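(* Let $(\mathcal{S}^x,H)$ be a finite thick skew translation generalized quadrangle of order $(s,t)$, where $s$ is odd if $s=t$, and suppose property ( * ) holds. Let $\mathbb{S}$ be its group of symmetries about $x$. Then: (i) for every line $L$ not incident with $x$, every element of the stabilizer $H_L$ fixes every line through the point $\mathrm{proj}_L x$; (ii) for every line $L$ not incident with $x$ and every nontrivial $\alpha\in H_L$, the set $[\alpha]$ of points of the line $x\,\mathrm{proj}_Lx$ that are incident with some line not through $x$ fixed by $\alpha$ has size $s/t$; in particular, if $s=t$ is odd, the lines not through $x$ fixed by $\alpha$ are precisely the $t$ lines through $\mathrm{proj}_Lx$ other than $x\,\mathrm{proj}_Lx$; (iii) $Z(H)=\mathbb{S}$.
   Context: A finite generalized quadrangle (GQ) of order $(s,t)$: every line has $s+1$ points, every point is on $t+1$ lines, two points are on at most one common line, and for each point $p$ not on a line $L$ there is a unique point of $L$ collinear with $p$, denoted $\mathrm{proj}_Lp$; thick means $s,t>1$. An elation generalized quadrangle $(\mathcal{S}^x,H)$: $H\le\mathrm{Aut}(\mathcal{S})$ fixes every line through $x$ and acts sharply transitively on the points not collinear with $x$. A symmetry about $x$ is an automorphism fixing every point collinear with $x$; the EGQ is a skew translation generalized quadrangle if $H$ contains a subgroup $\mathbb{S}$ of order $t$ consisting of symmetries about $x$. Property ( * ): whenever a point $y\neq x$ collinear with $x$ is fixed by some element $h\in H$, then $h$ fixes every point of the line $xy$. *)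

theory Defs
  imports Complex_Main
begin

(* An incidence structure: point set P, line set L, incidence relation I.
   An automorphism (collineation) is represented as a pair (f, g) of a point map
   and a line map; to make representatives unique they act as the identity
   outside P resp. L. *)

definition collinear :: "'p set \<Rightarrow> 'l set \<Rightarrow> ('p \<Rightarrow> 'l \<Rightarrow> bool) \<Rightarrow> 'p \<Rightarrow> 'p \<Rightarrow> bool" where
  "collinear P L I p q \<longleftrightarrow> (\<exists>l\<in>L. I p l \<and> I q l)"

definition generalized_quadrangle ::
  "'p set \<Rightarrow> 'l set \<Rightarrow> ('p \<Rightarrow> 'l \<Rightarrow> bool) \<Rightarrow> nat \<Rightarrow> nat \<Rightarrow> bool" where
  "generalized_quadrangle P L I s t \<longleftrightarrow>
     finite P \<and> finite L \<and>
     (\<forall>l\<in>L. card {p\<in>P. I p l} = s + 1) \<and>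
     (\<forall>p\<in>P. card {l\<in>L. I p l} = t + 1) \<and>
     (\<forall>p\<in>P. \<forall>q\<in>P. p \<noteq> q \<longrightarrow> card {l\<in>L. I p l \<and> I q l} \<le> 1) \<and>
     (\<forall>p\<in>P. \<forall>l\<in>L. \<not> I p l \<longrightarrow> (\<exists>!q. q \<in> P \<and> I q l \<and> collinear P L I p q))"

definition proj :: "'p set \<Rightarrow> 'l set \<Rightarrow> ('p \<Rightarrow> 'l \<Rightarrow> bool) \<Rightarrow> 'l \<Rightarrow> 'p \<Rightarrow> 'p" where
  "proj P L I l p = (THE q. q \<in> P \<and> I q l \<and> collinear P L I p q)"

definition automorphism ::
  "'p set \<Rightarrow> 'l set \<Rightarrow> ('p \<Rightarrow> 'l \<Rightarrow> bool) \<Rightarrow> ('p \<Rightarrow> 'p) \<times> ('l \<Rightarrow> 'l) \<Rightarrow> bool" where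
  "automorphism P L I h \<longleftrightarrow>
     bij_betw (fst h) P P \<and> bij_betw (snd h) L L \<and>
     (\<forall>p. p \<notin> P \<longrightarrow> fst h p = p) \<and> (\<forall>l. l \<notin> L \<longrightarrow> snd h l = l) \<and>
     (\<forall>p\<in>P. \<forall>l\<in>L. I (fst h p) (snd h l) \<longleftrightarrow> I p l)"

definition aut_id :: "('p \<Rightarrow> 'p) \<times> ('l \<Rightarrow> 'l)" where
  "aut_id = (id, id)"

definition aut_comp ::
  "('p \<Rightarrow> 'p) \<times> ('l \<Rightarrow> 'l) \<Rightarrow> ('p \<Rightarrow> 'p) \<times> ('l \<Rightarrow> 'l) \<Rightarrow> ('p \<Rightarrow> 'p) \<times> ('l \<Rightarrow> 'l)" where
  "aut_comp g h = (fst g \<circ> fst h, snd g \<circ> snd h)"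

definition aut_subgroup ::
  "'p set \<Rightarrow> 'l set \<Rightarrow> ('p \<Rightarrow> 'l \<Rightarrow> bool) \<Rightarrow> (('p \<Rightarrow> 'p) \<times> ('l \<Rightarrow> 'l)) set \<Rightarrow> bool" where
  "aut_subgroup P L I H \<longleftrightarrow>
     (\<forall>h\<in>H. automorphism P L I h) \<and> aut_id \<in> H \<and>
     (\<forall>g\<in>H. \<forall>h\<in>H. aut_comp g h \<in> H) \<and>
     (\<forall>h\<in>H. \<exists>g\<in>H. aut_comp h g = aut_id)"

definition center :: "(('p \<Rightarrow> 'p) \<times> ('l \<Rightarrow> 'l)) set \<Rightarrow> (('p \<Rightarrow> 'p) \<times> ('l \<Rightarrow> 'l)) set" where
  "center H = {h\<in>H. \<forall>g\<in>H. aut_comp h g = aut_comp g h}"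

definition symmetry_about ::
  "'p set \<Rightarrow> 'l set \<Rightarrow> ('p \<Rightarrow> 'l \<Rightarrow> bool) \<Rightarrow> 'p \<Rightarrow> ('p \<Rightarrow> 'p) \<times> ('l \<Rightarrow> 'l) \<Rightarrow> bool" where
  "symmetry_about P L I x h \<longleftrightarrow> automorphism P L I h \<and>
     (\<forall>y\<in>P. collinear P L I x y \<longrightarrow> fst h y = y)"

definition elation_GQ ::
  "'p set \<Rightarrow> 'l set \<Rightarrow> ('p \<Rightarrow> 'l \<Rightarrow> bool) \<Rightarrow> nat \<Rightarrow> nat \<Rightarrow> 'p \<Rightarrow>
   (('p \<Rightarrow> 'p) \<times> ('l \<Rightarrow> 'l)) set \<Rightarrow> bool" where
  "elation_GQ P L I s t x H \<longleftrightarrow>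
     generalized_quadrangle P L I s t \<and> x \<in> P \<and> aut_subgroup P L I H \<and>
     (\<forall>h\<in>H. \<forall>l\<in>L. I x l \<longrightarrow> snd h l = l) \<and>
     (\<forall>y\<in>P. \<forall>z\<in>P. \<not> collinear P L I x y \<longrightarrow> \<not> collinear P L I x z \<longrightarrow>
         (\<exists>!h. h \<in> H \<and> fst h y = z))"

definition skew_translation_GQ ::
  "'p set \<Rightarrow> 'l set \<Rightarrow> ('p \<Rightarrow> 'l \<Rightarrow> bool) \<Rightarrow> nat \<Rightarrow> nat \<Rightarrow> 'p \<Rightarrow>
   (('p \<Rightarrow> 'p) \<times> ('l \<Rightarrow> 'l)) set \<Rightarrow> (('p \<Rightarrow> 'p) \<times> ('l \<Rightarrow> 'l)) set \<Rightarrow> bool" where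
  "skew_translation_GQ P L I s t x H S \<longleftrightarrow>
     elation_GQ P L I s t x H \<and> S \<subseteq> H \<and> aut_subgroup P L I S \<and> card S = t \<and>
     (\<forall>h\<in>S. symmetry_about P L I x h)"

definition property_star ::
  "'p set \<Rightarrow> 'l set \<Rightarrow> ('p \<Rightarrow> 'l \<Rightarrow> bool) \<Rightarrow> 'p \<Rightarrow>
   (('p \<Rightarrow> 'p) \<times> ('l \<Rightarrow> 'l)) set \<Rightarrow> bool" where
  "property_star P L I x H \<longleftrightarrow>
     (\<forall>y\<in>P. \<forall>h\<in>H. y \<noteq> x \<longrightarrow> collinear P L I x y \<longrightarrow> fst h y = y \<longrightarrow>
        (\<forall>l\<in>L. I x l \<longrightarrow> I y l \<longrightarrow> (\<forall>z\<in>P. I z l \<longrightarrow> fst h z = z)))"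

(* [alpha]: points of the line x p (p = proj_L x) lying on some line not through x fixed by alpha *)
definition bracket ::
  "'p set \<Rightarrow> 'l set \<Rightarrow> ('p \<Rightarrow> 'l \<Rightarrow> bool) \<Rightarrow> 'p \<Rightarrow> 'p \<Rightarrow>
   ('p \<Rightarrow> 'p) \<times> ('l \<Rightarrow> 'l) \<Rightarrow> 'p set" where
  "bracket P L I x p \<alpha> =
     {z\<in>P. (\<exists>N\<in>L. I x N \<and> I p N \<and> I z N) \<and>
           (\<exists>M\<in>L. \<not> I x M \<and> snd \<alpha> M = M \<and> I z M)}"

end

theory Submission
  imports
    "HOL-Algebra.Multiplicative_Group"
    "HOL-Algebra.Sylow"
    "HOL-Combinatorics.Cycles"
    "Jordan_Normal_Form.Char_Poly"
    Defs
begin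

text \<open>
  By \<open>property_star\<close>, for each line \<open>N\<close> on \<open>x\<close> the stabilizer in \<open>H\<close> of a point of \<open>N\<close> other than \<open>x\<close> is the
  pointwise stabilizer \<open>K N\<close> of \<open>N\<close>, hence normal. Two of these meet in \<open>S\<close> and generate \<open>H\<close>, and there
  are at least three, so \<open>H / S\<close> is abelian; \<open>K N\<close> is the product of \<open>S\<close> and the stabilizer \<open>A\<close> of any
  line meeting \<open>N\<close> outside \<open>x\<close>.

  If \<open>g\<close> in \<open>K N - S\<close> fixes no line off \<open>x\<close>, Benson's congruence says that \<open>s + t\<close> divides \<open>s t\<close>. Counting
  elements of order \<open>p\<close> in \<open>H / S\<close> shows that \<open>t\<close> is at most the \<open>p\<close>-torsion of \<open>A\<close> for each prime \<open>p\<close>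
  dividing \<open>s\<close>, which excludes this divisibility (the hypothesis on the parity of \<open>s\<close> is what is needed when
  \<open>s = t\<close>). Therefore every \<open>g\<close> in \<open>K N - S\<close> is conjugate into \<open>A\<close>: the conjugacy class of a nontrivial
  \<open>a \<in> A\<close> is the whole coset \<open>a S\<close>. This forces \<open>H\<close> to be a \<open>p\<close>-group and then \<open>S\<close> to be central. Centrality
  gives (i) because \<open>S\<close> is transitive on the lines off \<open>x\<close> through a point collinear with \<open>x\<close>; (ii) follows
  because the lines off \<open>x\<close> fixed by \<open>\<alpha>\<close> form one orbit of the centralizer of \<open>\<alpha>\<close>, which has order \<open>s\<^sup>2\<close>.
\<close>

section \<open>Traces of periodic rational matrices\<close>

text \<open>Everything known about conjugacy concerns elements of \<open>K N\<close> outside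
  \<open>S\<close>, whereas centrality is a statement about \<open>S\<close> itself. The bridge is
  to find enough elements outside \<open>S\<close> that commute with \<open>S\<close>. Passing to a
  quotient helps because there the commutators with a fixed element of \<open>S\<close> take at most
  \<open>p\<close> values, so its centralizer has index at most \<open>p\<close>; an element of
  \<open>H\<close> that does not centralize \<open>S\<close> loses a factor of at least
  \<open>p\<close>. These two bounds meet exactly, and comparing them makes the centralizer of
  \<open>S\<close> large. The torsion bound is used three times: it refutes the divisibility, it
  makes the class of an element of \<open>S\<close> of the wrong prime order too long, and it gives
  \<open>t \<le> s\<close>, which pushes the large centralizer out of \<open>S\<close>. In Benson's
  congruence the obstacle is that a trace made of roots of unity lives in an extension field. It is
  read off a rational characteristic polynomial instead, which divides a power of
  \<open>X^(m+1) - X\<close>; Gauss's lemma then makes it an integer.\<close>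

lemma coeff_char_poly_trace:
  fixes A :: "'a :: {idom, ring_char_0} mat"
  assumes "A \<in> carrier_mat (Suc n) (Suc n)"
  shows "coeff (char_poly A) n = - (\<Sum>i<Suc n. A $$ (i, i))"
  using assms
proof (induction n arbitrary: A)
  case 0
  then show ?case
    by (simp add: char_poly_defs det_single)
next
  case (Suc n)
  let ?N = "Suc (Suc n)"
  let ?tr = "\<Sum>i<?N. A $$ (i, i)"
  have del: "coeff (char_poly (mat_delete A i i)) n = A $$ (i, i) - ?tr" if "i < ?N" for i
  proof -
    have "coeff (char_poly (mat_delete A i i)) n = - (\<Sum>j<Suc n. mat_delete A i i $$ (j, j))"
      using Suc.prems by (intro Suc.IH) auto
    also have "(\<Sum>j<Suc n. mat_delete A i i $$ (j, j))
        = (\<Sum>j<Suc n. A $$ (insert_index i j, insert_index i j))"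
      using Suc.prems that
      by (intro sum.cong refl mat_delete_index[symmetric]) auto
    also have "\<dots> = (\<Sum>j\<in>insert_index i ` {..<Suc n}. A $$ (j, j))"
      by (subst sum.reindex) (auto intro: insert_index_inj_on)
    also have "insert_index i ` {..<Suc n} = {..<?N} - {i}"
      using insert_index_image[of i "Suc n"] that by (simp add: atLeast0LessThan)
    also have "(\<Sum>j\<in>{..<?N} - {i}. A $$ (j, j)) = ?tr - A $$ (i, i)"
      using that by (subst sum_diff1) auto
    finally show ?thesis by simp
  qed
  \<comment> \<open>The derivative of the characteristic polynomial is the sum of those of the
    principal minors with one index deleted. The \<open>n + 2\<close> minors contribute
    \<open>tr - (n + 2) tr = - (n + 1) tr\<close>, and characteristic 0 permits cancelling
    \<open>n + 1\<close>.\<close>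
  have "of_nat (Suc n) * coeff (char_poly A) (Suc n) = coeff (pderiv (char_poly A)) n"
    by (simp add: coeff_pderiv)
  also have "\<dots> = (\<Sum>i<?N. A $$ (i, i) - ?tr)"
    unfolding pderiv_char_poly[OF Suc.prems] coeff_sum
    by (intro sum.cong refl del) auto
  also have "\<dots> = of_nat (Suc n) * (- ?tr)"
    by (simp only: sum_subtractf sum_constant) (simp add: algebra_simps)
  finally show ?case
    using mult_left_cancel[of "of_nat (Suc n) :: 'a"] by (metis of_nat_neq_0)
qed

text \<open>Over the polynomial ring \<open>X I - Y\<close> divides \<open>X^k I - Y^k\<close>. For
  \<open>k = m + 1\<close> periodicity replaces \<open>Y^k\<close> by \<open>Y\<close>, and
  subtracting \<open>X I - Y\<close> once more leaves the scalar matrix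
  \<open>(X^(m+1) - X) I\<close>. Taking determinants gives the claim; this is where the exponent
  \<open>n\<close> comes from.\<close>

lemma char_poly_dvd_annihilator:
  fixes Y :: "'a :: idom mat"
  assumes Y: "Y \<in> carrier_mat n n" and per: "Y ^\<^sub>m Suc m = Y"
  shows "char_poly Y dvd (monom 1 (Suc m) - monom 1 1) ^ n"
proof -
  let ?Y = "map_mat (\<lambda>a. [:a:]) Y"
  let ?C = "monom 1 1 \<cdot>\<^sub>m 1\<^sub>m n - ?Y :: 'a poly mat"
  have Yc: "?Y \<in> carrier_mat n n" and Cc: "?C \<in> carrier_mat n n"
    using Y by auto
  have hom: "?Y ^\<^sub>m k = map_mat (\<lambda>a. [:a:]) (Y ^\<^sub>m k)" for k
  proof -
    interpret comm_ring_hom "\<lambda>a::'a. [:a:]"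
      by unfold_locales (auto simp: one_pCons)
    show ?thesis using mat_hom_pow[OF Y] by simp
  qed
  have ex: "\<exists>B\<in>carrier_mat n n. ?C * B = monom 1 k \<cdot>\<^sub>m 1\<^sub>m n - ?Y ^\<^sub>m k" for k
  proof (induction k)
    case 0
    show ?case
      using Y Cc by (intro bexI[of _ "0\<^sub>m n n"]) (auto simp: right_mult_zero_mat[OF Cc] one_pCons monom_0)
  next
    case (Suc k)
    then obtain B where B: "B \<in> carrier_mat n n" "?C * B = monom 1 k \<cdot>\<^sub>m 1\<^sub>m n - ?Y ^\<^sub>m k" by auto
    let ?P = "?Y ^\<^sub>m k"
    have P: "?P \<in> carrier_mat n n" using Yc by simp
    have comm: "?Y * ?P = ?P * ?Y"
    proof (induction k)
      case (Suc k)
      have Pk: "?Y ^\<^sub>m k \<in> carrier_mat n n" using Yc by simp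
      have "?Y * (?Y ^\<^sub>m k * ?Y) = (?Y * ?Y ^\<^sub>m k) * ?Y"
        by (rule assoc_mult_mat[OF Yc Pk Yc, symmetric])
      then show ?case using Suc.IH by simp
    qed (use Yc in auto)
    have "?C * (monom 1 1 \<cdot>\<^sub>m B + ?P) = monom 1 1 \<cdot>\<^sub>m (?C * B) + ?C * ?P"
      using B Cc P by (simp add: mult_add_distrib_mat[of _ n n _ n] mult_smult_distrib[of _ n n _ n])
    also have "?C * ?P = monom 1 1 \<cdot>\<^sub>m ?P - ?Y ^\<^sub>m Suc k"
      using P Yc Cc by (simp add: minus_mult_distrib_mat[of _ n n _ _ n] mult_smult_assoc_mat[of _ n n _ n] comm)
    also have "monom 1 1 \<cdot>\<^sub>m (?C * B) + (monom 1 1 \<cdot>\<^sub>m ?P - ?Y ^\<^sub>m Suc k)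
        = monom 1 (Suc k) \<cdot>\<^sub>m 1\<^sub>m n - ?Y ^\<^sub>m Suc k"
      unfolding B(2) using P Yc
      by (intro eq_matI) (auto simp: algebra_simps mult_monom)
    finally show ?case
      using B P by (intro bexI[of _ "monom 1 1 \<cdot>\<^sub>m B + ?P"]) auto
  qed
  obtain B where B: "B \<in> carrier_mat n n" "?C * B = monom 1 (Suc m) \<cdot>\<^sub>m 1\<^sub>m n - ?Y ^\<^sub>m Suc m"
    using ex by blast
  have "?C * (B - 1\<^sub>m n) = ?C * B - ?C * 1\<^sub>m n"
    using B Cc by (intro mult_minus_distrib_mat[of _ n n _ n]) auto
  also have "\<dots> = (monom 1 (Suc m) - monom 1 1) \<cdot>\<^sub>m 1\<^sub>m n"
    unfolding B(2) hom per using Y Cc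
    by (intro eq_matI) (auto simp: right_mult_one_mat[OF Cc])
  finally have "det (?C * (B - 1\<^sub>m n)) = (monom 1 (Suc m) - monom 1 1) ^ n"
    by (simp add: det_smult)
  moreover have "det (?C * (B - 1\<^sub>m n)) = det ?C * det (B - 1\<^sub>m n)"
    using B Cc by (intro det_mult) auto
  moreover have "char_poly Y = det ?C"
    unfolding char_poly_defs using Y
    by (intro arg_cong[where f = det] eq_matI) (auto simp: monom_altdef)
  ultimately show ?thesis by (metis dvd_triv_left)
qed

lemma rat_poly_clear_denominators:
  fixes f :: "rat poly"
  obtains a F where "a > 0" "Polynomial.smult (of_int a) f = map_poly of_int F"
proof -
  have "\<exists>a>0. \<exists>F. Polynomial.smult (of_int a) f = map_poly of_int F"
  proof (induction f)
    case 0
    show ?case by (intro exI[of _ 1] conjI exI[of _ 0]) auto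
  next
    case (pCons c f)
    then obtain a F where a: "a > 0" "Polynomial.smult (of_int a) f = map_poly of_int F" by auto
    obtain p q where q: "q > 0" "c = of_int p / of_int q"
      by (metis quotient_of_div quotient_of_denom_pos surj_pair)
    have "Polynomial.smult (of_int (a * q)) (pCons c f) = map_poly of_int (pCons (a * p) (Polynomial.smult q F))"
    proof -
      have "Polynomial.smult (of_int (a * q)) f = Polynomial.smult (of_int q) (Polynomial.smult (of_int a) f)" by (simp add: mult.commute)
      also have "\<dots> = map_poly of_int (Polynomial.smult q F)"
        unfolding a(2) by (intro poly_eqI) (simp add: coeff_map_poly)
      finally show ?thesis using q
        by (intro poly_eqI) (auto simp: coeff_pCons coeff_map_poly poly_eq_iff split: nat.splits)
    qed
    then show ?case using a q by (intro exI[of _ "a * q"]) auto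
  qed
  then show ?thesis using that by blast
qed

text \<open>Gauss's lemma. If \<open>a\<close> and \<open>b\<close> clear the denominators of the
  monic factors, they are the leading coefficients of the cleared polynomials, so the contents
  divide \<open>a\<close> and \<open>b\<close>. Contents are multiplicative and the monic
  \<open>g\<close> has content 1, so the two contents multiply to \<open>a * b\<close>. Hence the
  first one is \<open>a\<close> itself, and dividing by \<open>a\<close> stays integral.\<close>

lemma monic_rat_factor_of_int_poly:
  fixes f h :: "rat poly"
  assumes f: "lead_coeff f = 1" and h: "lead_coeff h = 1"
    and fh: "f * h = map_poly of_int g"
  shows "coeff f i \<in> \<int>"
proof -
  have inj: "map_poly of_int p = (map_poly of_int q :: rat poly) \<longleftrightarrow> p = q" for p q :: "int poly"
    by (auto simp: poly_eq_iff coeff_map_poly)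
  have gl: "lead_coeff g = 1"
  proof -
    have "of_int (lead_coeff g) = lead_coeff (map_poly of_int g :: rat poly)"
      by (simp add: degree_map_poly coeff_map_poly)
    then show ?thesis using f h unfolding fh[symmetric] lead_coeff_mult by simp
  qed
  have cg: "content g = 1"
    using content_dvd_coeff[of g "degree g"] unfolding gl is_unit_content_iff .
  obtain a F where a: "a > 0" "Polynomial.smult (of_int a) f = map_poly of_int F"
    by (rule rat_poly_clear_denominators)
  obtain b E where b: "b > 0" "Polynomial.smult (of_int b) h = map_poly of_int E"
    by (rule rat_poly_clear_denominators)
  have lead: "lead_coeff F' = c" if "Polynomial.smult (of_int c) f' = map_poly of_int F'" "lead_coeff f' = 1"
    for c F' and f' :: "rat poly"
  proof -
    have "of_int (lead_coeff F') = lead_coeff (map_poly of_int F' :: rat poly)"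
      by (simp add: degree_map_poly coeff_map_poly)
    then show ?thesis using that unfolding that(1)[symmetric] by (simp split: if_splits)
  qed
  have "content F dvd a" "content E dvd b"
    using lead[OF a(2) f] lead[OF b(2) h] content_dvd_coeff by metis+
  have "map_poly of_int (F * E) = (map_poly of_int (Polynomial.smult (a * b) g) :: rat poly)"
  proof -
    have "map_poly of_int (F * E) = Polynomial.smult (of_int a) f * Polynomial.smult (of_int b) h"
      unfolding a(2) b(2) by (intro poly_eqI) (simp add: coeff_map_poly coeff_mult)
    also have "\<dots> = Polynomial.smult (of_int (a * b)) (map_poly of_int g)"
      using fh by (simp add: mult.commute)
    also have "\<dots> = map_poly of_int (Polynomial.smult (a * b) g)"
      by (intro poly_eqI) (simp add: coeff_map_poly)
    finally show ?thesis .
  qed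
  then have "F * E = Polynomial.smult (a * b) g" using inj by blast
  then have "content (F * E) = a * b"
    using cg a b by simp
  then have ab: "content F * content E = a * b"
    by (simp add: content_mult)
  have "content F = a"
  proof (rule ccontr)
    have le: "content F \<le> a" "content E \<le> b"
      using \<open>content F dvd a\<close> \<open>content E dvd b\<close> a b by (auto intro: zdvd_imp_le)
    have "0 \<le> content F" "0 \<le> content E"
      by (metis abs_ge_zero normalize_content normalize_int_def)+
    moreover have "content E \<noteq> 0" using ab a b by auto
    moreover assume "content F \<noteq> a"
    ultimately have "content F * content E < a * b"
      using le by (intro mult_less_le_imp_less) auto
    then show False using ab by simp
  qed
  then have "a dvd coeff F i" using content_dvd_coeff by metis
  then obtain c where "coeff F i = a * c" by auto
  moreover have "of_int a * coeff f i = of_int (coeff F i)"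
    using arg_cong[OF a(2), of "\<lambda>p. coeff p i"] by (simp add: coeff_map_poly)
  ultimately have "coeff f i = of_int c" using a by simp
  then show ?thesis by simp
qed

text \<open>The eigenvalues are 0 or roots of unity, so the trace is a rational algebraic integer.
  In terms of polynomials: \<open>char_poly Y\<close> is a monic rational factor of a power of
  \<open>X^(m+1) - X\<close>, which is monic with integer coefficients because
  \<open>m > 0\<close>.\<close>

lemma trace_periodic_rat_mat_in_Ints:
  fixes Y :: "rat mat"
  assumes Y: "Y \<in> carrier_mat n n" and per: "Y ^\<^sub>m Suc m = Y" and m: "m > 0"
  shows "(\<Sum>i<n. Y $$ (i, i)) \<in> \<int>"
proof (cases n)
  case (Suc k)
  let ?p = "monom 1 (Suc m) - monom 1 1"
  obtain h where h: "(?p :: rat poly) ^ n = char_poly Y * h"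
    using char_poly_dvd_annihilator[OF Y per] by (auto elim: dvdE)
  have lp: "lead_coeff (?p :: rat poly) = 1"
  proof -
    have "degree (?p :: rat poly) = Suc m"
      using m by (subst diff_conv_add_uminus, subst degree_add_eq_left)
        (auto simp: degree_monom_eq)
    then show ?thesis using m by simp
  qed
  have lc: "lead_coeff (char_poly Y) = 1"
    using degree_monic_char_poly[OF Y] by auto
  have "lead_coeff ((?p :: rat poly) ^ n) = 1"
    by (simp only: lead_coeff_power lp power_one)
  then have "lead_coeff h = 1"
    unfolding h lead_coeff_mult lc by simp
  moreover have "char_poly Y * h = map_poly of_int (?p ^ n :: int poly)"
  proof -
    interpret map_poly_comm_ring_hom "of_int :: int \<Rightarrow> rat" ..
    show ?thesis unfolding h[symmetric] by (simp add: hom_distribs)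
  qed
  ultimately have "coeff (char_poly Y) k \<in> \<int>"
    using lc by (intro monic_rat_factor_of_int_poly)
  then show ?thesis
    using coeff_char_poly_trace[of Y k] Y Suc by (simp add: minus_in_Ints_iff del: sum.lessThan_Suc)
qed auto

section \<open>Benson's congruence\<close>

text \<open>The kernel is an idempotent matrix \<open>E\<close> commuting with the permutation
  matrix of \<open>\<theta>\<close>. Their product \<open>Y\<close> has powers that again are
  \<open>E\<close> twisted by powers of \<open>\<theta>\<close>, so \<open>Y\<close> is periodic
  because \<open>\<theta>\<close> has finite order, and its trace is the sum in question.\<close>

lemma idempotent_kernel_twisted_trace:
  fixes e :: "'a \<Rightarrow> 'a \<Rightarrow> rat"
  assumes fin: "finite A" and th: "bij_betw \<theta> A A"
    and inv: "\<And>p q. p \<in> A \<Longrightarrow> q \<in> A \<Longrightarrow> e (\<theta> p) (\<theta> q) = e p q"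
    and idem: "\<And>p q. p \<in> A \<Longrightarrow> q \<in> A \<Longrightarrow> (\<Sum>r\<in>A. e p r * e r q) = e p q"
  shows "(\<Sum>p\<in>A. e (\<theta> p) p) \<in> \<int>"
proof -
  define n where "n = card A"
  obtain f where f: "bij_betw f {..<n} A"
    using ex_bij_betw_nat_finite[OF fin] unfolding n_def atLeast0LessThan by blast
  have fA: "f i \<in> A" if "i < n" for i
    using f that by (auto dest: bij_betwE)
  have thA: "(\<theta> ^^ k) p \<in> A" if "p \<in> A" for k p
    by (induction k) (use that th in \<open>auto dest: bij_betwE\<close>)
  \<comment> \<open>Extending \<open>\<theta>\<close> by the identity gives a permutation of the
    whole type, for which a finite order is available.\<close>
  define \<pi> where "\<pi> = (\<lambda>p. if p \<in> A then \<theta> p else p)"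
  have "bij_betw \<pi> A A"
    using th by (rule bij_betw_cong[THEN iffD1, rotated]) (simp add: \<pi>_def)
  then have "\<pi> permutes A"
    by (rule bij_imp_permutes) (simp add: \<pi>_def)
  then have "permutation \<pi>"
    using fin unfolding permutation_permutes by blast
  then obtain m where m: "m > 0" "\<pi> ^^ m = id"
    using permutation_is_nilpotent by blast
  have pow: "(\<pi> ^^ k) p = (\<theta> ^^ k) p" if "p \<in> A" for k p
    by (induction k) (use that thA in \<open>auto simp: \<pi>_def\<close>)
  define Y where "Y = mat n n (\<lambda>(i, j). e (\<theta> (f i)) (f j))"
  have Y: "Y \<in> carrier_mat n n" by (simp add: Y_def)
  have inv': "e ((\<theta> ^^ k) p) ((\<theta> ^^ k) q) = e p q" if "p \<in> A" "q \<in> A" for k p q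
    by (induction k) (use that inv thA in auto)
  have Yk: "(Y ^\<^sub>m Suc k) $$ (i, j) = e ((\<theta> ^^ Suc k) (f i)) (f j)" if "i < n" "j < n" for k i j
    using that
  proof (induction k arbitrary: i j)
    case 0
    then show ?case using Y by (simp add: Y_def)
  next
    case (Suc k)
    have "(Y ^\<^sub>m Suc (Suc k)) $$ (i, j) = (\<Sum>l<n. (Y ^\<^sub>m Suc k) $$ (i, l) * Y $$ (l, j))"
      using Y Suc.prems pow_carrier_mat[OF Y, of "Suc k"]
      by (subst pow_mat.simps, subst index_mult_mat)
        (auto simp: scalar_prod_def atLeast0LessThan simp del: pow_mat.simps intro!: sum.cong)
    also have "\<dots> = (\<Sum>l<n. e ((\<theta> ^^ Suc (Suc k)) (f i)) (\<theta> (f l)) * e (\<theta> (f l)) (f j))"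
    proof (intro sum.cong refl)
      fix l assume "l \<in> {..<n}"
      then have "(Y ^\<^sub>m Suc k) $$ (i, l) = e ((\<theta> ^^ Suc k) (f i)) (f l)"
        using Suc by blast
      also have "\<dots> = e ((\<theta> ^^ Suc (Suc k)) (f i)) (\<theta> (f l))"
        using \<open>l \<in> {..<n}\<close> Suc.prems fA thA inv[of "(\<theta> ^^ Suc k) (f i)" "f l"]
        by (metis funpow.simps(2) lessThan_iff o_apply)
      finally show "(Y ^\<^sub>m Suc k) $$ (i, l) * Y $$ (l, j)
          = e ((\<theta> ^^ Suc (Suc k)) (f i)) (\<theta> (f l)) * e (\<theta> (f l)) (f j)"
        using \<open>l \<in> {..<n}\<close> Suc.prems by (simp add: Y_def)
    qed
    also have "\<dots> = (\<Sum>r\<in>A. e ((\<theta> ^^ Suc (Suc k)) (f i)) (\<theta> r) * e (\<theta> r) (f j))"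
      using f by (rule sum.reindex_bij_betw)
    also have "\<dots> = (\<Sum>r\<in>A. e ((\<theta> ^^ Suc (Suc k)) (f i)) r * e r (f j))"
      using th by (rule sum.reindex_bij_betw)
    also have "\<dots> = e ((\<theta> ^^ Suc (Suc k)) (f i)) (f j)"
      using Suc.prems fA thA[of "f i" "Suc (Suc k)"] by (intro idem) blast+
    finally show ?case .
  qed
  have "Y ^\<^sub>m Suc m = Y"
  proof (rule eq_matI)
    fix i j assume "i < dim_row Y" "j < dim_col Y"
    then have ij: "i < n" "j < n" using Y by auto
    have "(\<theta> ^^ Suc m) (f i) = \<theta> (f i)"
      using pow[OF fA[OF ij(1)], of m] m by simp
    then show "(Y ^\<^sub>m Suc m) $$ (i, j) = Y $$ (i, j)"
      using Yk[OF ij] ij by (simp add: Y_def)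
  qed (use Y in auto)
  from trace_periodic_rat_mat_in_Ints[OF Y this m(1)]
  have "(\<Sum>i<n. Y $$ (i, i)) \<in> \<int>" .
  also have "(\<Sum>i<n. Y $$ (i, i)) = (\<Sum>i<n. e (\<theta> (f i)) (f i))"
    by (simp add: Y_def)
  also have "\<dots> = (\<Sum>p\<in>A. e (\<theta> p) p)"
    using f by (rule sum.reindex_bij_betw)
  finally show ?thesis .
qed

section \<open>The matrix of common lines of a generalized quadrangle\<close>

locale gq =
  fixes P :: "'p set" and L :: "'l set" and I :: "'p \<Rightarrow> 'l \<Rightarrow> bool" and s t :: nat
  assumes gq: "generalized_quadrangle P L I s t" and s0: "s > 0"
begin

lemma finite_P: "finite P" and finite_L: "finite L"
  using gq by (auto simp: generalized_quadrangle_def)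

lemma card_points: "l \<in> L \<Longrightarrow> card {p \<in> P. I p l} = s + 1"
  using gq by (auto simp: generalized_quadrangle_def)

lemma card_lines: "p \<in> P \<Longrightarrow> card {l \<in> L. I p l} = t + 1"
  using gq by (auto simp: generalized_quadrangle_def)

lemma line_unique:
  assumes "p \<in> P" "q \<in> P" "p \<noteq> q" "l \<in> L" "m \<in> L" "I p l" "I q l" "I p m" "I q m"
  shows "l = m"
proof -
  have "card {l \<in> L. I p l \<and> I q l} \<le> 1"
    using gq assms by (auto simp: generalized_quadrangle_def)
  then show ?thesis
    using assms finite_L card_le_Suc0_iff_eq[of "{l \<in> L. I p l \<and> I q l}"] by auto
qed

lemma proj_ex1:
  assumes "p \<in> P" "l \<in> L" "\<not> I p l"
  shows "\<exists>!q. q \<in> P \<and> I q l \<and> collinear P L I p q"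
  using gq assms by (auto simp: generalized_quadrangle_def)

lemma proj_unique:
  assumes "p \<in> P" "l \<in> L" "\<not> I p l"
    and "q \<in> P" "I q l" "collinear P L I p q" "r \<in> P" "I r l" "collinear P L I p r"
  shows "q = r"
  using proj_ex1[OF assms(1-3)] assms by blast

lemma proj_line_ex1:
  assumes "p \<in> P" "l \<in> L" "\<not> I p l"
  shows "\<exists>!(q, m). q \<in> P \<and> I q l \<and> m \<in> L \<and> I p m \<and> I q m"
proof -
  obtain q where q: "q \<in> P" "I q l" "collinear P L I p q"
    and uq: "\<And>r. r \<in> P \<Longrightarrow> I r l \<Longrightarrow> collinear P L I p r \<Longrightarrow> r = q"
    using proj_ex1[OF assms] by metis
  obtain m where m: "m \<in> L" "I p m" "I q m" using q by (auto simp: collinear_def)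
  show ?thesis
  proof (rule ex1I[of _ "(q, m)"])
    fix y assume "case y of (q, m) \<Rightarrow> q \<in> P \<and> I q l \<and> m \<in> L \<and> I p m \<and> I q m"
    then obtain q' m' where y: "y = (q', m')" "q' \<in> P" "I q' l" "m' \<in> L" "I p m'" "I q' m'"
      by (cases y) auto
    have "q' = q" using uq y by (auto simp: collinear_def)
    moreover have "m' = m"
      using line_unique[of p q m' m] y m q assms \<open>q' = q\<close> by auto
    ultimately show "y = (q, m)" using y by simp
  qed (use q m in auto)
qed

text \<open>This is the matrix \<open>M = B B^T\<close> for the point-line incidence matrix
  \<open>B\<close>: the collinearity graph with \<open>t + 1\<close> added on the diagonal.\<close>

definition common_lines :: "'p \<Rightarrow> 'p \<Rightarrow> nat" where
  "common_lines p q = card {l \<in> L. I p l \<and> I q l}"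

lemma common_lines_self: "p \<in> P \<Longrightarrow> common_lines p p = t + 1"
  using card_lines by (simp add: common_lines_def)

lemma common_lines_distinct:
  assumes "p \<in> P" "q \<in> P" "p \<noteq> q"
  shows "common_lines p q = (if collinear P L I p q then 1 else 0)"
proof (cases "collinear P L I p q")
  case True
  then obtain l where "l \<in> L" "I p l" "I q l" by (auto simp: collinear_def)
  then have "{l \<in> L. I p l \<and> I q l} = {l}" using line_unique[OF assms] by auto
  then show ?thesis using True by (simp add: common_lines_def)
next
  case False
  then have "{l \<in> L. I p l \<and> I q l} = {}" by (auto simp: collinear_def)
  then have "common_lines p q = 0" by (simp only: common_lines_def card.empty)
  then show ?thesis using False by simp
qed

text \<open>In matrix form \<open>M^2 = (t + 1) J + (s + t) M\<close>. The left side counts paths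
  \<open>p\<close>, \<open>l\<close>, \<open>r\<close>, \<open>m\<close>, \<open>q\<close>. For a
  line \<open>m\<close> on \<open>q\<close> that misses \<open>p\<close> the quadrangle axiom leaves
  exactly one path. If \<open>m\<close> passes through \<open>p\<close> there are \<open>s\<close>
  paths with \<open>r \<noteq> p\<close>, which force \<open>l = m\<close>, and \<open>t + 1\<close>
  with \<open>r = p\<close>.\<close>

lemma common_lines_comp:
  assumes p: "p \<in> P" and q: "q \<in> P"
  shows "(\<Sum>r\<in>P. common_lines p r * common_lines r q) = (t + 1) + (s + t) * common_lines p q"
proof -
  let ?T = "\<lambda>m. {(r, l). r \<in> P \<and> I r m \<and> l \<in> L \<and> I p l \<and> I r l}"
  have finT: "finite (?T m)" for m
    by (rule finite_subset[of _ "P \<times> L"]) (auto simp: finite_P finite_L)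
  have T1: "card (?T m) = 1" if m: "m \<in> L" "\<not> I p m" for m
  proof -
    obtain y where "y \<in> ?T m" "\<And>z. z \<in> ?T m \<Longrightarrow> z = y"
      using proj_line_ex1[OF p m] unfolding mem_Collect_eq by (elim ex1E) blast
    then have "?T m = {y}" by blast
    then show ?thesis by simp
  qed
  have T2: "card (?T m) = s + t + 1" if m: "m \<in> L" "I p m" for m
  proof -
    have "?T m = (\<lambda>r. (r, m)) ` {r \<in> P. I r m \<and> r \<noteq> p} \<union> (\<lambda>l. (p, l)) ` {l \<in> L. I p l}"
    proof (intro equalityI subsetI)
      fix z assume "z \<in> ?T m"
      then obtain r l where z: "z = (r, l)" "r \<in> P" "I r m" "l \<in> L" "I p l" "I r l" by auto
      show "z \<in> (\<lambda>r. (r, m)) ` {r \<in> P. I r m \<and> r \<noteq> p} \<union> (\<lambda>l. (p, l)) ` {l \<in> L. I p l}"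
      proof (cases "r = p")
        case False
        then have "l = m" using line_unique[OF p z(2)] z m by auto
        then show ?thesis using z False by auto
      qed (use z in auto)
    qed (use m p in auto)
    then have "card (?T m) = card ((\<lambda>r. (r, m)) ` {r \<in> P. I r m \<and> r \<noteq> p}) + card ((\<lambda>l. (p, l)) ` {l \<in> L. I p l})"
      using finite_P finite_L by (simp only:) (subst card_Un_disjoint; auto)
    also have "card ((\<lambda>r. (r, m)) ` {r \<in> P. I r m \<and> r \<noteq> p}) = card {r \<in> P. I r m \<and> r \<noteq> p}"
      by (rule card_image) (auto simp: inj_on_def)
    also have "{r \<in> P. I r m \<and> r \<noteq> p} = {r \<in> P. I r m} - {p}" by auto
    also have "card \<dots> = s" using card_points[OF m(1)] p m finite_P by (subst card_Diff_singleton) auto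
    also have "card ((\<lambda>l. (p, l)) ` {l \<in> L. I p l}) = card {l \<in> L. I p l}"
      by (rule card_image) (auto simp: inj_on_def)
    finally show ?thesis using card_lines[OF p] by simp
  qed
  have "(\<Sum>r\<in>P. common_lines p r * common_lines r q)
      = card (SIGMA r:P. {l \<in> L. I p l \<and> I r l} \<times> {m \<in> L. I r m \<and> I q m})"
    using finite_P finite_L by (subst card_SigmaI) (auto simp: common_lines_def card_cartesian_product)
  also have "\<dots> = card (SIGMA m:{m \<in> L. I q m}. ?T m)"
    by (rule bij_betw_same_card[of "\<lambda>(r, l, m). (m, r, l)"],
        rule bij_betwI[where g = "\<lambda>(m, r, l). (r, l, m)"]) auto
  also have "\<dots> = (\<Sum>m | m \<in> L \<and> I q m. card (?T m))"
    using finite_L finT by (subst card_SigmaI) auto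
  also have "\<dots> = (\<Sum>m | m \<in> L \<and> I q m. 1 + (if I p m then s + t else 0))"
    using T1 T2 by (intro sum.cong) auto
  also have "\<dots> = (t + 1) + (s + t) * card {m \<in> L. I q m \<and> I p m}"
  proof -
    have "(\<Sum>m | m \<in> L \<and> I q m. if I p m then s + t else 0)
        = (\<Sum>m | m \<in> {m \<in> L. I q m} \<and> I p m. s + t)"
      using finite_L sum.inter_filter[of "{m \<in> L. I q m}" "\<lambda>_. s + t" "I p"] by simp
    then show ?thesis
      unfolding sum.distrib using card_lines[OF q] by (simp add: conj_ac mult.commute add_mult_distrib)
  qed
  finally show ?thesis by (simp add: common_lines_def conj_ac)
qed

lemma common_lines_sum:
  assumes p: "p \<in> P"
  shows "(\<Sum>r\<in>P. common_lines p r) = (s + 1) * (t + 1)"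
proof -
  have "(\<Sum>r\<in>P. common_lines p r) = card (SIGMA r:P. {l \<in> L. I p l \<and> I r l})"
    using finite_P finite_L by (subst card_SigmaI) (auto simp: common_lines_def)
  also have "\<dots> = card (SIGMA l:{l \<in> L. I p l}. {r \<in> P. I r l})"
    by (rule bij_betw_same_card[of prod.swap], rule bij_betwI[where g = prod.swap]) auto
  also have "\<dots> = (\<Sum>l | l \<in> L \<and> I p l. card {r \<in> P. I r l})"
    using finite_P finite_L by (subst card_SigmaI) auto
  also have "\<dots> = (\<Sum>l | l \<in> L \<and> I p l. s + 1)"
    using card_points by (intro sum.cong) auto
  finally show ?thesis using card_lines[OF p] by simp
qed

lemma common_lines_sym: "common_lines p q = common_lines q p"
  by (simp add: common_lines_def conj_ac)

text \<open>Summing a row of \<open>M^2\<close> in two ways, once from the constant row sums of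
  \<open>M\<close> and once from the quadratic identity, leaves a linear equation for the number of
  points.\<close>

lemma card_P:
  assumes p: "p \<in> P"
  shows "card P = (s + 1) * (s * t + 1)"
proof -
  have "(s + 1) * (t + 1) * ((s + 1) * (t + 1)) = (\<Sum>r\<in>P. common_lines p r * (\<Sum>q\<in>P. common_lines r q))"
    using common_lines_sum p by (simp add: sum_distrib_right[symmetric] del: mult_Suc mult_Suc_right)
  also have "\<dots> = (\<Sum>q\<in>P. \<Sum>r\<in>P. common_lines p r * common_lines r q)"
    by (simp add: sum_distrib_left) (rule sum.swap)
  also have "\<dots> = (\<Sum>q\<in>P. (t + 1) + (s + t) * common_lines p q)"
    using common_lines_comp p by (intro sum.cong) auto
  also have "\<dots> = (t + 1) * card P + (s + t) * ((s + 1) * (t + 1))"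
    by (simp only: sum.distrib sum_constant sum_distrib_left[symmetric] common_lines_sum[OF p])
      (simp add: algebra_simps)
  finally have "(t + 1) * card P = (t + 1) * ((s + 1) * (s * t + 1))"
    by (simp add: algebra_simps)
  then show ?thesis by (metis add_is_0 mult_cancel1 one_neq_zero)
qed

text \<open>The kernel \<open>(M - \<lambda>J) / (s + t)\<close>, where \<open>M\<close> counts common lines, is the
  projection to the \<open>(s + t)\<close>-eigenspace of \<open>M\<close>, so its trace against a collineation is a rational
  sum of roots of unity.\<close>

lemma benson:
  assumes a: "automorphism P L I h" and x: "x \<in> P"
  shows "int (s + t) dvd int (\<Sum>p\<in>P. common_lines (fst h p) p) - int ((s + 1) * (t + 1))"
proof -
  define k :: rat where "k = of_nat (s + t)"
  \<comment> \<open>\<open>lam J\<close> is the part of \<open>M\<close> on constant vectors: the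
    row sum \<open>(s + 1) (t + 1)\<close> divided by the number \<open>(s + 1) (s t + 1)\<close> of
    points. Its twisted trace is therefore the constant \<open>(s + 1) (t + 1)\<close> of the
    congruence.\<close>
  define lam :: rat where "lam = of_nat (t + 1) / of_nat (s * t + 1)"
  define e where "e = (\<lambda>p q. (of_nat (common_lines p q) - lam) / k)"
  have k0: "k > 0" using s0 by (simp add: k_def)
  have lam: "lam * of_nat (card P) = of_nat ((s + 1) * (t + 1))"
  proof -
    have "(of_nat (s * t + 1) :: rat) \<noteq> 0" by (metis Suc_eq_plus1 of_nat_neq_0)
    then have "lam * of_nat (s * t + 1) = of_nat (t + 1)"
      unfolding lam_def by (rule nonzero_eq_divide_eq[THEN iffD1, OF _ refl])
    then show ?thesis
      unfolding card_P[OF x] of_nat_mult by (simp only: mult.left_commute[of lam])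
  qed
  have bij: "bij_betw (fst h) P P" "bij_betw (snd h) L L"
    using a by (auto simp: automorphism_def)
  have inc: "I (fst h p) (snd h l) \<longleftrightarrow> I p l" if "p \<in> P" "l \<in> L" for p l
    using a that by (auto simp: automorphism_def)
  have cl: "common_lines (fst h p) (fst h q) = common_lines p q" if "p \<in> P" "q \<in> P" for p q
  proof -
    have "bij_betw (snd h) {l \<in> L. I p l \<and> I q l} {l \<in> L. I (fst h p) l \<and> I (fst h q) l}"
    proof (rule bij_betw_imageI)
      show "inj_on (snd h) {l \<in> L. I p l \<and> I q l}"
        using bij(2) unfolding bij_betw_def by (auto intro: inj_on_subset)
      have "m \<in> snd h ` {l \<in> L. I p l \<and> I q l}"
        if "m \<in> L" "I (fst h p) m" "I (fst h q) m" for m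
      proof -
        obtain l where "l \<in> L" "m = snd h l"
          using bij(2) \<open>m \<in> L\<close> unfolding bij_betw_def by blast
        then show ?thesis using that inc \<open>p \<in> P\<close> \<open>q \<in> P\<close> by blast
      qed
      then show "snd h ` {l \<in> L. I p l \<and> I q l} = {l \<in> L. I (fst h p) l \<and> I (fst h q) l}"
        using bij(2) inc that unfolding bij_betw_def by blast
    qed
    then show ?thesis unfolding common_lines_def by (rule bij_betw_same_card[symmetric])
  qed
  have idem: "(\<Sum>r\<in>P. e p r * e r q) = e p q" if pq: "p \<in> P" "q \<in> P" for p q
  proof -
    have "(\<Sum>r\<in>P. e p r * e r q) = (\<Sum>r\<in>P. (of_nat (common_lines p r * common_lines r q)
        - lam * of_nat (common_lines p r) - lam * of_nat (common_lines q r) + lam * lam) / (k * k))"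
    proof (rule sum.cong[OF refl])
      fix r
      have "(a - lam) / k * ((b - lam) / k) = (a * b - lam * a - lam * b + lam * lam) / (k * k)" for a b
        unfolding times_divide_times_eq by (simp add: algebra_simps)
      then show "e p r * e r q = (of_nat (common_lines p r * common_lines r q)
        - lam * of_nat (common_lines p r) - lam * of_nat (common_lines q r) + lam * lam) / (k * k)"
        unfolding e_def common_lines_sym[of q r] of_nat_mult .
    qed
    also have "\<dots> = (of_nat (\<Sum>r\<in>P. common_lines p r * common_lines r q)
        - lam * of_nat (\<Sum>r\<in>P. common_lines p r) - lam * of_nat (\<Sum>r\<in>P. common_lines q r)
        + lam * (lam * of_nat (card P))) / (k * k)"
      by (simp add: sum_divide_distrib[symmetric] sum.distrib sum_subtractf sum_distrib_left mult.commute)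
    also have "\<dots> = (of_nat (t + 1) + k * of_nat (common_lines p q) - lam * of_nat ((s + 1) * (t + 1))) / (k * k)"
      unfolding common_lines_sum[OF pq(1)] common_lines_sum[OF pq(2)] common_lines_comp[OF pq] lam
      by (simp add: k_def)
    also have "of_nat (t + 1) + k * of_nat (common_lines p q) - lam * of_nat ((s + 1) * (t + 1))
        = k * (of_nat (common_lines p q) - lam)"
    proof -
      have "of_nat (t + 1) = lam * of_nat (s * t + 1)"
        unfolding lam_def by (metis Suc_eq_plus1 nonzero_eq_divide_eq of_nat_neq_0)
      then show ?thesis unfolding k_def by (simp add: algebra_simps)
    qed
    finally show ?thesis using k0 by (simp add: e_def)
  qed
  have "(\<Sum>p\<in>P. e (fst h p) p) \<in> \<int>"
    by (rule idempotent_kernel_twisted_trace[OF finite_P bij(1) _ idem]) (auto simp: e_def cl)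
  also have "(\<Sum>p\<in>P. e (fst h p) p) = (of_nat (\<Sum>p\<in>P. common_lines (fst h p) p) - of_nat ((s + 1) * (t + 1))) / k"
    unfolding e_def sum_divide_distrib[symmetric] sum_subtractf lam[symmetric] by (simp add: mult.commute)
  finally obtain z where "(of_nat (\<Sum>p\<in>P. common_lines (fst h p) p) - of_nat ((s + 1) * (t + 1))) / k = of_int z"
    by (auto elim: Ints_cases)
  then have "of_nat (\<Sum>p\<in>P. common_lines (fst h p) p) - of_nat ((s + 1) * (t + 1)) = of_int z * k"
    using k0 by (simp add: field_simps)
  then have "(of_int (int (\<Sum>p\<in>P. common_lines (fst h p) p) - int ((s + 1) * (t + 1))) :: rat)
      = of_int (int (s + t) * z)"
    unfolding k_def by simp
  then have "int (\<Sum>p\<in>P. common_lines (fst h p) p) - int ((s + 1) * (t + 1)) = int (s + t) * z"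
    by (simp only: of_int_eq_iff)
  then show ?thesis by simp
qed

end

section \<open>Finite groups\<close>

context group
begin

lemma inv_mult_cancel:
  assumes "a \<in> carrier G" "b \<in> carrier G"
  shows "inv a \<otimes> (a \<otimes> b) = b" "a \<otimes> (inv a \<otimes> b) = b"
  using assms by (simp_all add: m_assoc[symmetric])

lemmas group_word_simps = m_assoc inv_mult_group inv_mult_cancel

text \<open>Orbit-stabilizer as an inequality: left translation by \<open>inv g\<close> embeds the
  fibre of \<open>f\<close> through \<open>g\<close> into \<open>B\<close>. The one-sided criterion
  is for situations where fibres are only bounded from above.\<close>

lemma card_fibers_le:
  assumes A: "subgroup A G" "finite A" and B: "finite B"
    and f: "\<And>g h. g \<in> A \<Longrightarrow> h \<in> A \<Longrightarrow> f g = f h \<Longrightarrow> inv g \<otimes> h \<in> B"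
  shows "card A \<le> card (f ` A) * card B"
proof -
  have "card A = (\<Sum>y\<in>f ` A. card {x \<in> A. f x = y})"
    using sum.image_gen[OF A(2), of "\<lambda>_. 1::nat" f] by simp
  also have "\<dots> \<le> (\<Sum>y\<in>f ` A. card B)"
  proof (intro sum_mono)
    fix y assume "y \<in> f ` A"
    then obtain g where g: "g \<in> A" "y = f g" by auto
    have "inj_on (\<lambda>x. inv g \<otimes> x) {x \<in> A. f x = y}"
      using g(1) subgroup.mem_carrier[OF A(1)] by (auto simp: inj_on_def)
    moreover have "(\<lambda>x. inv g \<otimes> x) ` {x \<in> A. f x = y} \<subseteq> B"
      using f g by auto
    ultimately show "card {x \<in> A. f x = y} \<le> card B"
      using B by (rule card_inj_on_le)
  qed
  finally show ?thesis by simp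
qed

lemma card_fibers:
  assumes A: "subgroup A G" "finite A" and B: "B \<subseteq> A"
    and f: "\<And>g h. g \<in> A \<Longrightarrow> h \<in> A \<Longrightarrow> f g = f h \<longleftrightarrow> inv g \<otimes> h \<in> B"
  shows "card A = card (f ` A) * card B"
proof -
  have "card A = (\<Sum>y\<in>f ` A. card {x \<in> A. f x = y})"
    using sum.image_gen[OF A(2), of "\<lambda>_. 1::nat" f] by simp
  also have "\<dots> = (\<Sum>y\<in>f ` A. card B)"
  proof (intro sum.cong refl)
    fix y assume "y \<in> f ` A"
    then obtain g where g: "g \<in> A" "y = f g" by auto
    have c: "x \<in> carrier G" if "x \<in> A" for x using that subgroup.mem_carrier[OF A(1)] by auto
    have "bij_betw (\<lambda>x. inv g \<otimes> x) {x \<in> A. f x = y} B"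
    proof (rule bij_betwI[where g = "\<lambda>b. g \<otimes> b"])
      show "(\<lambda>b. g \<otimes> b) \<in> B \<rightarrow> {x \<in> A. f x = y}"
      proof
        fix b assume "b \<in> B"
        then have "b \<in> A" "g \<otimes> b \<in> A" using B g subgroup.m_closed[OF A(1)] by auto
        moreover have "inv g \<otimes> (g \<otimes> b) \<in> B" using \<open>b \<in> B\<close> \<open>b \<in> A\<close> g c by (simp add: inv_mult_cancel)
        ultimately show "g \<otimes> b \<in> {x \<in> A. f x = y}" using f[of g "g \<otimes> b"] g by simp
      qed
      show "(\<lambda>x. inv g \<otimes> x) \<in> {x \<in> A. f x = y} \<rightarrow> B"
        using f[OF g(1)] g(2) by (auto simp: eq_commute[of "f g"])
    qed (use g c B in \<open>auto simp: inv_mult_cancel\<close>)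
    then show "card {x \<in> A. f x = y} = card B" by (rule bij_betw_same_card)
  qed
  finally show ?thesis by simp
qed

lemma card_set_mult:
  assumes X: "subgroup X G" "finite X" and Y: "subgroup Y G" "finite Y"
  shows "card (X <#> Y) * card (X \<inter> Y) = card X * card Y"
proof -
  note XY = subgroup.mem_carrier[OF X(1)] subgroup.mem_carrier[OF Y(1)]
    subgroup.m_closed[OF X(1)] subgroup.m_closed[OF Y(1)]
    subgroup.m_inv_closed[OF X(1)] subgroup.m_inv_closed[OF Y(1)]
  let ?f = "\<lambda>(x, y). x \<otimes> y"
  have im: "X <#> Y = ?f ` (X \<times> Y)" by (auto simp: set_mult_def)
  have "card (X \<times> Y) = (\<Sum>z\<in>?f ` (X \<times> Y). card {w \<in> X \<times> Y. ?f w = z})"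
    using sum.image_gen[of "X \<times> Y" "\<lambda>_. 1::nat" ?f] X Y by simp
  also have "\<dots> = (\<Sum>z\<in>?f ` (X \<times> Y). card (X \<inter> Y))"
  proof (intro sum.cong refl)
    fix z assume "z \<in> ?f ` (X \<times> Y)"
    then obtain x y where z: "x \<in> X" "y \<in> Y" "z = x \<otimes> y" by auto
    have "bij_betw (\<lambda>w. (x \<otimes> w, inv w \<otimes> y)) (X \<inter> Y) {w \<in> X \<times> Y. ?f w = z}"
    proof (rule bij_betwI[where g = "\<lambda>w. inv x \<otimes> fst w"])
      show "(\<lambda>w. (x \<otimes> w, inv w \<otimes> y)) \<in> X \<inter> Y \<rightarrow> {w \<in> X \<times> Y. ?f w = z}"
        using z XY by (auto simp: m_assoc inv_mult_cancel)
      have "inv x \<otimes> u \<in> Y" if "u \<in> X" "v \<in> Y" "u \<otimes> v = x \<otimes> y" for u v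
      proof -
        have "u = (u \<otimes> v) \<otimes> inv v" using that(1,2) XY by (simp add: m_assoc)
        then have "u = x \<otimes> (y \<otimes> inv v)"
          unfolding that(3) using that(1,2) z XY by (simp add: m_assoc)
        then show ?thesis using that z XY by (simp add: inv_mult_cancel)
      qed
      then show "(\<lambda>w. inv x \<otimes> fst w) \<in> {w \<in> X \<times> Y. ?f w = z} \<rightarrow> X \<inter> Y"
        using z XY by auto
      show "inv x \<otimes> fst (x \<otimes> w, inv w \<otimes> y) = w" if "w \<in> X \<inter> Y" for w
        using that z XY by (auto simp: inv_mult_cancel)
      have "inv (inv x \<otimes> u) \<otimes> y = v" if "u \<in> X" "v \<in> Y" "u \<otimes> v = x \<otimes> y" for u v
      proof -
        have "inv (inv x \<otimes> u) \<otimes> y = inv u \<otimes> (x \<otimes> y)"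
          using that z XY by (simp add: group_word_simps)
        then show ?thesis using that(1,2) XY unfolding that(3)[symmetric] by (simp add: inv_mult_cancel)
      qed
      then show "(x \<otimes> (inv x \<otimes> fst w), inv (inv x \<otimes> fst w) \<otimes> y) = w"
        if "w \<in> {w \<in> X \<times> Y. ?f w = z}" for w
        using that z XY by (auto simp: inv_mult_cancel)
    qed
    then show "card {w \<in> X \<times> Y. ?f w = z} = card (X \<inter> Y)" by (rule bij_betw_same_card[symmetric])
  qed
  finally show ?thesis using im by (simp add: card_cartesian_product)
qed

lemma card_subgroups_le:
  assumes "finite (carrier G)" "subgroup X G" "subgroup Y G" "subgroup Z G" "X \<subseteq> Z" "Y \<subseteq> Z"
  shows "card X * card Y \<le> card Z * card (X \<inter> Y)"
proof -
  have fin: "finite X" "finite Y" "finite Z"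
    using assms subgroup.subset finite_subset by metis+
  have "X <#> Y \<subseteq> Z"
    using assms subgroup.m_closed[OF assms(4)] by (auto simp: set_mult_def)
  then have "card (X <#> Y) \<le> card Z" using fin by (simp add: card_mono)
  then show ?thesis using card_set_mult[of X Y] assms fin by (metis mult_le_mono1)
qed

lemma rcos_eq_iff:
  assumes "subgroup N G" "g \<in> carrier G" "h \<in> carrier G"
  shows "N #> g = N #> h \<longleftrightarrow> g \<otimes> inv h \<in> N"
proof
  assume "N #> g = N #> h"
  then have "N #> (g \<otimes> inv h) = N"
    by (rule coset_mult_inv2) (use assms subgroup.subset in auto)
  then show "g \<otimes> inv h \<in> N"
    by (rule coset_join1) (use assms in auto)
next
  assume "g \<otimes> inv h \<in> N"
  then have "N #> (g \<otimes> inv h) = N"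
    by (intro coset_join2) (use assms in auto)
  then show "N #> g = N #> h"
    by (rule coset_mult_inv1) (use assms subgroup.subset in auto)
qed

lemma commute_mult:
  assumes "x \<in> carrier G" "y \<in> carrier G" "h \<in> carrier G"
    and "x \<otimes> h = h \<otimes> x" "y \<otimes> h = h \<otimes> y"
  shows "(x \<otimes> y) \<otimes> h = h \<otimes> (x \<otimes> y)"
  using assms by (metis m_assoc)

lemma subgroup_nat_pow_closed:
  fixes n :: nat
  assumes "subgroup X G" "x \<in> X"
  shows "x [^] n \<in> X"
  by (induction n) (use assms subgroup.one_closed subgroup.m_closed in \<open>auto\<close>)

lemma exists_prime_order_element:
  assumes X: "subgroup X G" "finite X" and p: "prime p" "p dvd card X"
  shows "\<exists>x\<in>X. x \<noteq> \<one> \<and> x [^] p = \<one>"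
proof -
  let ?X = "G\<lparr>carrier := X\<rparr>"
  have gX: "group ?X" using X(1) by (rule subgroup_imp_group)
  obtain m where "card X = p * m" using p by auto
  then obtain T where T: "subgroup T ?X" "card T = p ^ 1"
    using sylow_thm[OF p(1) gX, of 1 m] X by (auto simp: Coset.order_def)
  have fT: "finite T" using T(1) X subgroup.subset[OF T(1)] finite_subset by auto
  have "\<one> \<in> T" using subgroup.one_closed[OF T(1)] by simp
  moreover have "card T > 1" using T p prime_gt_1_nat by auto
  ultimately obtain x where x: "x \<in> T" "x \<noteq> \<one>"
    using fT by (metis card_le_Suc0_iff_eq not_less One_nat_def)
  have TG: "subgroup T G" using T(1) X(1) incl_subgroup by blast
  interpret T: group "G\<lparr>carrier := T\<rparr>" using TG by (rule subgroup_imp_group)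
  have "x [^]\<^bsub>G\<lparr>carrier := T\<rparr>\<^esub> p = \<one>"
    using T.pow_order_eq_1[of x] x T by (simp add: Coset.order_def)
  then have "x [^] p = \<one>" by (simp add: nat_pow_consistent[symmetric])
  then show ?thesis using x T(1) subgroup.subset by fastforce
qed

lemma subgroup_centralizer:
  assumes "subgroup X G" "Y \<subseteq> carrier G"
  shows "subgroup {x \<in> X. \<forall>y\<in>Y. x \<otimes> y = y \<otimes> x} G"
proof (rule subgroupI)
  note X = subgroup.mem_carrier[OF assms(1)]
  show "{x \<in> X. \<forall>y\<in>Y. x \<otimes> y = y \<otimes> x} \<noteq> {}"
    using subgroup.one_closed[OF assms(1)] assms(2) by (auto intro!: exI[of _ \<one>])
  show "inv a \<in> {x \<in> X. \<forall>y\<in>Y. x \<otimes> y = y \<otimes> x}"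
    if "a \<in> {x \<in> X. \<forall>y\<in>Y. x \<otimes> y = y \<otimes> x}" for a
  proof -
    have "inv a \<otimes> y = y \<otimes> inv a" if "y \<in> Y" for y
    proof -
      have c: "a \<in> carrier G" "y \<in> carrier G" "a \<otimes> y = y \<otimes> a"
        using \<open>a \<in> _\<close> \<open>y \<in> Y\<close> X assms(2) by auto
      have "inv a \<otimes> y = inv a \<otimes> (y \<otimes> a) \<otimes> inv a" using c by (simp add: m_assoc)
      also have "\<dots> = y \<otimes> inv a" unfolding c(3)[symmetric] using c(1,2) by (simp add: group_word_simps)
      finally show ?thesis .
    qed
    then show ?thesis using that subgroup.m_inv_closed[OF assms(1)] by auto
  qed
  show "a \<otimes> b \<in> {x \<in> X. \<forall>y\<in>Y. x \<otimes> y = y \<otimes> x}"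
    if "a \<in> {x \<in> X. \<forall>y\<in>Y. x \<otimes> y = y \<otimes> x}" "b \<in> {x \<in> X. \<forall>y\<in>Y. x \<otimes> y = y \<otimes> x}" for a b
  proof -
    have "a \<otimes> b \<otimes> y = y \<otimes> (a \<otimes> b)" if "y \<in> Y" for y
    proof -
      have c: "a \<in> carrier G" "b \<in> carrier G" "y \<in> carrier G" "a \<otimes> y = y \<otimes> a" "b \<otimes> y = y \<otimes> b"
        using \<open>a \<in> _\<close> \<open>b \<in> _\<close> \<open>y \<in> Y\<close> X assms(2) by auto
      then show ?thesis by (metis m_assoc)
    qed
    then show ?thesis using that subgroup.m_closed[OF assms(1)] by auto
  qed
qed (use subgroup.subset[OF assms(1)] in auto)

lemma conj_pow:
  fixes n :: nat
  assumes "g \<in> carrier G" "h \<in> carrier G"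
  shows "(h \<otimes> g \<otimes> inv h) [^] n = h \<otimes> g [^] n \<otimes> inv h"
  by (induction n) (use assms in \<open>simp_all add: group_word_simps\<close>)

lemma conj_eq_iff_centralizes:
  assumes "g \<in> carrier G" "h \<in> carrier G" "a \<in> carrier G"
  shows "g \<otimes> a \<otimes> inv g = h \<otimes> a \<otimes> inv h \<longleftrightarrow> (inv g \<otimes> h) \<otimes> a = a \<otimes> (inv g \<otimes> h)"
proof
  assume *: "g \<otimes> a \<otimes> inv g = h \<otimes> a \<otimes> inv h"
  have "(inv g \<otimes> h) \<otimes> a = inv g \<otimes> (h \<otimes> a \<otimes> inv h) \<otimes> h" using assms by (simp add: group_word_simps)
  also have "\<dots> = a \<otimes> (inv g \<otimes> h)" unfolding *[symmetric] using assms by (simp add: group_word_simps)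
  finally show "(inv g \<otimes> h) \<otimes> a = a \<otimes> (inv g \<otimes> h)" .
next
  assume *: "(inv g \<otimes> h) \<otimes> a = a \<otimes> (inv g \<otimes> h)"
  have "g \<otimes> a \<otimes> inv g = g \<otimes> (a \<otimes> (inv g \<otimes> h)) \<otimes> inv h" using assms by (simp add: group_word_simps)
  also have "\<dots> = h \<otimes> a \<otimes> inv h" unfolding *[symmetric] using assms by (simp add: group_word_simps)
  finally show "g \<otimes> a \<otimes> inv g = h \<otimes> a \<otimes> inv h" .
qed

lemma card_conj_class:
  assumes fin: "finite (carrier G)" and a: "a \<in> carrier G"
  shows "Coset.order G = card ((\<lambda>g. g \<otimes> a \<otimes> inv g) ` carrier G) * card {h \<in> carrier G. h \<otimes> a = a \<otimes> h}"
  unfolding Coset.order_def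
  by (rule card_fibers) (use fin a in \<open>auto simp: subgroup_self conj_eq_iff_centralizes\<close>)

text \<open>Class equation for the conjugation action on a normal subgroup.\<close>

lemma p_group_normal_meets_center:
  assumes p: "prime p" and ord: "Coset.order G = p ^ n" and N: "N \<lhd> G" and N1: "N \<noteq> {\<one>}"
  shows "\<exists>z\<in>N. z \<noteq> \<one> \<and> z [^] p = \<one> \<and> (\<forall>g\<in>carrier G. g \<otimes> z = z \<otimes> g)"
proof -
  have sN: "subgroup N G" and nN: "\<And>g x. g \<in> carrier G \<Longrightarrow> x \<in> N \<Longrightarrow> g \<otimes> x \<otimes> inv g \<in> N"
    using N by (auto simp: normal_inv_iff)
  note Nc = subgroup.mem_carrier[OF sN]
  have finG: "finite (carrier G)"
    using ord p by (metis order_gt_0_iff_finite zero_less_power prime_gt_0_nat)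
  have finN: "finite N" using finG subgroup.subset[OF sN] finite_subset by blast
  define F where "F = {z \<in> N. \<forall>g\<in>carrier G. z \<otimes> g = g \<otimes> z}"
  have sF: "subgroup F G" unfolding F_def by (rule subgroup_centralizer[OF sN]) auto
  define orb where "orb a = (\<lambda>g. g \<otimes> a \<otimes> inv g) ` carrier G" for a
  have self: "a \<in> orb a" if "a \<in> carrier G" for a
    unfolding orb_def using that by (intro image_eqI[of _ _ \<one>]) auto
  have orb_eq: "orb b = orb a" if b: "b \<in> orb a" and a: "a \<in> carrier G" for a b
  proof -
    obtain g where g: "g \<in> carrier G" "b = g \<otimes> a \<otimes> inv g" using b by (auto simp: orb_def)
    have "x \<in> orb a \<Longrightarrow> x \<in> orb b" for x
    proof -
      assume "x \<in> orb a"
      then obtain h where h: "h \<in> carrier G" "x = h \<otimes> a \<otimes> inv h" by (auto simp: orb_def)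
      then have "x = (h \<otimes> inv g) \<otimes> b \<otimes> inv (h \<otimes> inv g)" using g a by (simp add: group_word_simps)
      then show ?thesis using g h by (auto simp: orb_def)
    qed
    moreover have "x \<in> orb b \<Longrightarrow> x \<in> orb a" for x
    proof -
      assume "x \<in> orb b"
      then obtain h where h: "h \<in> carrier G" "x = h \<otimes> b \<otimes> inv h" by (auto simp: orb_def)
      then have "x = (h \<otimes> g) \<otimes> a \<otimes> inv (h \<otimes> g)" using g a by (simp add: group_word_simps)
      then show ?thesis using g h by (auto simp: orb_def)
    qed
    ultimately show ?thesis by blast
  qed
  have pdvd: "p dvd card (orb a)" if "a \<in> N - F" for a
  proof -
    have a: "a \<in> carrier G" using that Nc by auto
    have "card (orb a) dvd p ^ n"
      using card_conj_class[OF finG a] ord unfolding orb_def by (metis dvd_triv_left)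
    then obtain k where k: "card (orb a) = p ^ k" using p by (auto simp: divides_primepow_nat)
    have "card (orb a) \<noteq> 1"
    proof
      assume "card (orb a) = 1"
      then have "orb a = {a}" using self[OF a] by (metis card_1_singletonE singletonD)
      then have "g \<otimes> a \<otimes> inv g = a" if "g \<in> carrier G" for g using that by (auto simp: orb_def)
      then have "a \<otimes> g = g \<otimes> a" if "g \<in> carrier G" for g
        using that a inv_solve_right'[of a "g \<otimes> a" g] by auto
      then show False using \<open>a \<in> N - F\<close> by (auto simp: F_def)
    qed
    then show ?thesis using k by (cases k) auto
  qed
  have Un: "\<Union>(orb ` (N - F)) = N - F"
  proof
    show "N - F \<subseteq> \<Union>(orb ` (N - F))" using self Nc by blast
    show "\<Union>(orb ` (N - F)) \<subseteq> N - F"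
    proof
      fix x assume "x \<in> \<Union>(orb ` (N - F))"
      then obtain a where a: "a \<in> N" "a \<notin> F" "x \<in> orb a" by blast
      have "x \<in> N" using a nN by (auto simp: orb_def)
      moreover have "x \<notin> F"
      proof
        assume "x \<in> F"
        then have "orb x = {x}"
        proof -
          have "g \<otimes> x \<otimes> inv g = x" if "g \<in> carrier G" for g
            using \<open>x \<in> F\<close> that Nc[OF \<open>x \<in> N\<close>] inv_solve_right'[of x "g \<otimes> x" g] by (auto simp: F_def)
          then show ?thesis using Nc[OF \<open>x \<in> N\<close>] by (auto simp: orb_def)
        qed
        then have "a = x" using orb_eq[OF a(3) Nc[OF a(1)]] self[OF Nc[OF a(1)]] by simp
        then show False using a \<open>x \<in> F\<close> by simp
      qed
      ultimately show "x \<in> N - F" by simp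
    qed
  qed
  have "p dvd card (\<Union>(orb ` (N - F)))"
  proof (rule dvd_partition)
    show "\<forall>c1\<in>orb ` (N - F). \<forall>c2\<in>orb ` (N - F). c1 \<noteq> c2 \<longrightarrow> c1 \<inter> c2 = {}"
    proof (intro ballI impI)
      fix c1 c2 assume "c1 \<in> orb ` (N - F)" "c2 \<in> orb ` (N - F)" "c1 \<noteq> c2"
      then obtain a b where "c1 = orb a" "a \<in> N" "c2 = orb b" "b \<in> N" by auto
      then show "c1 \<inter> c2 = {}" using orb_eq Nc \<open>c1 \<noteq> c2\<close> by blast
    qed
  qed (use pdvd Un finN in auto)
  then have 1: "p dvd card (N - F)" using Un by simp
  have "card N dvd p ^ n"
    using lagrange[OF sN] ord by (metis dvd_triv_right)
  then obtain k where k: "card N = p ^ k" using p by (auto simp: divides_primepow_nat)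
  have "card N \<noteq> 1" using N1 subgroup.one_closed[OF sN] by (metis card_1_singletonE singletonD)
  then have 2: "p dvd card N" using k by (cases k) auto
  have "F \<subseteq> N" by (auto simp: F_def)
  then have "card N = card (N - F) + card F"
    using finN by (simp add: card_Diff_subset finite_subset card_mono)
  then have "p dvd card F" using 1 2 by (simp add: dvd_add_right_iff)
  then obtain z where "z \<in> F" "z \<noteq> \<one>" "z [^] p = \<one>"
    using exists_prime_order_element[OF sF _ p] \<open>F \<subseteq> N\<close> finN finite_subset by blast
  then show ?thesis by (auto simp: F_def)
qed

text \<open>In the application all elements are images in a quotient, which is why the commutation
  hypotheses are stated for elements and not for subgroups.\<close>

lemma centralizes_of_conj:
  assumes c: "a \<in> carrier G" "b \<in> carrier G" "\<sigma> \<in> carrier G" "h \<in> carrier G" "\<tau> \<in> carrier G"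
    and h: "a \<otimes> \<sigma> = h \<otimes> a \<otimes> inv h" and b: "b \<otimes> h \<otimes> inv b = h \<otimes> \<tau>"
    and at: "\<tau> \<otimes> a = a \<otimes> \<tau>" and ab: "b \<otimes> a = a \<otimes> b"
  shows "b \<otimes> \<sigma> = \<sigma> \<otimes> b"
proof -
  \<comment> \<open>Conjugation by \<open>b\<close> fixes \<open>a\<close> and sends
    \<open>h\<close> to \<open>h \<tau>\<close>. Since \<open>\<tau>\<close> commutes with
    \<open>a\<close>, it fixes \<open>h a h^-1 = a \<sigma>\<close>, and with \<open>a\<close> also
    \<open>\<sigma>\<close>. The chain is this computation without the outer inverse of
    \<open>b\<close>.\<close>
  have "a \<otimes> (b \<otimes> \<sigma>) = b \<otimes> (a \<otimes> \<sigma>)" using c ab by (metis m_assoc)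
  also have "\<dots> = (b \<otimes> h \<otimes> inv b) \<otimes> (b \<otimes> a) \<otimes> inv h" unfolding h using c by (simp add: group_word_simps)
  also have "\<dots> = h \<otimes> (\<tau> \<otimes> a) \<otimes> b \<otimes> inv h" unfolding b ab using c by (simp add: group_word_simps)
  also have "\<dots> = h \<otimes> a \<otimes> inv h \<otimes> (h \<otimes> \<tau>) \<otimes> b \<otimes> inv h" unfolding at using c by (simp add: group_word_simps)
  also have "\<dots> = a \<otimes> \<sigma> \<otimes> (b \<otimes> h \<otimes> inv b) \<otimes> b \<otimes> inv h" unfolding h b ..
  also have "\<dots> = a \<otimes> (\<sigma> \<otimes> b)" using c by (simp add: group_word_simps)
  finally show ?thesis using c by simp
qed

end

lemma (in group_hom) subgroup_vimage_centralizer: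
  assumes X: "subgroup X G" and Y: "Y \<subseteq> carrier H"
  shows "subgroup {x \<in> X. \<forall>y\<in>Y. h x \<otimes>\<^bsub>H\<^esub> y = y \<otimes>\<^bsub>H\<^esub> h x} G"
proof -
  let ?C = "{u \<in> carrier H. \<forall>y\<in>Y. u \<otimes>\<^bsub>H\<^esub> y = y \<otimes>\<^bsub>H\<^esub> u}"
  have C: "subgroup ?C H" by (rule H.subgroup_centralizer[OF H.subgroup_self Y])
  have eq: "{x \<in> X. \<forall>y\<in>Y. h x \<otimes>\<^bsub>H\<^esub> y = y \<otimes>\<^bsub>H\<^esub> h x} = {x \<in> X. h x \<in> ?C}"
    using subgroup.mem_carrier[OF X] by auto
  show ?thesis
    unfolding eq
  proof (rule G.subgroupI)
    show "{x \<in> X. h x \<in> ?C} \<noteq> {}"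
      using subgroup.one_closed[OF X] subgroup.one_closed[OF C] by (metis (mono_tags, lifting) empty_iff hom_one mem_Collect_eq)
    show "inv a \<in> {x \<in> X. h x \<in> ?C}" if "a \<in> {x \<in> X. h x \<in> ?C}" for a
      using that subgroup.m_inv_closed[OF X] subgroup.m_inv_closed[OF C] subgroup.mem_carrier[OF X]
      by (simp del: mem_Collect_eq add: mem_Collect_eq[of _ "\<lambda>x. x \<in> X \<and> h x \<in> ?C"])
    show "a \<otimes> b \<in> {x \<in> X. h x \<in> ?C}"
      if "a \<in> {x \<in> X. h x \<in> ?C}" "b \<in> {x \<in> X. h x \<in> ?C}" for a b
      using that subgroup.m_closed[OF X] subgroup.m_closed[OF C] subgroup.mem_carrier[OF X]
      by (simp del: mem_Collect_eq add: mem_Collect_eq[of _ "\<lambda>x. x \<in> X \<and> h x \<in> ?C"])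
  qed (use subgroup.subset[OF X] in auto)
qed

section \<open>Arithmetic and counting\<close>

text \<open>If \<open>s = t\<close>, then \<open>2 s\<close> divides \<open>s^2\<close>, so
  \<open>s\<close> is even. Otherwise divide by the gcd \<open>d\<close> to get coprime
  \<open>s'\<close> and \<open>t'\<close>. From \<open>s + t\<close> dividing \<open>t^2\<close> it
  follows that \<open>s' + t'\<close> divides \<open>d\<close>, hence \<open>s\<close>. As
  \<open>s\<close> has one prime only, a prime of \<open>s' > 1\<close> and a prime of
  \<open>s' + t'\<close> coincide, so it divides \<open>t'\<close> too, against coprimality.\<close>

lemma sum_not_dvd_mult_of_single_prime:
  fixes s t :: nat
  assumes s: "s > 1" and t: "t > 0" "t \<le> s"
    and single: "\<And>p q. prime p \<Longrightarrow> prime q \<Longrightarrow> p dvd s \<Longrightarrow> q dvd s \<Longrightarrow> p = q"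
    and odd: "s = t \<Longrightarrow> odd s"
  shows "\<not> s + t dvd s * t"
proof
  assume dvd: "s + t dvd s * t"
  show False
  proof (cases "s = t")
    case True
    then have "s * 2 dvd s * s" using dvd by (simp add: mult_2_right)
    then have "2 dvd s" using s by (simp add: nat_mult_dvd_cancel_disj)
    then show False using odd True by simp
  next
    case False
    define d where "d = gcd s t"
    obtain s' t' where st: "s = d * s'" "t = d * t'" "coprime s' t'"
      using gcd_coprime_exists[of s t] s unfolding d_def by (metis gcd_eq_0_iff mult.commute not_one_less_zero)
    have d0: "d > 0" using s unfolding d_def by simp
    have "s' > t'" using st False t by auto
    moreover have "t' > 0" using st t by auto
    ultimately have "s' > 1" by simp
    have "t * (s + t) = s * t + t * t" by (simp add: algebra_simps)
    then have "s + t dvd t * t" using dvd by (metis dvd_add_right_iff dvd_triv_right)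
    then have "d * (s' + t') dvd d * (d * (t' * t'))" unfolding st by (simp add: algebra_simps)
    then have "s' + t' dvd d * (t' * t')" using d0 by (metis nat_mult_dvd_cancel1)
    moreover have "coprime (s' + t') (t' * t')"
      using st(3) by simp (simp add: coprime_iff_gcd_eq_1)
    ultimately have "s' + t' dvd d" by (simp add: coprime_dvd_mult_left_iff)
    have "s' \<noteq> 1" "s' + t' \<noteq> 1" using \<open>s' > 1\<close> by auto
    then obtain p q where p: "prime p" "p dvd s'" and q: "prime q" "q dvd s' + t'"
      using prime_factor_nat by meson
    have "q = p" using single[OF q(1) p(1)] p q \<open>s' + t' dvd d\<close> st by (meson dvd_mult dvd_mult2 dvd_trans)
    then have "p dvd t'" using q p by (simp add: dvd_add_right_iff)
    then show False using p st(3) by (meson coprime_common_divisor not_prime_unit)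
  qed
qed

lemma prime_power_of_single_prime:
  fixes n :: nat
  assumes n: "n > 0" and p: "prime p" and single: "\<And>q. prime q \<Longrightarrow> q dvd n \<Longrightarrow> q = p"
  shows "\<exists>k. n = p ^ k"
proof -
  obtain m where m: "n = p ^ multiplicity p n * m" "\<not> p dvd m"
    using multiplicity_decompose'[of n p] n p by (metis not_prime_unit not_gr0)
  have "m = 1"
  proof (rule ccontr)
    assume "m \<noteq> 1"
    then obtain q where "prime q" "q dvd m" using prime_factor_nat by blast
    then show False using m single by (metis dvd_mult)
  qed
  then show ?thesis using m by auto
qed

lemma sum_card_swap:
  assumes "finite A" "finite B"
  shows "(\<Sum>a\<in>A. card {b \<in> B. R a b}) = (\<Sum>b\<in>B. card {a \<in> A. R a b})"
proof -
  have "(\<Sum>a\<in>A. card {b \<in> B. R a b}) = (\<Sum>a\<in>A. \<Sum>b\<in>B. if R a b then 1 else 0)"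
    using assms by (intro sum.cong refl) (simp add: sum.If_cases Int_def)
  also have "\<dots> = (\<Sum>b\<in>B. \<Sum>a\<in>A. if R a b then 1 else 0)" by (rule sum.swap)
  also have "\<dots> = (\<Sum>b\<in>B. card {a \<in> A. R a b})"
    using assms by (intro sum.cong refl) (simp add: sum.If_cases Int_def)
  finally show ?thesis .
qed

section \<open>The elation group\<close>

text \<open>The indices stand for the lines \<open>N\<close> on \<open>x\<close>, \<open>K i\<close>
  for the pointwise stabilizer of such a line and \<open>A i\<close> for the stabilizer of one
  chosen line meeting it off \<open>x\<close>. The last assumption is what Benson's congruence
  delivers; its second alternative is refuted inside the group in
  \<open>sum_not_dvd\<close>.\<close>

locale stgq_group = group G for G (structure) +
  fixes S :: "'a set" and \<Lambda> :: "'i set" and K A :: "'i \<Rightarrow> 'a set" and s t :: nat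
  assumes ord: "Coset.order G = s * s * t"
    and subgroup_S: "subgroup S G" and card_S: "card S = t"
    and normal_K: "i \<in> \<Lambda> \<Longrightarrow> K i \<lhd> G" and card_K: "i \<in> \<Lambda> \<Longrightarrow> card (K i) = s * t"
    and S_subset_K: "i \<in> \<Lambda> \<Longrightarrow> S \<subseteq> K i"
    and K_inter_K: "i \<in> \<Lambda> \<Longrightarrow> j \<in> \<Lambda> \<Longrightarrow> i \<noteq> j \<Longrightarrow> K i \<inter> K j = S"
    and card_index: "card \<Lambda> = t + 1"
    and subgroup_A: "i \<in> \<Lambda> \<Longrightarrow> subgroup (A i) G" and A_subset_K: "i \<in> \<Lambda> \<Longrightarrow> A i \<subseteq> K i"
    and card_A: "i \<in> \<Lambda> \<Longrightarrow> card (A i) = s" and A_inter_S: "i \<in> \<Lambda> \<Longrightarrow> A i \<inter> S = {\<one>}"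
    and s1: "s > 1" and t1: "t > 1" and odd: "s = t \<Longrightarrow> odd s"
    and conj_into_A_or_dvd: "i \<in> \<Lambda> \<Longrightarrow> g \<in> K i \<Longrightarrow> g \<notin> S \<Longrightarrow> (\<exists>h\<in>carrier G. h \<otimes> g \<otimes> inv h \<in> A i) \<or> s + t dvd s * t"
begin

lemma finite_carrier: "finite (carrier G)"
  using ord s1 t1 order_gt_0_iff_finite by (metis gr0I less_nat_zero_code mult_is_0)

lemma finite_index: "finite \<Lambda>"
  using card_index card.infinite by fastforce

lemma subgroup_K: "i \<in> \<Lambda> \<Longrightarrow> subgroup (K i) G"
  using normal_K normal_imp_subgroup by blast

lemma subgroup_carrier: "X \<subseteq> carrier G" if "subgroup X G" for X
  using that subgroup.subset by blast

lemma finite_subgroup: "finite X" if "subgroup X G" for X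
  using that finite_carrier subgroup.subset finite_subset by blast

lemma third_index:
  assumes "i \<in> \<Lambda>" "j \<in> \<Lambda>"
  shows "\<exists>k\<in>\<Lambda>. k \<noteq> i \<and> k \<noteq> j"
proof (rule ccontr)
  assume "\<not> ?thesis"
  then have "\<Lambda> \<subseteq> {i, j}" by auto
  then have "card \<Lambda> \<le> card {i, j}" by (intro card_mono) auto
  also have "\<dots> \<le> 2" by (simp add: card_insert_if)
  finally show False using card_index t1 by simp
qed

lemma ex_index: "\<exists>i. i \<in> \<Lambda>"
  using card_index by (metis add_is_0 card.empty ex_in_conv one_neq_zero)

lemma normal_S: "S \<lhd> G"
proof -
  obtain i where i: "i \<in> \<Lambda>" using ex_index by blast
  obtain j where j: "j \<in> \<Lambda>" "j \<noteq> i" using third_index[OF i i] by auto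
  have "x \<otimes> h \<otimes> inv x \<in> S" if "x \<in> carrier G" "h \<in> S" for x h
    using that normal_K[OF i] normal_K[OF j(1)] K_inter_K[OF j(1) i j(2)] unfolding normal_inv_iff by blast
  then show ?thesis using subgroup_S unfolding normal_inv_iff by blast
qed

lemma K_mult_K:
  assumes "i \<in> \<Lambda>" "j \<in> \<Lambda>" "i \<noteq> j"
  shows "K i <#> K j = carrier G"
proof (rule card_subset_eq[OF finite_carrier])
  show "K i <#> K j \<subseteq> carrier G"
    using assms subgroup_carrier[OF subgroup_K] by (auto simp: set_mult_def)
  have "card (K i <#> K j) * t = (s * t) * (s * t)"
    using card_set_mult[of "K i" "K j"] assms subgroup_K finite_subgroup K_inter_K card_K card_S by auto
  also have "\<dots> = (s * s * t) * t" by (simp add: algebra_simps)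
  finally show "card (K i <#> K j) = card (carrier G)"
    using t1 ord by (simp add: Coset.order_def)
qed

lemma K_eq_A_mult_S:
  assumes "i \<in> \<Lambda>"
  shows "K i = A i <#> S"
proof -
  have "A i <#> S \<subseteq> K i"
    using assms A_subset_K S_subset_K subgroup.m_closed[OF subgroup_K] by (fastforce simp: set_mult_def)
  moreover have "card (A i <#> S) = s * t"
    using card_set_mult[of "A i" S] assms subgroup_A subgroup_S finite_subgroup A_inter_S card_A card_S by auto
  ultimately show ?thesis
    using card_subset_eq[OF finite_subgroup[OF subgroup_K[OF assms]]] card_K[OF assms] by metis
qed

lemma K_decomp:
  assumes "i \<in> \<Lambda>" "g \<in> K i"
  obtains a \<sigma> where "a \<in> A i" "\<sigma> \<in> S" "g = a \<otimes> \<sigma>"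
  using assms K_eq_A_mult_S by (auto simp: set_mult_def)

abbreviation \<pi> where "\<pi> g \<equiv> S #> g"

lemma pi_hom: "group_hom G (G Mod S) \<pi>"
  using normal_S normal.factorgroup_is_group[OF normal_S] normal.r_coset_hom_Mod[OF normal_S]
  by (simp add: group_hom_def group_hom_axioms_def is_group)

sublocale Q: group "G Mod S"
  by (rule normal.factorgroup_is_group[OF normal_S])

sublocale pi: group_hom G "G Mod S" \<pi>
  by (rule pi_hom)

lemma pi_eq_iff: "g \<in> carrier G \<Longrightarrow> h \<in> carrier G \<Longrightarrow> \<pi> g = \<pi> h \<longleftrightarrow> g \<otimes> inv h \<in> S"
  by (rule rcos_eq_iff[OF subgroup_S])

text \<open>A commutator of elements of two different \<open>K i\<close>, \<open>K j\<close> lies in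
  both by normality, hence in \<open>S\<close>. So modulo \<open>S\<close> an element of
  \<open>K i\<close> commutes with \<open>K j\<close> and \<open>K k\<close> for two further
  indices, and these generate the group. Thus each \<open>K i\<close> is central modulo
  \<open>S\<close>, and two of them generate the group again.\<close>

lemma pi_commute:
  assumes "g \<in> carrier G" "h \<in> carrier G"
  shows "\<pi> (g \<otimes> h) = \<pi> (h \<otimes> g)"
proof -
  have diff: "\<pi> g \<otimes>\<^bsub>G Mod S\<^esub> \<pi> h = \<pi> h \<otimes>\<^bsub>G Mod S\<^esub> \<pi> g"
    if "i \<in> \<Lambda>" "j \<in> \<Lambda>" "i \<noteq> j" "g \<in> K i" "h \<in> K j" for i j g h
  proof -
    have c: "g \<in> carrier G" "h \<in> carrier G" using that subgroup_carrier[OF subgroup_K] by auto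
    have "g \<otimes> h \<otimes> inv (h \<otimes> g) = g \<otimes> (h \<otimes> inv g \<otimes> inv h)"
      using c by (simp add: group_word_simps)
    moreover have "h \<otimes> inv g \<otimes> inv h \<in> K i"
      using normal_K[OF that(1)] c that subgroup.m_inv_closed[OF subgroup_K[OF that(1)]] unfolding normal_inv_iff by blast
    ultimately have 1: "g \<otimes> h \<otimes> inv (h \<otimes> g) \<in> K i"
      using that subgroup.m_closed[OF subgroup_K[OF that(1)]] by simp
    have "g \<otimes> h \<otimes> inv (h \<otimes> g) = (g \<otimes> h \<otimes> inv g) \<otimes> inv h"
      using c by (simp add: group_word_simps)
    moreover have "g \<otimes> h \<otimes> inv g \<in> K j"
      using normal_K[OF that(2)] c that unfolding normal_inv_iff by blast
    ultimately have "g \<otimes> h \<otimes> inv (h \<otimes> g) \<in> K j"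
      using that subgroup.m_closed[OF subgroup_K[OF that(2)]] subgroup.m_inv_closed[OF subgroup_K[OF that(2)]] by simp
    then have "\<pi> (g \<otimes> h) = \<pi> (h \<otimes> g)"
      using 1 K_inter_K that c pi_eq_iff by blast
    then show ?thesis using c by simp
  qed
  have all: "\<pi> g \<otimes>\<^bsub>G Mod S\<^esub> \<pi> h = \<pi> h \<otimes>\<^bsub>G Mod S\<^esub> \<pi> g"
    if h: "h \<in> carrier G" "j \<in> \<Lambda>" "k \<in> \<Lambda>" "j \<noteq> k" "g \<in> carrier G"
      "\<And>x. x \<in> K j \<union> K k \<Longrightarrow> \<pi> x \<otimes>\<^bsub>G Mod S\<^esub> \<pi> h = \<pi> h \<otimes>\<^bsub>G Mod S\<^esub> \<pi> x" for g h j k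
  proof -
    have "g \<in> K j <#> K k" using K_mult_K[OF h(2,3,4)] h(5) by simp
    then obtain x y where xy: "x \<in> K j" "y \<in> K k" "g = x \<otimes> y"
      by (auto simp: set_mult_def)
    have c: "x \<in> carrier G" "y \<in> carrier G" using xy subgroup_carrier[OF subgroup_K] h by auto
    show ?thesis
      unfolding xy(3) pi.hom_mult[OF c]
      by (rule Q.commute_mult) (use c h xy in \<open>auto simp del: mult_FactGroup\<close>)
  qed
  have K: "\<pi> g \<otimes>\<^bsub>G Mod S\<^esub> \<pi> h = \<pi> h \<otimes>\<^bsub>G Mod S\<^esub> \<pi> g"
    if i: "i \<in> \<Lambda>" "h \<in> K i" "g \<in> carrier G" for i g h
  proof -
    obtain j where j: "j \<in> \<Lambda>" "j \<noteq> i" using third_index[OF i(1) i(1)] by auto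
    obtain k where k: "k \<in> \<Lambda>" "k \<noteq> i" "k \<noteq> j" using third_index[OF i(1) j(1)] by auto
    show ?thesis
      by (rule all[of h j k g]) (use i j k diff subgroup_carrier[OF subgroup_K[OF i(1)]] in \<open>auto simp del: pi.hom_mult mult_FactGroup\<close>)
  qed
  obtain i where i: "i \<in> \<Lambda>" using ex_index by blast
  obtain j where j: "j \<in> \<Lambda>" "j \<noteq> i" using third_index[OF i i] by auto
  have "\<pi> h \<otimes>\<^bsub>G Mod S\<^esub> \<pi> g = \<pi> g \<otimes>\<^bsub>G Mod S\<^esub> \<pi> h"
    by (rule all[of g i j h]) (use assms i j K in \<open>auto simp del: pi.hom_mult mult_FactGroup\<close>)
  then show ?thesis using assms by simp
qed

lemma commutator_in_S:
  assumes "g \<in> carrier G" "h \<in> carrier G"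
  shows "g \<otimes> h \<otimes> inv g \<otimes> inv h \<in> S"
  using pi_commute[OF assms] assms by (simp add: pi_eq_iff group_word_simps del: pi.hom_mult)

lemma A_abelian:
  assumes i: "i \<in> \<Lambda>" and ab: "a \<in> A i" "b \<in> A i"
  shows "a \<otimes> b = b \<otimes> a"
proof -
  have c: "a \<in> carrier G" "b \<in> carrier G" using ab subgroup_carrier[OF subgroup_A[OF i]] by auto
  have "a \<otimes> b \<otimes> inv a \<otimes> inv b \<in> A i"
    using ab subgroup.m_closed[OF subgroup_A[OF i]] subgroup.m_inv_closed[OF subgroup_A[OF i]] by simp
  then have "(a \<otimes> b) \<otimes> inv (b \<otimes> a) = \<one>"
    using A_inter_S[OF i] commutator_in_S[OF c] c by (auto simp: group_word_simps)
  then show ?thesis using c by (metis inv_closed inv_inv inv_unique' m_closed inv_equality)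
qed

section \<open>Counting torsion modulo \<open>S\<close>\<close>

lemma S_pow_mult:
  assumes "g \<in> carrier G" "h \<in> carrier G"
  shows "\<pi> ((g \<otimes> h) [^] (n::nat)) = \<pi> (g [^] n \<otimes> h [^] n)"
proof -
  have "\<pi> g \<otimes>\<^bsub>G Mod S\<^esub> \<pi> h = \<pi> h \<otimes>\<^bsub>G Mod S\<^esub> \<pi> g"
    using pi_commute[OF assms] assms by simp
  then have "(\<pi> g \<otimes>\<^bsub>G Mod S\<^esub> \<pi> h) [^]\<^bsub>G Mod S\<^esub> n = \<pi> g [^]\<^bsub>G Mod S\<^esub> n \<otimes>\<^bsub>G Mod S\<^esub> \<pi> h [^]\<^bsub>G Mod S\<^esub> n"
    using assms by (intro Q.pow_mult_distrib) auto
  then show ?thesis using assms by (simp add: pi.hom_nat_pow)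
qed

lemma pi_eq_self: "g \<in> carrier G \<Longrightarrow> \<pi> g = \<pi> \<one> \<longleftrightarrow> g \<in> S"
  by (subst pi_eq_iff) auto

text \<open>The preimage of the \<open>p\<close>-torsion subgroup of the abelian quotient by
  \<open>S\<close>.\<close>

definition \<Omega> :: "nat \<Rightarrow> 'a set" where "\<Omega> p = {g \<in> carrier G. g [^] p \<in> S}"

lemma subgroup_Omega: "subgroup (\<Omega> p) G"
proof (rule subgroupI)
  show "\<Omega> p \<noteq> {}" using subgroup.one_closed[OF subgroup_S] by (auto simp: \<Omega>_def intro!: exI[of _ \<one>])
  show "inv a \<in> \<Omega> p" if "a \<in> \<Omega> p" for a
    using that subgroup.m_inv_closed[OF subgroup_S] by (auto simp: \<Omega>_def nat_pow_inv)
  show "a \<otimes> b \<in> \<Omega> p" if "a \<in> \<Omega> p" "b \<in> \<Omega> p" for a b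
  proof -
    have c: "a \<in> carrier G" "b \<in> carrier G" "a [^] p \<otimes> b [^] p \<in> S"
      using that subgroup.m_closed[OF subgroup_S] by (auto simp: \<Omega>_def)
    then have "\<pi> ((a \<otimes> b) [^] p) = \<pi> \<one>"
      unfolding S_pow_mult[OF c(1,2)] by (subst pi_eq_self) auto
    then show ?thesis using c by (subst (asm) pi_eq_self) (auto simp: \<Omega>_def)
  qed
qed (auto simp: \<Omega>_def)

lemma S_Omega: "S \<subseteq> \<Omega> p"
  using subgroup_carrier[OF subgroup_S] subgroup_nat_pow_closed[OF subgroup_S] by (auto simp: \<Omega>_def)

definition T :: "nat \<Rightarrow> 'i \<Rightarrow> 'a set" where "T p i = {a \<in> A i. a [^] p = \<one>}"

lemma subgroup_T:
  assumes i: "i \<in> \<Lambda>" shows "subgroup (T p i) G"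
proof (rule subgroupI)
  note A = subgroup.mem_carrier[OF subgroup_A[OF i]]
  show "T p i \<noteq> {}" using subgroup.one_closed[OF subgroup_A[OF i]] by (auto simp: T_def intro!: exI[of _ \<one>])
  show "inv a \<in> T p i" if "a \<in> T p i" for a
    using that A subgroup.m_inv_closed[OF subgroup_A[OF i]] by (auto simp: T_def nat_pow_inv)
  show "a \<otimes> b \<in> T p i" if "a \<in> T p i" "b \<in> T p i" for a b
    using that A subgroup.m_closed[OF subgroup_A[OF i]] A_abelian[OF i] by (auto simp: T_def pow_mult_distrib)
qed (use subgroup_carrier[OF subgroup_A[OF i]] in \<open>auto simp: T_def\<close>)

text \<open>Splitting off the factor in \<open>S\<close> leaves an element of \<open>A i\<close>
  whose \<open>p\<close>-th power lies in \<open>A i \<inter> S\<close>, which is trivial: torsion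
  of \<open>K i / S\<close> lifts to genuine torsion of \<open>A i\<close>.\<close>

lemma Omega_K:
  assumes i: "i \<in> \<Lambda>"
  shows "\<Omega> p \<inter> K i = T p i <#> S"
proof
  show "\<Omega> p \<inter> K i \<subseteq> T p i <#> S"
  proof
    fix g assume g: "g \<in> \<Omega> p \<inter> K i"
    then obtain a \<sigma> where a: "a \<in> A i" "\<sigma> \<in> S" "g = a \<otimes> \<sigma>" using K_decomp[OF i] by blast
    have c: "a \<in> carrier G" "\<sigma> \<in> carrier G" using a subgroup_carrier[OF subgroup_A[OF i]] subgroup_carrier[OF subgroup_S] by auto
    have "a = g \<otimes> inv \<sigma>" using a c by (simp add: m_assoc)
    then have "a \<in> \<Omega> p"
      using g a S_Omega subgroup.m_closed[OF subgroup_Omega] subgroup.m_inv_closed[OF subgroup_Omega] by blast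
    then have "a [^] p \<in> S \<inter> A i"
      using subgroup_nat_pow_closed[OF subgroup_A[OF i] a(1)] by (auto simp: \<Omega>_def)
    then have "a \<in> T p i" using A_inter_S[OF i] a by (auto simp: T_def)
    then show "g \<in> T p i <#> S" using a by (auto simp: set_mult_def)
  qed
  show "T p i <#> S \<subseteq> \<Omega> p \<inter> K i"
  proof
    fix g assume "g \<in> T p i <#> S"
    then obtain a \<sigma> where a: "a \<in> T p i" "\<sigma> \<in> S" "g = a \<otimes> \<sigma>" by (auto simp: set_mult_def)
    have "a \<in> A i" using a by (simp add: T_def)
    moreover have "a \<in> \<Omega> p"
      using a subgroup.one_closed[OF subgroup_S] subgroup_carrier[OF subgroup_A[OF i]] by (auto simp: \<Omega>_def T_def)
    ultimately show "g \<in> \<Omega> p \<inter> K i"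
      using a S_Omega A_subset_K[OF i] S_subset_K[OF i] subgroup.m_closed[OF subgroup_Omega] subgroup.m_closed[OF subgroup_K[OF i]] by blast
  qed
qed

lemma card_Omega_K:
  assumes i: "i \<in> \<Lambda>"
  shows "card (\<Omega> p \<inter> K i) = card (T p i) * t"
proof -
  have "T p i \<inter> S = {\<one>}"
  proof -
    have "T p i \<subseteq> A i" by (auto simp: T_def)
    then show ?thesis
      using A_inter_S[OF i] subgroup.one_closed[OF subgroup_T[OF i]] subgroup.one_closed[OF subgroup_S] by blast
  qed
  then show ?thesis
    using card_set_mult[OF subgroup_T[OF i] finite_subgroup[OF subgroup_T[OF i]] subgroup_S finite_subgroup[OF subgroup_S], of p] card_S
    unfolding Omega_K[OF i] by simp
qed

text \<open>Modulo \<open>S\<close> the group is the direct product of \<open>K i\<close> and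
  \<open>K j\<close>, so its torsion is the product of theirs. Concretely, if \<open>x^p y^p\<close>
  lies in \<open>S\<close>, then \<open>x^p\<close> lies in
  \<open>K i \<inter> K j = S\<close>.\<close>

lemma card_Omega:
  assumes i: "i \<in> \<Lambda>" and j: "j \<in> \<Lambda>" and ij: "i \<noteq> j"
  shows "card (\<Omega> p) = card (T p i) * card (T p j) * t"
proof -
  let ?X = "\<Omega> p \<inter> K i" and ?Y = "\<Omega> p \<inter> K j"
  have sX: "subgroup ?X G" and sY: "subgroup ?Y G"
    using subgroups_Inter_pair[OF subgroup_Omega subgroup_K] i j by auto
  have "?X <#> ?Y = \<Omega> p"
  proof
    show "?X <#> ?Y \<subseteq> \<Omega> p"
      using subgroup.m_closed[OF subgroup_Omega] by (auto simp: set_mult_def)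
    show "\<Omega> p \<subseteq> ?X <#> ?Y"
    proof
      fix g assume g: "g \<in> \<Omega> p"
      then have "g \<in> K i <#> K j" using K_mult_K[OF i j ij] by (simp add: \<Omega>_def)
      then obtain x y where xy: "x \<in> K i" "y \<in> K j" "g = x \<otimes> y" by (auto simp: set_mult_def)
      have c: "x \<in> carrier G" "y \<in> carrier G" using xy subgroup_carrier[OF subgroup_K] i j by auto
      have "\<pi> (x [^] p \<otimes> y [^] p) = \<pi> \<one>"
        using g xy S_pow_mult[OF c, of p, symmetric] pi_eq_self[of "g [^] p"] by (simp add: \<Omega>_def)
      then have S: "x [^] p \<otimes> y [^] p \<in> S" using c by (subst (asm) pi_eq_self) auto
      have yp: "y [^] p \<in> K j" using subgroup_nat_pow_closed[OF subgroup_K[OF j] xy(2)] .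
      have "x [^] p = (x [^] p \<otimes> y [^] p) \<otimes> inv (y [^] p)" using c by (simp add: m_assoc)
      also have "\<dots> \<in> K j"
        using S S_subset_K[OF j] yp subgroup.m_closed[OF subgroup_K[OF j]] subgroup.m_inv_closed[OF subgroup_K[OF j]] by blast
      finally have "x [^] p \<in> S"
        using subgroup_nat_pow_closed[OF subgroup_K[OF i] xy(1)] K_inter_K[OF i j ij] by blast
      then have x: "x \<in> \<Omega> p" using c by (simp add: \<Omega>_def)
      have "y = inv x \<otimes> g" using xy c by (simp add: inv_mult_cancel)
      then have "y \<in> \<Omega> p"
        using x g subgroup.m_closed[OF subgroup_Omega] subgroup.m_inv_closed[OF subgroup_Omega] by blast
      then show "g \<in> ?X <#> ?Y" using x xy by (auto simp: set_mult_def)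
    qed
  qed
  moreover have "?X \<inter> ?Y = S" using K_inter_K[OF i j ij] S_Omega by auto
  ultimately have "card (\<Omega> p) * t = (card (T p i) * card (T p j) * t) * t"
    using card_set_mult[OF sX finite_subgroup[OF sX] sY finite_subgroup[OF sY]] card_Omega_K[OF i] card_Omega_K[OF j] card_S
    by (simp add: algebra_simps)
  then show ?thesis using t1 by simp
qed

text \<open>Comparison with a third index shows that all \<open>T p j\<close> have the same size
  \<open>w + 1\<close>, and \<open>p dvd s\<close> makes \<open>w\<close> positive. The
  \<open>t + 1\<close> sets \<open>\<Omega> p \<inter> K j - S\<close> are disjoint of size
  \<open>w t\<close> inside \<open>\<Omega> p - S\<close>, which has
  \<open>((w + 1)^2 - 1) t = (w + 2) w t\<close> elements. Hence
  \<open>t + 1 \<le> w + 2\<close>.\<close>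

lemma T_card_ge:
  assumes p: "prime p" "p dvd s" and i: "i \<in> \<Lambda>"
  shows "t \<le> card (T p i)"
proof -
  have ge2: "card (T p j) \<ge> 2" if j: "j \<in> \<Lambda>" for j
  proof -
    obtain a where a: "a \<in> A j" "a \<noteq> \<one>" "a [^] p = \<one>"
      using exists_prime_order_element[OF subgroup_A[OF j] finite_subgroup[OF subgroup_A[OF j]] p(1)] card_A[OF j] p(2) by auto
    have "{\<one>, a} \<subseteq> T p j" using a subgroup.one_closed[OF subgroup_A[OF j]] by (auto simp: T_def)
    then have "card {\<one>, a} \<le> card (T p j)" using finite_subgroup[OF subgroup_T[OF j]] by (rule card_mono[rotated])
    then show ?thesis using a by simp
  qed
  have eq: "card (T p j) = card (T p i)" if j: "j \<in> \<Lambda>" for j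
  proof (cases "i = j")
    case False
    obtain k where k: "k \<in> \<Lambda>" "k \<noteq> i" "k \<noteq> j" using third_index[OF i j] by auto
    have "card (T p i) * card (T p k) * t = card (T p j) * card (T p k) * t"
      using card_Omega[OF i k(1), of p] card_Omega[OF j k(1), of p] k by auto
    then show ?thesis using ge2[OF k(1)] t1 by auto
  qed simp
  obtain w where w: "card (T p i) = Suc w" "w \<ge> 1"
    using ge2[OF i] by (cases "card (T p i)") auto
  have "S \<subseteq> \<Omega> p" by (rule S_Omega)
  have "card (\<Union>j\<in>\<Lambda>. \<Omega> p \<inter> K j - S) = (\<Sum>j\<in>\<Lambda>. card (\<Omega> p \<inter> K j - S))"
    by (rule card_UN_disjoint) (use finite_index finite_subgroup[OF subgroup_Omega] K_inter_K in auto)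
  also have "\<dots> = (\<Sum>j\<in>\<Lambda>. w * t)"
  proof (intro sum.cong refl)
    fix j assume j: "j \<in> \<Lambda>"
    have "card (\<Omega> p \<inter> K j - S) = card (\<Omega> p \<inter> K j) - card S"
      using S_Omega S_subset_K[OF j] finite_subgroup[OF subgroup_S] by (intro card_Diff_subset) auto
    then show "card (\<Omega> p \<inter> K j - S) = w * t"
      using card_Omega_K[OF j] eq[OF j] w card_S by simp
  qed
  also have "\<dots> = (t + 1) * (w * t)" using card_index by simp
  finally have 1: "card (\<Union>j\<in>\<Lambda>. \<Omega> p \<inter> K j - S) = (t + 1) * (w * t)" .
  obtain j where j: "j \<in> \<Lambda>" "j \<noteq> i" using third_index[OF i i] by auto
  have "card (\<Union>j\<in>\<Lambda>. \<Omega> p \<inter> K j - S) \<le> card (\<Omega> p - S)"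
    using finite_subgroup[OF subgroup_Omega] by (intro card_mono) auto
  also have "\<dots> = card (\<Omega> p) - card S"
    using S_Omega finite_subgroup[OF subgroup_S] by (intro card_Diff_subset) auto
  also have "\<dots> = Suc w * Suc w * t - t" using card_Omega[OF i j(1)] j eq[OF j(1)] w card_S by simp
  also have "\<dots> = (w + 2) * (w * t)" by (simp add: algebra_simps)
  finally have "(t + 1) * (w * t) \<le> (w + 2) * (w * t)" using 1 by simp
  then have "t + 1 \<le> w + 2" using w t1 by (subst (asm) mult_le_cancel2) auto
  then show ?thesis using w by simp
qed

lemma T_le: "i \<in> \<Lambda> \<Longrightarrow> card (T p i) \<le> s"
  using card_A card_mono[OF finite_subgroup[OF subgroup_A], of i "T p i"] by (auto simp: T_def)

lemma t_le_s: "t \<le> s"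
proof -
  obtain p where "prime p" "p dvd s" using prime_factor_nat[of s] s1 by auto
  then show ?thesis using T_card_ge T_le ex_index by (meson le_trans)
qed

text \<open>Two distinct primes dividing \<open>s\<close> would give two torsion subgroups of
  \<open>A i\<close> with trivial intersection and at least \<open>t\<close> elements each, so
  \<open>t^2 \<le> s\<close>. But the divisibility makes \<open>s + t\<close> a divisor of
  \<open>t^2\<close>, so \<open>s + t \<le> t^2\<close>. Hence \<open>s\<close> has a single prime
  divisor, where the arithmetic lemma applies.\<close>

lemma sum_not_dvd: "\<not> s + t dvd s * t"
proof
  assume dvd: "s + t dvd s * t"
  have single: "p = q" if pq: "prime p" "prime q" "p dvd s" "q dvd s" for p q
  proof (rule ccontr)
    assume ne: "p \<noteq> q"
    obtain i where i: "i \<in> \<Lambda>" using ex_index by blast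
    have "T p i \<inter> T q i \<subseteq> {\<one>}"
    proof
      fix a assume "a \<in> T p i \<inter> T q i"
      then have a: "a \<in> carrier G" "a [^] p = \<one>" "a [^] q = \<one>"
        using subgroup_carrier[OF subgroup_A[OF i]] by (auto simp: T_def)
      then have "ord a dvd p" "ord a dvd q" by (simp_all add: pow_eq_id)
      then have "ord a = 1" using pq ne by (metis prime_nat_iff primes_dvd_imp_eq)
      then show "a \<in> {\<one>}" using a ord_eq_1 by simp
    qed
    then have "card (T p i \<inter> T q i) \<le> 1" by (metis card_mono finite.simps card.empty card_insert_disjoint empty_iff One_nat_def)
    moreover have "card (T p i) * card (T q i) \<le> card (A i) * card (T p i \<inter> T q i)"
      using card_subgroups_le[OF finite_carrier subgroup_T[OF i] subgroup_T[OF i] subgroup_A[OF i]] by (auto simp: T_def)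
    ultimately have "card (T p i) * card (T q i) \<le> s"
      using card_A[OF i] by (metis mult.right_neutral mult_le_mono2 order_trans)
    moreover have "t * t \<le> card (T p i) * card (T q i)"
      using T_card_ge pq i by (intro mult_le_mono) auto
    ultimately have "t * t \<le> s" by simp
    have "t * (s + t) = s * t + t * t" by (simp add: algebra_simps)
    then have "s + t dvd t * t" using dvd by (metis dvd_add_right_iff dvd_triv_right)
    then have "s + t \<le> t * t" using t1 by (intro dvd_imp_le) auto
    then show False using \<open>t * t \<le> s\<close> t1 by simp
  qed
  show False
    using sum_not_dvd_mult_of_single_prime[OF s1 _ t_le_s single odd] t1 dvd by auto
qed

section \<open>Conjugacy of elements outside \<open>S\<close>\<close>

lemma conj_into_A:
  assumes "i \<in> \<Lambda>" "g \<in> K i" "g \<notin> S"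
  obtains h where "h \<in> carrier G" "h \<otimes> g \<otimes> inv h \<in> A i"
  using conj_into_A_or_dvd[OF assms] sum_not_dvd by blast

lemma pi_conj:
  assumes "g \<in> carrier G" "h \<in> carrier G"
  shows "\<pi> (h \<otimes> g \<otimes> inv h) = \<pi> g"
proof -
  have "\<pi> (h \<otimes> (g \<otimes> inv h)) = \<pi> ((g \<otimes> inv h) \<otimes> h)"
    using assms by (intro pi_commute) auto
  then show ?thesis using assms by (simp add: m_assoc del: pi.hom_mult)
qed

text \<open>Some conjugate of \<open>a \<sigma>\<close> lies in \<open>A i\<close>. The quotient by
  \<open>S\<close> is abelian, so this conjugate agrees with \<open>a\<close> modulo
  \<open>S\<close>; as \<open>A i\<close> meets \<open>S\<close> trivially, it is
  \<open>a\<close>.\<close>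

lemma conj_class_coset:
  assumes i: "i \<in> \<Lambda>" and a: "a \<in> A i" "a \<noteq> \<one>" and \<sigma>: "\<sigma> \<in> S"
  obtains h where "h \<in> carrier G" "h \<otimes> a \<otimes> inv h = a \<otimes> \<sigma>"
proof -
  have c: "a \<in> carrier G" "\<sigma> \<in> carrier G" using a \<sigma> subgroup_carrier[OF subgroup_A[OF i]] subgroup_carrier[OF subgroup_S] by auto
  have "a \<otimes> \<sigma> \<notin> S"
  proof
    assume "a \<otimes> \<sigma> \<in> S"
    then have "(a \<otimes> \<sigma>) \<otimes> inv \<sigma> \<in> S"
      using \<sigma> subgroup.m_closed[OF subgroup_S] subgroup.m_inv_closed[OF subgroup_S] by blast
    then show False using A_inter_S[OF i] a c by (auto simp: m_assoc)
  qed
  moreover have "a \<otimes> \<sigma> \<in> K i"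
    using a \<sigma> A_subset_K[OF i] S_subset_K[OF i] subgroup.m_closed[OF subgroup_K[OF i]] by blast
  ultimately obtain h where h: "h \<in> carrier G" "h \<otimes> (a \<otimes> \<sigma>) \<otimes> inv h \<in> A i"
    using conj_into_A[OF i] by blast
  let ?b = "h \<otimes> (a \<otimes> \<sigma>) \<otimes> inv h"
  have "\<pi> ?b = \<pi> (a \<otimes> \<sigma>)" using c h by (intro pi_conj) auto
  also have "\<dots> = \<pi> (\<sigma> \<otimes> a)" using c by (intro pi_commute)
  also have "\<dots> = \<pi> a" using c \<sigma> by (subst pi_eq_iff) (auto simp: m_assoc)
  finally have "?b \<otimes> inv a \<in> S" using c h by (subst (asm) pi_eq_iff) auto
  moreover have "?b \<otimes> inv a \<in> A i"
    using h a subgroup.m_closed[OF subgroup_A[OF i]] subgroup.m_inv_closed[OF subgroup_A[OF i]] by blast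
  ultimately have "?b \<otimes> inv a = \<one>" using A_inter_S[OF i] by blast
  then have "?b = a" using c h inv_solve_right'[of \<one> ?b a] by auto
  then have "inv h \<otimes> a \<otimes> inv (inv h) = inv h \<otimes> ?b \<otimes> h" using h by simp
  also have "\<dots> = a \<otimes> \<sigma>" using c h by (simp add: group_word_simps)
  finally show ?thesis using that h by blast
qed

text \<open>A conjugate of \<open>g\<close> lies in \<open>A i\<close>, so a conjugate of
  \<open>g^p\<close> lies in \<open>A i \<inter> S\<close>. This sharpens
  \<open>g^p \<in> S\<close>, but only for \<open>g\<close> outside \<open>S\<close>.\<close>

lemma Omega_K_minus_S_exponent:
  assumes i: "i \<in> \<Lambda>" and g: "g \<in> \<Omega> p \<inter> K i" "g \<notin> S"
  shows "g [^] p = \<one>"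
proof -
  obtain h where h: "h \<in> carrier G" "h \<otimes> g \<otimes> inv h \<in> A i"
    using conj_into_A[OF i] g by blast
  have c: "g \<in> carrier G" "g [^] p \<in> S" using g by (auto simp: \<Omega>_def)
  have "h \<otimes> g [^] p \<otimes> inv h \<in> S"
    using normal_S h c unfolding normal_inv_iff by blast
  moreover have "h \<otimes> g [^] p \<otimes> inv h \<in> A i"
    using subgroup_nat_pow_closed[OF subgroup_A[OF i] h(2), of p] conj_pow[OF c(1) h(1)] by simp
  ultimately have 1: "h \<otimes> g [^] p \<otimes> inv h = \<one>" using A_inter_S[OF i] by blast
  have "g [^] p = inv h \<otimes> (h \<otimes> g [^] p \<otimes> inv h) \<otimes> h"
    using c h by (simp add: group_word_simps)
  then show ?thesis unfolding 1 using h by simp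
qed

text \<open>An element of \<open>S\<close> of order \<open>r \<noteq> p\<close> would commute with no element of \<open>K i - S\<close> of order \<open>p\<close>,
  so its conjugacy class would not fit into \<open>S - {\<one>}\<close>.\<close>

lemma prime_divisors_eq:
  assumes p: "prime p" "p dvd s" and r: "prime r" "r dvd t"
  shows "r = p"
proof (rule ccontr)
  assume ne: "r \<noteq> p"
  obtain \<sigma> where \<sigma>: "\<sigma> \<in> S" "\<sigma> \<noteq> \<one>" "\<sigma> [^] r = \<one>"
    using exists_prime_order_element[OF subgroup_S finite_subgroup[OF subgroup_S] r(1)] r(2) card_S by auto
  have \<sigma>c: "\<sigma> \<in> carrier G" using \<sigma> subgroup_carrier[OF subgroup_S] by auto
  obtain i where i: "i \<in> \<Lambda>" using ex_index by blast
  let ?W = "\<Omega> p \<inter> K i"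
  have sW: "subgroup ?W G" using subgroups_Inter_pair[OF subgroup_Omega subgroup_K[OF i]] .
  have SW: "S \<subseteq> ?W" using S_Omega S_subset_K[OF i] by auto
  \<comment> \<open>If \<open>g\<close> outside \<open>S\<close> commuted with
    \<open>\<sigma>\<close>, both \<open>g\<close> and \<open>g \<sigma>\<close> would have trivial
    \<open>p\<close>-th power, hence so would \<open>\<sigma>\<close>; but \<open>\<sigma>\<close>
    has order \<open>r\<close>.\<close>
  have comm: "g \<in> S" if g: "g \<in> ?W" "g \<otimes> \<sigma> = \<sigma> \<otimes> g" for g
  proof (rule ccontr)
    assume gS: "g \<notin> S"
    have gc: "g \<in> carrier G" using g subgroup_carrier[OF sW] by auto
    have "g \<otimes> \<sigma> \<in> ?W" using g \<sigma> SW subgroup.m_closed[OF sW] by blast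
    moreover have "g \<otimes> \<sigma> \<notin> S"
    proof
      assume "g \<otimes> \<sigma> \<in> S"
      then have "g \<otimes> \<sigma> \<otimes> inv \<sigma> \<in> S"
        using \<sigma> subgroup.m_closed[OF subgroup_S] subgroup.m_inv_closed[OF subgroup_S] by blast
      then show False using gS gc \<sigma>c by (simp add: m_assoc)
    qed
    ultimately have "(g \<otimes> \<sigma>) [^] p = \<one>" by (rule Omega_K_minus_S_exponent[OF i])
    moreover have "(g \<otimes> \<sigma>) [^] p = g [^] p \<otimes> \<sigma> [^] p" using g gc \<sigma>c by (intro pow_mult_distrib)
    moreover have "g [^] p = \<one>" using Omega_K_minus_S_exponent[OF i g(1) gS] .
    ultimately have "\<sigma> [^] p = \<one>" using \<sigma>c by simp
    then have "ord \<sigma> dvd p" "ord \<sigma> dvd r" using \<sigma> \<sigma>c by (simp_all add: pow_eq_id)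
    then have "ord \<sigma> = 1" using p r ne by (metis prime_nat_iff primes_dvd_imp_eq)
    then show False using \<sigma> \<sigma>c ord_eq_1 by simp
  qed
  \<comment> \<open>The centralizer of \<open>\<sigma>\<close> in \<open>?W\<close> lies in
    \<open>S\<close>, so at least \<open>card ?W / t\<close> conjugates appear, and
    \<open>card ?W\<close> is at least \<open>t^2\<close> by the torsion bound. Yet the conjugates
    lie among the \<open>t - 1\<close> nontrivial elements of \<open>S\<close>.\<close>
  let ?f = "\<lambda>g. g \<otimes> \<sigma> \<otimes> inv g"
  have "card ?W \<le> card (?f ` ?W) * card S"
  proof (rule card_fibers_le[OF sW finite_subgroup[OF sW] finite_subgroup[OF subgroup_S]])
    fix g h assume gh: "g \<in> ?W" "h \<in> ?W" "?f g = ?f h"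
    then have "(inv g \<otimes> h) \<otimes> \<sigma> = \<sigma> \<otimes> (inv g \<otimes> h)"
      using conj_eq_iff_centralizes[of g h \<sigma>] subgroup_carrier[OF sW] \<sigma>c by blast
    moreover have "inv g \<otimes> h \<in> ?W"
      using gh subgroup.m_closed[OF sW] subgroup.m_inv_closed[OF sW] by blast
    ultimately show "inv g \<otimes> h \<in> S" using comm by blast
  qed
  moreover have "?f ` ?W \<subseteq> S - {\<one>}"
  proof
    fix y assume "y \<in> ?f ` ?W"
    then obtain g where g: "g \<in> carrier G" "y = ?f g" using subgroup_carrier[OF sW] by auto
    have "y \<in> S" using normal_S g \<sigma> unfolding normal_inv_iff by blast
    moreover have "y \<noteq> \<one>"
    proof
      assume "y = \<one>"
      have "\<sigma> = inv g \<otimes> ?f g \<otimes> g" using g(1) \<sigma>c by (simp add: group_word_simps)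
      then have "\<sigma> = \<one>" unfolding g(2)[symmetric] \<open>y = \<one>\<close> using g(1) by simp
      then show False using \<sigma> by simp
    qed
    ultimately show "y \<in> S - {\<one>}" by simp
  qed
  then have "card (?f ` ?W) \<le> t - 1"
    using card_mono[of "S - {\<one>}" "?f ` ?W"] finite_subgroup[OF subgroup_S] card_S subgroup.one_closed[OF subgroup_S]
    by simp
  ultimately have "card ?W \<le> (t - 1) * t"
    using card_S by (metis mult_le_mono1 order_trans)
  moreover have "t * t \<le> card ?W"
    unfolding card_Omega_K[OF i] using T_card_ge[OF p i] by simp
  ultimately have "t * t \<le> (t - 1) * t" by (rule order_trans[rotated])
  then show False using t1 by simp
qed

lemma is_p_group: "\<exists>p n. prime p \<and> Coset.order G = p ^ n"
proof -
  obtain p where p: "prime p" "p dvd s" using prime_factor_nat[of s] s1 by auto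
  have single: "q = p" if q: "prime q" "q dvd s * s * t" for q
  proof -
    obtain r where r: "prime r" "r dvd t" using prime_factor_nat[of t] t1 by auto
    have "q dvd s \<or> q dvd t" using q by (auto simp: prime_dvd_mult_iff)
    then show ?thesis
    proof
      assume "q dvd s"
      then show ?thesis using prime_divisors_eq[OF q(1) _ r] prime_divisors_eq[OF p r] by simp
    next
      assume "q dvd t"
      then show ?thesis using prime_divisors_eq[OF p q(1)] by simp
    qed
  qed
  have "s * s * t > 0" using s1 t1 by simp
  then have "\<exists>k. s * s * t = p ^ k" using p(1) single by (rule prime_power_of_single_prime)
  then show ?thesis using p ord by auto
qed

text \<open>If \<open>S\<close> is not central, pass to the quotient by a maximal normal \<open>M \<le> S\<close> modulo which it is still
  not central. There \<open>[S, G]\<close> has prime order \<open>p\<close>, so the commutator pairing of \<open>S\<close> with \<open>G\<close> has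
  radicals \<open>C\<close> and \<open>D\<close> with \<open>|S| |D| \<ge> |C| |G|\<close>. Hence \<open>D\<close> is too large to avoid any \<open>K i - S\<close>, so it
  meets each \<open>A i\<close>, then contains it (\<open>centralizes_of_conj\<close>), and finally is all of \<open>G\<close>.\<close>

lemma S_central:
  assumes "\<sigma> \<in> S" "g \<in> carrier G"
  shows "g \<otimes> \<sigma> = \<sigma> \<otimes> g"
proof (rule ccontr)
  assume not_central: "g \<otimes> \<sigma> \<noteq> \<sigma> \<otimes> g"
  obtain p n where p: "prime p" and pn: "Coset.order G = p ^ n" using is_p_group by blast
  have p0: "p > 1" using p prime_gt_1_nat by blast
  note Sc = subsetD[OF subgroup_carrier[OF subgroup_S]]
  \<comment> \<open>The normal subgroups inside \<open>S\<close> modulo which \<open>S\<close> is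
    still not central. The trivial subgroup is one of them by assumption, and a maximal member is
    taken.\<close>
  define F where "F = {M. M \<lhd> G \<and> M \<subseteq> S \<and> (\<exists>\<sigma>\<in>S. \<exists>g\<in>carrier G. g \<otimes> \<sigma> \<otimes> inv g \<otimes> inv \<sigma> \<notin> M)}"
  have "F \<subseteq> Pow S" by (auto simp: F_def)
  then have "finite F" using finite_subgroup[OF subgroup_S] finite_subset by blast
  have "g \<otimes> \<sigma> \<otimes> inv g \<otimes> inv \<sigma> \<noteq> \<one>"
  proof
    assume 1: "g \<otimes> \<sigma> \<otimes> inv g \<otimes> inv \<sigma> = \<one>"
    have "g \<otimes> \<sigma> = (g \<otimes> \<sigma> \<otimes> inv g \<otimes> inv \<sigma>) \<otimes> (\<sigma> \<otimes> g)"
      using assms Sc by (simp add: group_word_simps)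
    then show False unfolding 1 using assms Sc not_central by simp
  qed
  then have "{\<one>} \<in> F"
    using assms one_is_normal subgroup.one_closed[OF subgroup_S] by (auto simp: F_def)
  then obtain M where M: "M \<in> F" and maxM: "\<And>M'. M' \<in> F \<Longrightarrow> M \<subseteq> M' \<Longrightarrow> M = M'"
    using finite_has_maximal[OF \<open>finite F\<close>] by blast
  obtain \<sigma>\<^sub>0 g\<^sub>0 where M0: "\<sigma>\<^sub>0 \<in> S" "g\<^sub>0 \<in> carrier G" "g\<^sub>0 \<otimes> \<sigma>\<^sub>0 \<otimes> inv g\<^sub>0 \<otimes> inv \<sigma>\<^sub>0 \<notin> M"
    using M by (auto simp: F_def)
  have nM: "M \<lhd> G" and MS: "M \<subseteq> S" using M by (auto simp: F_def)
  have sM: "subgroup M G" using nM normal_imp_subgroup by blast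
  define Q where "Q = G Mod M"
  define q where "q = (\<lambda>a. M #> a)"
  interpret QG: group Q unfolding Q_def by (rule normal.factorgroup_is_group[OF nM])
  have "group_hom G Q q"
    using normal.r_coset_hom_Mod[OF nM] is_group QG.is_group
    unfolding Q_def q_def by (simp add: group_hom_def group_hom_axioms_def)
  then interpret qh: group_hom G Q q .
  have q_eq: "q g = q h \<longleftrightarrow> g \<otimes> inv h \<in> M" if "g \<in> carrier G" "h \<in> carrier G" for g h
    unfolding q_def using rcos_eq_iff[OF sM that] .
  have carQ: "carrier Q = q ` carrier G"
    unfolding Q_def q_def by (auto simp: FactGroup_def RCOSETS_def)
  have comm_iff: "q g \<otimes>\<^bsub>Q\<^esub> q \<sigma> = q \<sigma> \<otimes>\<^bsub>Q\<^esub> q g \<longleftrightarrow> g \<otimes> \<sigma> \<otimes> inv g \<otimes> inv \<sigma> \<in> M"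
    if "g \<in> carrier G" "\<sigma> \<in> carrier G" for g \<sigma>
    using q_eq[of "g \<otimes> \<sigma>" "\<sigma> \<otimes> g"] that by (simp add: group_word_simps)
  have ordQ: "\<exists>k. Coset.order Q = p ^ k"
  proof -
    have "Coset.order Q dvd p ^ n"
    proof -
      have "Coset.order Q = card (rcosets M)" by (simp add: Q_def Coset.order_def FactGroup_def)
      then show ?thesis using lagrange[OF sM] pn by (metis dvd_triv_left)
    qed
    then show ?thesis using p by (auto simp: divides_primepow_nat)
  qed
  have nqS: "q ` S \<lhd> Q"
    unfolding QG.normal_inv_iff
  proof (intro conjI ballI)
    show "subgroup (q ` S) Q" by (rule qh.subgroup_img_is_subgroup[OF subgroup_S])
    fix x y assume "x \<in> carrier Q" "y \<in> q ` S"
    then obtain g \<sigma> where "x = q g" "g \<in> carrier G" "y = q \<sigma>" "\<sigma> \<in> S" using carQ by auto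
    moreover from this have "g \<otimes> \<sigma> \<otimes> inv g \<in> S" using normal_S unfolding normal_inv_iff by blast
    ultimately show "x \<otimes>\<^bsub>Q\<^esub> y \<otimes>\<^bsub>Q\<^esub> inv\<^bsub>Q\<^esub> x \<in> q ` S"
      using Sc by (auto intro!: image_eqI[of _ q "g \<otimes> \<sigma> \<otimes> inv g"])
  qed
  have "q ` S \<noteq> {\<one>\<^bsub>Q\<^esub>}"
  proof
    assume 1: "q ` S = {\<one>\<^bsub>Q\<^esub>}"
    have "q \<sigma>\<^sub>0 = \<one>\<^bsub>Q\<^esub>" using 1 M0(1) by blast
    then have "q g\<^sub>0 \<otimes>\<^bsub>Q\<^esub> q \<sigma>\<^sub>0 = q \<sigma>\<^sub>0 \<otimes>\<^bsub>Q\<^esub> q g\<^sub>0" using M0(2) by simp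
    then show False using M0 comm_iff[OF M0(2) Sc[OF M0(1)]] by simp
  qed
  moreover obtain k where "Coset.order Q = p ^ k" using ordQ by blast
  ultimately obtain y where y: "y \<in> q ` S" "y \<noteq> \<one>\<^bsub>Q\<^esub>" "y [^]\<^bsub>Q\<^esub> p = \<one>\<^bsub>Q\<^esub>"
      "\<forall>x\<in>carrier Q. x \<otimes>\<^bsub>Q\<^esub> y = y \<otimes>\<^bsub>Q\<^esub> x"
    using QG.p_group_normal_meets_center[OF p _ nqS] by metis
  obtain z where zy: "z \<in> S" "y = q z" using y(1) by auto
  have z: "z \<in> S" "q z \<noteq> \<one>\<^bsub>Q\<^esub>" "q z [^]\<^bsub>Q\<^esub> p = \<one>\<^bsub>Q\<^esub>"
    and zc: "\<And>x. x \<in> carrier Q \<Longrightarrow> x \<otimes>\<^bsub>Q\<^esub> q z = q z \<otimes>\<^bsub>Q\<^esub> x"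
    using y zy by auto
  have zG: "z \<in> carrier G" and zQ: "q z \<in> carrier Q" using z Sc by auto
  have zk: "x \<otimes>\<^bsub>Q\<^esub> q z [^]\<^bsub>Q\<^esub> k = q z [^]\<^bsub>Q\<^esub> k \<otimes>\<^bsub>Q\<^esub> x" if "x \<in> carrier Q" for x and k :: nat
    using QG.group_commutes_pow[OF zc[OF that, symmetric] zQ that, of k] by simp
  have pow_mod: "\<exists>l<p. q z [^]\<^bsub>Q\<^esub> k = q z [^]\<^bsub>Q\<^esub> l" for k :: nat
  proof -
    have "q z [^]\<^bsub>Q\<^esub> k = q z [^]\<^bsub>Q\<^esub> (p * (k div p) + k mod p)" by simp
    also have "\<dots> = (q z [^]\<^bsub>Q\<^esub> p) [^]\<^bsub>Q\<^esub> (k div p) \<otimes>\<^bsub>Q\<^esub> q z [^]\<^bsub>Q\<^esub> (k mod p)"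
      using zQ by (simp only: QG.nat_pow_mult[symmetric] QG.nat_pow_pow)
    also have "\<dots> = q z [^]\<^bsub>Q\<^esub> (k mod p)" using z zQ by simp
    finally show ?thesis using p0 by (intro exI[of _ "k mod p"]) auto
  qed
  \<comment> \<open>The preimage of the cyclic subgroup generated by the central element
    \<open>q z\<close>: a normal subgroup inside \<open>S\<close> that properly contains
    \<open>M\<close>. Maximality then forces all commutators of \<open>S\<close> with the group into
    \<open>M'\<close>, so that they take at most \<open>p\<close> values modulo
    \<open>M\<close>.\<close>
  define M' where "M' = {g \<in> carrier G. \<exists>k::nat. q g = q z [^]\<^bsub>Q\<^esub> k}"
  have M'_pow: "\<exists>k<p. q g = q z [^]\<^bsub>Q\<^esub> k" if g: "g \<in> M'" for g
  proof -
    obtain k :: nat where "q g = q z [^]\<^bsub>Q\<^esub> k" using g by (auto simp: M'_def)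
    then show ?thesis using pow_mod[of k] by simp
  qed
  have zM': "z \<in> M'"
  proof -
    have "q z = q z [^]\<^bsub>Q\<^esub> (1::nat)" using zQ by simp
    then show ?thesis using zG unfolding M'_def by blast
  qed
  have sM': "subgroup M' G"
  proof (rule subgroupI)
    show "M' \<noteq> {}" using zM' by blast
    show "a \<otimes> b \<in> M'" if "a \<in> M'" "b \<in> M'" for a b
      using that zQ by (auto simp: M'_def QG.nat_pow_mult)
    show "inv a \<in> M'" if a: "a \<in> M'" for a
    proof -
      obtain k where k: "q a = q z [^]\<^bsub>Q\<^esub> k" "k < p" "a \<in> carrier G"
        using a M'_pow[OF a] by (auto simp: M'_def)
      have "q z [^]\<^bsub>Q\<^esub> (p - k) \<otimes>\<^bsub>Q\<^esub> q a = \<one>\<^bsub>Q\<^esub>"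
        using k z zQ by (simp add: QG.nat_pow_mult)
      then have "q (inv a) = q z [^]\<^bsub>Q\<^esub> (p - k)" using k zQ by (simp add: QG.inv_equality)
      then show ?thesis using k by (auto simp: M'_def)
    qed
  qed (auto simp: M'_def)
  have nM': "M' \<lhd> G"
    unfolding normal_inv_iff
  proof (intro conjI ballI sM')
    fix x h assume x: "x \<in> carrier G" and h: "h \<in> M'"
    then obtain k :: nat where k: "q h = q z [^]\<^bsub>Q\<^esub> k" "h \<in> carrier G" by (auto simp: M'_def)
    have "q (x \<otimes> h \<otimes> inv x) = q x \<otimes>\<^bsub>Q\<^esub> q z [^]\<^bsub>Q\<^esub> k \<otimes>\<^bsub>Q\<^esub> inv\<^bsub>Q\<^esub> q x" using x k by simp
    also have "\<dots> = q z [^]\<^bsub>Q\<^esub> k" using x zQ by (simp add: zk QG.m_assoc)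
    finally show "x \<otimes> h \<otimes> inv x \<in> M'" using x k by (auto simp: M'_def)
  qed
  have M'S: "M' \<subseteq> S"
  proof
    fix g assume "g \<in> M'"
    then obtain k where g: "g \<in> carrier G" "q g = q z [^]\<^bsub>Q\<^esub> (k::nat)" by (auto simp: M'_def)
    have "q g = q (z [^] k)" using g zG by (simp add: qh.hom_nat_pow)
    then have "g \<otimes> inv (z [^] k) \<in> S" using q_eq[of g "z [^] k"] g zG MS by auto
    then have "g \<otimes> inv (z [^] k) \<otimes> z [^] k \<in> S"
      using subgroup.m_closed[OF subgroup_S] subgroup_nat_pow_closed[OF subgroup_S z(1)] by blast
    then show "g \<in> S" using g zG by (simp add: m_assoc)
  qed
  have "M \<subseteq> M'"
  proof
    fix g assume g: "g \<in> M"
    then have gc: "g \<in> carrier G" using subgroup_carrier[OF sM] by auto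
    have "q g = q \<one>" using q_eq[OF gc one_closed] g gc by simp
    then have "q g = q z [^]\<^bsub>Q\<^esub> (0::nat)" by simp
    then show "g \<in> M'" using gc unfolding M'_def by blast
  qed
  moreover have "z \<in> M'" by (rule zM')
  moreover have "z \<notin> M" using z q_eq[OF zG one_closed] zG by auto
  ultimately have "M' \<notin> F" using maxM by blast
  then have commM': "g \<otimes> \<sigma> \<otimes> inv g \<otimes> inv \<sigma> \<in> M'" if "\<sigma> \<in> S" "g \<in> carrier G" for \<sigma> g
    using nM' M'S that unfolding F_def by blast
  \<comment> \<open>The relation of commuting modulo \<open>M\<close>. \<open>D\<close> and
    \<open>C\<close> are its radicals in the whole group and in \<open>S\<close>.\<close>
  define cm where "cm h \<sigma> \<longleftrightarrow> q h \<otimes>\<^bsub>Q\<^esub> q \<sigma> = q \<sigma> \<otimes>\<^bsub>Q\<^esub> q h" for h \<sigma>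
  define D where "D = {h \<in> carrier G. \<forall>\<sigma>\<in>S. cm h \<sigma>}"
  define C where "C = {\<sigma> \<in> S. \<forall>h\<in>carrier G. cm h \<sigma>}"
  have sD: "subgroup D G"
  proof -
    have eq: "D = {h \<in> carrier G. \<forall>y\<in>q ` S. q h \<otimes>\<^bsub>Q\<^esub> y = y \<otimes>\<^bsub>Q\<^esub> q h}" by (auto simp: D_def cm_def)
    have "q ` S \<subseteq> carrier Q" using Sc by auto
    then show ?thesis unfolding eq by (rule qh.subgroup_vimage_centralizer[OF subgroup_self])
  qed
  \<comment> \<open>An element outside \<open>D\<close> commutes modulo \<open>M\<close> only with a
    proper subgroup of the \<open>p\<close>-group \<open>S\<close>, of size at most
    \<open>t / p\<close>. Clearing the denominator and adding the excess for
    \<open>h \<in> D\<close> yields one formula for both cases.\<close>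
  have rel: "p * card {\<sigma> \<in> S. cm h \<sigma>} \<le> t + (if h \<in> D then (p - 1) * t else 0)" if h: "h \<in> carrier G" for h
  proof (cases "h \<in> D")
    case True
    then have "{\<sigma> \<in> S. cm h \<sigma>} = S" by (auto simp: D_def)
    then show ?thesis using True card_S p0 by (cases p) auto
  next
    case False
    let ?R = "{\<sigma> \<in> S. cm h \<sigma>}"
    have "?R = {\<sigma> \<in> S. \<forall>y\<in>{q h}. q \<sigma> \<otimes>\<^bsub>Q\<^esub> y = y \<otimes>\<^bsub>Q\<^esub> q \<sigma>}" by (auto simp: cm_def)
    then have sR: "subgroup ?R G" using qh.subgroup_vimage_centralizer[OF subgroup_S, of "{q h}"] h by simp
    have "card ?R dvd p ^ n" "card S dvd p ^ n" using lagrange[OF sR] lagrange[OF subgroup_S] pn by (metis dvd_triv_right)+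
    then obtain a b where ab: "card ?R = p ^ a" "card S = p ^ b" using p by (metis divides_primepow_nat)
    have "?R \<subset> S" using False h by (auto simp: D_def)
    then have "p ^ a < p ^ b" using psubset_card_mono[OF finite_subgroup[OF subgroup_S]] ab by metis
    then have "a < b" using p0 by (simp add: power_strict_increasing_iff)
    then have "p ^ Suc a \<le> p ^ b" using p0 by (intro power_increasing) auto
    then show ?thesis using ab card_S False by simp
  qed
  \<comment> \<open>Dually, the conjugates of \<open>\<sigma>\<close> modulo \<open>M\<close> differ
    from it by powers of \<open>q z\<close>, so there are at most \<open>p\<close> of them and the
    centralizer has index at most \<open>p\<close>; for \<open>\<sigma> \<in> C\<close> it is
    everything.\<close>
  have col: "Coset.order G + (if \<sigma> \<in> C then (p - 1) * Coset.order G else 0) \<le> p * card {h \<in> carrier G. cm h \<sigma>}"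
    if \<sigma>: "\<sigma> \<in> S" for \<sigma>
  proof (cases "\<sigma> \<in> C")
    case True
    then have "{h \<in> carrier G. cm h \<sigma>} = carrier G" by (auto simp: C_def)
    then show ?thesis using True p0 by (cases p) (auto simp: Coset.order_def)
  next
    case False
    let ?f = "\<lambda>h. q (h \<otimes> \<sigma> \<otimes> inv h)" and ?B = "{h \<in> carrier G. cm h \<sigma>}"
    have \<sigma>c: "\<sigma> \<in> carrier G" using \<sigma> Sc by auto
    have "card (carrier G) \<le> card (?f ` carrier G) * card ?B"
    proof (rule card_fibers_le[OF subgroup_self finite_carrier])
      fix g h assume gh: "g \<in> carrier G" "h \<in> carrier G" "?f g = ?f h"
      then have "q g \<otimes>\<^bsub>Q\<^esub> q \<sigma> \<otimes>\<^bsub>Q\<^esub> inv\<^bsub>Q\<^esub> q g = q h \<otimes>\<^bsub>Q\<^esub> q \<sigma> \<otimes>\<^bsub>Q\<^esub> inv\<^bsub>Q\<^esub> q h"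
        using \<sigma>c by simp
      then have "inv\<^bsub>Q\<^esub> q g \<otimes>\<^bsub>Q\<^esub> q h \<otimes>\<^bsub>Q\<^esub> q \<sigma> = q \<sigma> \<otimes>\<^bsub>Q\<^esub> (inv\<^bsub>Q\<^esub> q g \<otimes>\<^bsub>Q\<^esub> q h)"
        using gh \<sigma>c by (subst (asm) QG.conj_eq_iff_centralizes) auto
      then show "inv g \<otimes> h \<in> ?B" using gh by (simp add: cm_def)
    qed (use finite_carrier in auto)
    moreover have "card (?f ` carrier G) \<le> p"
    proof -
      have "?f ` carrier G \<subseteq> (\<lambda>k. q z [^]\<^bsub>Q\<^esub> k \<otimes>\<^bsub>Q\<^esub> q \<sigma>) ` {..<p}"
      proof
        fix y assume "y \<in> ?f ` carrier G"
        then obtain h where h: "h \<in> carrier G" "y = ?f h" by auto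
        obtain k where k: "k < p" "q (h \<otimes> \<sigma> \<otimes> inv h \<otimes> inv \<sigma>) = q z [^]\<^bsub>Q\<^esub> k"
          using M'_pow[OF commM'[OF \<sigma> h(1)]] by blast
        have "h \<otimes> \<sigma> \<otimes> inv h = (h \<otimes> \<sigma> \<otimes> inv h \<otimes> inv \<sigma>) \<otimes> \<sigma>"
          using h \<sigma>c by (simp add: m_assoc)
        then have "y = q (h \<otimes> \<sigma> \<otimes> inv h \<otimes> inv \<sigma>) \<otimes>\<^bsub>Q\<^esub> q \<sigma>"
          using h \<sigma>c by (metis qh.hom_mult m_closed inv_closed)
        then show "y \<in> (\<lambda>k. q z [^]\<^bsub>Q\<^esub> k \<otimes>\<^bsub>Q\<^esub> q \<sigma>) ` {..<p}" using k by auto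
      qed
      then have "card (?f ` carrier G) \<le> card ((\<lambda>k. q z [^]\<^bsub>Q\<^esub> k \<otimes>\<^bsub>Q\<^esub> q \<sigma>) ` {..<p})"
        by (intro card_mono) auto
      also have "\<dots> \<le> p" using card_image_le[of "{..<p}"] by simp
      finally show ?thesis .
    qed
    ultimately have "card (carrier G) \<le> p * card ?B" by (rule order_trans[OF _ mult_le_mono1])
    then show ?thesis using False by (simp add: Coset.order_def)
  qed
  let ?N = "Coset.order G"
  have CS: "finite C" using finite_subgroup[OF subgroup_S] by (auto simp: C_def)
  \<comment> \<open>Count the commuting pairs by columns from below and by rows from above. The
    common term \<open>t * ?N\<close> and the factor \<open>p - 1\<close> cancel.\<close>
  have "t * ?N + (p - 1) * ?N * card C = (\<Sum>\<sigma>\<in>S. ?N + (if \<sigma> \<in> C then (p - 1) * ?N else 0))"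
  proof -
    have "S \<inter> C = C" by (auto simp: C_def)
    then show ?thesis using finite_subgroup[OF subgroup_S] card_S by (simp add: sum.distrib sum.If_cases)
  qed
  also have "\<dots> \<le> (\<Sum>\<sigma>\<in>S. p * card {h \<in> carrier G. cm h \<sigma>})" by (intro sum_mono col)
  also have "\<dots> = (\<Sum>h\<in>carrier G. p * card {\<sigma> \<in> S. cm h \<sigma>})"
    using sum_card_swap[OF finite_subgroup[OF subgroup_S] finite_carrier, of "\<lambda>\<sigma> h. cm h \<sigma>"] by (simp add: sum_distrib_left[symmetric])
  also have "\<dots> \<le> (\<Sum>h\<in>carrier G. t + (if h \<in> D then (p - 1) * t else 0))" by (intro sum_mono rel)
  also have "\<dots> = ?N * t + (p - 1) * t * card D"
  proof -
    have "carrier G \<inter> D = D" by (auto simp: D_def)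
    then show ?thesis using finite_carrier by (simp add: sum.distrib sum.If_cases Coset.order_def)
  qed
  finally have "(p - 1) * (?N * card C) \<le> (p - 1) * (t * card D)" by (simp add: algebra_simps)
  then have ND: "?N * card C \<le> t * card D" using p0 by (subst (asm) mult_le_cancel1) auto
  have "{\<one>, z} \<subseteq> C"
    using z zc subgroup.one_closed[OF subgroup_S] by (auto simp: C_def cm_def)
  then have "card {\<one>, z} \<le> card C" using CS card_mono by blast
  moreover have "z \<noteq> \<one>"
  proof
    assume "z = \<one>"
    then have "q z = \<one>\<^bsub>Q\<^esub>" by simp
    then show False using z(2) by simp
  qed
  ultimately have "2 \<le> card C" by simp
  then have "?N * 2 \<le> t * card D" using ND mult_le_mono2[of 2 "card C" ?N] by linarith
  then have "t * (2 * (s * s)) \<le> t * card D" unfolding ord by (simp add: algebra_simps)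
  then have cD: "2 * (s * s) \<le> card D" using t1 by (subst (asm) mult_le_cancel1) auto
  have nD: "h \<otimes> g \<otimes> inv h \<in> D" if g: "g \<in> D" and h: "h \<in> carrier G" for g h
  proof -
    have gc: "g \<in> carrier G" using g by (simp add: D_def)
    have "cm (h \<otimes> g \<otimes> inv h) \<sigma>" if \<sigma>: "\<sigma> \<in> S" for \<sigma>
    proof -
      have "inv h \<otimes> \<sigma> \<otimes> inv (inv h) \<in> S" using normal_S \<sigma> inv_closed[OF h] unfolding normal_inv_iff by blast
      then have S': "inv h \<otimes> \<sigma> \<otimes> h \<in> S" using h by simp
      have q3: "q (x \<otimes> y \<otimes> w) = q x \<otimes>\<^bsub>Q\<^esub> q y \<otimes>\<^bsub>Q\<^esub> q w"
        if "x \<in> carrier G" "y \<in> carrier G" "w \<in> carrier G" for x y w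
        using that by simp
      have "cm g (inv h \<otimes> \<sigma> \<otimes> h)" using g S' by (simp add: D_def)
      then have *: "q (g \<otimes> (inv h \<otimes> \<sigma> \<otimes> h)) = q ((inv h \<otimes> \<sigma> \<otimes> h) \<otimes> g)"
        using gc h \<sigma> Sc by (simp add: cm_def)
      have "q (h \<otimes> g \<otimes> inv h) \<otimes>\<^bsub>Q\<^esub> q \<sigma> = q (h \<otimes> (g \<otimes> (inv h \<otimes> \<sigma> \<otimes> h)) \<otimes> inv h)"
        using gc h \<sigma> Sc by (subst qh.hom_mult[symmetric]) (auto simp: group_word_simps simp del: qh.hom_mult)
      also have "\<dots> = q h \<otimes>\<^bsub>Q\<^esub> q (g \<otimes> (inv h \<otimes> \<sigma> \<otimes> h)) \<otimes>\<^bsub>Q\<^esub> q (inv h)"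
        using gc h \<sigma> Sc by (intro q3) auto
      also have "\<dots> = q (h \<otimes> ((inv h \<otimes> \<sigma> \<otimes> h) \<otimes> g) \<otimes> inv h)"
        unfolding * using gc h \<sigma> Sc by (intro q3[symmetric]) auto
      also have "\<dots> = q \<sigma> \<otimes>\<^bsub>Q\<^esub> q (h \<otimes> g \<otimes> inv h)"
        using gc h \<sigma> Sc by (subst qh.hom_mult[symmetric]) (auto simp: group_word_simps simp del: qh.hom_mult)
      finally show ?thesis by (simp add: cm_def)
    qed
    then show ?thesis using gc h by (simp add: D_def)
  qed
  have KD: "K i \<subseteq> D" if i: "i \<in> \<Lambda>" for i
  proof -
    \<comment> \<open>Since \<open>z \<in> C\<close> gave \<open>card D \<ge> 2 s^2\<close>, the
      product formula yields at least \<open>2 s\<close> elements in \<open>D \<inter> K i\<close>.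
      This exceeds \<open>card S = t\<close> because \<open>t \<le> s\<close>, so there is an
      element of \<open>D\<close> outside \<open>S\<close> that can be conjugated into
      \<open>A i\<close>.\<close>
    have "card D * card (K i) \<le> card (carrier G) * card (D \<inter> K i)"
      by (rule card_subgroups_le[OF finite_carrier sD subgroup_K[OF i] subgroup_self]) (use subgroup_carrier[OF sD] subgroup_carrier[OF subgroup_K[OF i]] in auto)
    then have "card D * (s * t) \<le> s * (s * t) * card (D \<inter> K i)"
      using card_K[OF i] ord by (simp add: Coset.order_def mult.assoc)
    then have "(s * t) * card D \<le> (s * t) * (s * card (D \<inter> K i))"
      by (simp only: mult_ac)
    then have "card D \<le> s * card (D \<inter> K i)"
      using s1 t1 by (subst (asm) mult_le_cancel1) auto
    then have "2 * (s * s) \<le> s * card (D \<inter> K i)" using cD by (rule order_trans[rotated])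
    then have "s * (2 * s) \<le> s * card (D \<inter> K i)" by (simp add: algebra_simps)
    then have "2 * s \<le> card (D \<inter> K i)" using s1 by (subst (asm) mult_le_cancel1) auto
    then have "card S < card (D \<inter> K i)" using t_le_s card_S s1 by simp
    then have "\<not> D \<inter> K i \<subseteq> S" using card_mono[OF finite_subgroup[OF subgroup_S], of "D \<inter> K i"] by linarith
    then obtain g where g: "g \<in> D" "g \<in> K i" "g \<notin> S" by blast
    obtain h where h: "h \<in> carrier G" "h \<otimes> g \<otimes> inv h \<in> A i" using conj_into_A[OF i g(2,3)] by blast
    define a where "a = h \<otimes> g \<otimes> inv h"
    have gc: "g \<in> carrier G" using g subgroup_carrier[OF sD] by auto
    have a: "a \<in> A i" "a \<in> D" using h nD[OF g(1) h(1)] by (auto simp: a_def)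
    have ac: "a \<in> carrier G" using a subgroup_carrier[OF sD] by auto
    have "a \<noteq> \<one>"
    proof
      assume 1: "a = \<one>"
      have "g = inv h \<otimes> a \<otimes> h" using h gc by (simp add: a_def group_word_simps)
      then have "g = \<one>" using 1 h by simp
      then show False using g subgroup.one_closed[OF subgroup_S] by simp
    qed
    have AD: "A i \<subseteq> D"
    proof
      fix b assume b: "b \<in> A i"
      then have bc: "b \<in> carrier G" using subgroup_carrier[OF subgroup_A[OF i]] by auto
      have "cm b \<sigma>" if \<sigma>: "\<sigma> \<in> S" for \<sigma>
      proof -
        have \<sigma>c: "\<sigma> \<in> carrier G" using \<sigma> Sc by auto
        obtain h where h: "h \<in> carrier G" "h \<otimes> a \<otimes> inv h = a \<otimes> \<sigma>"
          using conj_class_coset[OF i a(1) \<open>a \<noteq> \<one>\<close> \<sigma>] by blast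
        \<comment> \<open>\<open>h\<close> witnesses that \<open>a\<close> and
          \<open>a \<sigma>\<close> are conjugate. Conjugating \<open>h\<close> by \<open>b\<close>
          changes it by a commutator \<open>\<tau>\<close> in \<open>S\<close>, and
          \<open>\<tau>\<close> commutes with \<open>a\<close> modulo \<open>M\<close> because
          \<open>a \<in> D\<close>; \<open>b\<close> commutes with \<open>a\<close> as
          \<open>A i\<close> is abelian.\<close>
        define \<tau> where "\<tau> = inv h \<otimes> b \<otimes> h \<otimes> inv b"
        have \<tau>: "\<tau> \<in> S"
          using commutator_in_S[of "inv h" b] h bc by (simp add: \<tau>_def)
        show ?thesis
          unfolding cm_def
        proof (rule QG.centralizes_of_conj[of "q a" "q b" "q \<sigma>" "q h" "q \<tau>"])
          have "q (a \<otimes> \<sigma>) = q (h \<otimes> a \<otimes> inv h)" unfolding h(2) ..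
          then show "q a \<otimes>\<^bsub>Q\<^esub> q \<sigma> = q h \<otimes>\<^bsub>Q\<^esub> q a \<otimes>\<^bsub>Q\<^esub> inv\<^bsub>Q\<^esub> q h"
            using h(1) ac \<sigma>c by simp
          have "b \<otimes> h \<otimes> inv b = h \<otimes> \<tau>" using h bc by (simp add: \<tau>_def group_word_simps)
          from arg_cong[OF this, of q]
          show "q b \<otimes>\<^bsub>Q\<^esub> q h \<otimes>\<^bsub>Q\<^esub> inv\<^bsub>Q\<^esub> q b = q h \<otimes>\<^bsub>Q\<^esub> q \<tau>" using h(1) bc \<tau> Sc by simp
          show "q \<tau> \<otimes>\<^bsub>Q\<^esub> q a = q a \<otimes>\<^bsub>Q\<^esub> q \<tau>" using a(2) \<tau> by (simp add: D_def cm_def)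
          have "q (b \<otimes> a) = q (a \<otimes> b)" using A_abelian[OF i b a(1)] by simp
          then show "q b \<otimes>\<^bsub>Q\<^esub> q a = q a \<otimes>\<^bsub>Q\<^esub> q b" using ac bc by simp
        qed (use ac bc \<sigma>c h(1) \<tau> Sc in auto)
      qed
      then show "b \<in> D" using bc by (simp add: D_def)
    qed
    have "S \<subseteq> D"
    proof
      fix \<sigma> assume \<sigma>: "\<sigma> \<in> S"
      obtain h where h: "h \<in> carrier G" "h \<otimes> a \<otimes> inv h = a \<otimes> \<sigma>"
        using conj_class_coset[OF i a(1) \<open>a \<noteq> \<one>\<close> \<sigma>] by blast
      have "a \<otimes> \<sigma> \<in> D" using nD[OF a(2) h(1)] unfolding h(2) .
      then have "inv a \<otimes> (a \<otimes> \<sigma>) \<in> D"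
        using subgroup.m_closed[OF sD subgroup.m_inv_closed[OF sD a(2)]] by blast
      then show "\<sigma> \<in> D" using ac \<sigma> Sc by (simp add: inv_mult_cancel)
    qed
    then show ?thesis
      unfolding K_eq_A_mult_S[OF i] using AD subgroup.m_closed[OF sD] by (auto simp: set_mult_def)
  qed
  obtain i where i: "i \<in> \<Lambda>" using ex_index by blast
  obtain j where j: "j \<in> \<Lambda>" "j \<noteq> i" using third_index[OF i i] by auto
  have "carrier G \<subseteq> D"
    unfolding K_mult_K[OF i j(1) j(2)[symmetric], symmetric]
    using KD[OF i] KD[OF j(1)] subgroup.m_closed[OF sD] by (auto simp: set_mult_def)
  then have "cm g\<^sub>0 \<sigma>\<^sub>0" using M0 by (auto simp: D_def)
  then show False using M0 comm_iff[OF M0(2) Sc[OF M0(1)]] by (simp add: cm_def)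
qed

section \<open>Centralizers and the centre\<close>

lemma conj_class_eq:
  assumes i: "i \<in> \<Lambda>" and a: "a \<in> A i" "a \<noteq> \<one>"
  shows "(\<lambda>g. g \<otimes> a \<otimes> inv g) ` carrier G = (\<lambda>\<sigma>. a \<otimes> \<sigma>) ` S"
proof
  have c: "a \<in> carrier G" using a subgroup_carrier[OF subgroup_A[OF i]] by auto
  show "(\<lambda>\<sigma>. a \<otimes> \<sigma>) ` S \<subseteq> (\<lambda>g. g \<otimes> a \<otimes> inv g) ` carrier G"
    using conj_class_coset[OF i a] by (metis (mono_tags, lifting) image_eqI image_subsetI)
  show "(\<lambda>g. g \<otimes> a \<otimes> inv g) ` carrier G \<subseteq> (\<lambda>\<sigma>. a \<otimes> \<sigma>) ` S"
  proof
    fix y assume "y \<in> (\<lambda>g. g \<otimes> a \<otimes> inv g) ` carrier G"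
    then obtain g where g: "g \<in> carrier G" "y = g \<otimes> a \<otimes> inv g" by auto
    have "y = a \<otimes> (inv a \<otimes> g \<otimes> a \<otimes> inv g)" using g c by (simp add: group_word_simps)
    moreover have "inv a \<otimes> g \<otimes> a \<otimes> inv g \<in> S" using commutator_in_S[of "inv a" g] g c by simp
    ultimately show "y \<in> (\<lambda>\<sigma>. a \<otimes> \<sigma>) ` S" by blast
  qed
qed

lemma card_centralizer:
  assumes i: "i \<in> \<Lambda>" and a: "a \<in> A i" "a \<noteq> \<one>"
  shows "card {h \<in> carrier G. h \<otimes> a = a \<otimes> h} = s * s"
proof -
  have c: "a \<in> carrier G" using a subgroup_carrier[OF subgroup_A[OF i]] by auto
  have "card ((\<lambda>\<sigma>. a \<otimes> \<sigma>) ` S) = t"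
  proof (subst card_image)
    show "inj_on (\<lambda>\<sigma>. a \<otimes> \<sigma>) S"
    proof (rule inj_onI)
      fix x y assume "x \<in> S" "y \<in> S" "a \<otimes> x = a \<otimes> y"
      then show "x = y" using c subsetD[OF subgroup_carrier[OF subgroup_S]] by simp
    qed
  qed (rule card_S)
  then have "s * s * t = t * card {h \<in> carrier G. h \<otimes> a = a \<otimes> h}"
    using card_conj_class[OF finite_carrier c] conj_class_eq[OF i a] ord by simp
  then show ?thesis using t1 by (metis mult.commute mult_cancel2 not_one_less_zero)
qed

lemma K_commutes_with_A:
  assumes i: "i \<in> \<Lambda>" and a: "a \<in> A i" and g: "g \<in> K i"
  shows "g \<otimes> a = a \<otimes> g"
proof -
  obtain b \<sigma> where b: "b \<in> A i" "\<sigma> \<in> S" "g = b \<otimes> \<sigma>" using K_decomp[OF i g] by blast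
  have c: "a \<in> carrier G" "b \<in> carrier G" "\<sigma> \<in> carrier G"
    using a b subgroup_carrier[OF subgroup_A[OF i]] subgroup_carrier[OF subgroup_S] by auto
  show ?thesis
    unfolding b(3) using c
    by (intro commute_mult) (auto intro: A_abelian[OF i b(1) a] S_central[OF b(2) c(1), symmetric])
qed

text \<open>Write \<open>h = x y\<close> with factors in \<open>K i\<close> and \<open>K j\<close>,
  and let \<open>a\<close> be the component of \<open>x\<close> in \<open>A i\<close>. It commutes
  with \<open>K i\<close>. Being \<open>h\<close> times inverses of \<open>y\<close> and of an
  element of \<open>S\<close>, it also commutes with \<open>A j\<close>, and so with the whole
  group. But a nontrivial \<open>a\<close> has a centralizer of order \<open>s^2\<close> only. Hence
  \<open>x \<in> S\<close>, and by symmetry \<open>y \<in> S\<close>.\<close>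

lemma central_in_S:
  assumes h: "h \<in> carrier G" and central: "\<And>g. g \<in> carrier G \<Longrightarrow> h \<otimes> g = g \<otimes> h"
  shows "h \<in> S"
proof -
  have key: "x \<in> S"
    if ij: "i \<in> \<Lambda>" "j \<in> \<Lambda>" "i \<noteq> j" and x: "x \<in> K i" and y: "y \<in> K j" and hxy: "h = x \<otimes> y" for i j x y
  proof -
    have c: "x \<in> carrier G" "y \<in> carrier G" using x y ij subgroup_carrier[OF subgroup_K] by auto
    obtain a \<sigma> where a: "a \<in> A i" "\<sigma> \<in> S" "x = a \<otimes> \<sigma>" using K_decomp[OF ij(1) x] by blast
    have ac: "a \<in> carrier G" "\<sigma> \<in> carrier G" using a subgroup_carrier[OF subgroup_A[OF ij(1)]] subgroup_carrier[OF subgroup_S] by auto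
    have "a = \<one>"
    proof (rule ccontr)
      assume "a \<noteq> \<one>"
      have ah: "a = h \<otimes> inv y \<otimes> inv \<sigma>" using hxy a ac c by (simp add: group_word_simps)
      have j: "b \<otimes> a = a \<otimes> b" if b: "b \<in> A j" for b
      proof -
        have bc: "b \<in> carrier G" using b subgroup_carrier[OF subgroup_A[OF ij(2)]] by auto
        have "inv y \<otimes> b = b \<otimes> inv y"
          by (rule K_commutes_with_A[OF ij(2) b]) (use y subgroup.m_inv_closed[OF subgroup_K[OF ij(2)]] in auto)
        moreover have "inv \<sigma> \<otimes> b = b \<otimes> inv \<sigma>"
          using S_central[OF subgroup.m_inv_closed[OF subgroup_S a(2)] bc] by simp
        ultimately have "(h \<otimes> inv y \<otimes> inv \<sigma>) \<otimes> b = b \<otimes> (h \<otimes> inv y \<otimes> inv \<sigma>)"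
          using h c ac bc central[OF bc] by (intro commute_mult) auto
        then show ?thesis unfolding ah[symmetric] by simp
      qed
      have "g \<otimes> a = a \<otimes> g" if g: "g \<in> carrier G" for g
      proof -
        have "g \<in> K i <#> K j" using K_mult_K[OF ij] g by simp
        then obtain u v where uv: "u \<in> K i" "v \<in> K j" "g = u \<otimes> v" by (auto simp: set_mult_def)
        obtain b \<rho> where b: "b \<in> A j" "\<rho> \<in> S" "v = b \<otimes> \<rho>" using K_decomp[OF ij(2) uv(2)] by blast
        have bc: "u \<in> carrier G" "b \<in> carrier G" "\<rho> \<in> carrier G"
          using uv b subgroup_carrier[OF subgroup_K[OF ij(1)]] subgroup_carrier[OF subgroup_A[OF ij(2)]] subgroup_carrier[OF subgroup_S] by auto
        have "u \<otimes> (b \<otimes> \<rho>) \<otimes> a = a \<otimes> (u \<otimes> (b \<otimes> \<rho>))"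
          using bc ac j[OF b(1)] S_central[OF b(2) ac(1)] K_commutes_with_A[OF ij(1) a(1) uv(1)]
          by (intro commute_mult) auto
        then show ?thesis using uv b by simp
      qed
      then have all: "{g \<in> carrier G. g \<otimes> a = a \<otimes> g} = carrier G" by auto
      have "card (carrier G) = s * s"
        using card_centralizer[OF ij(1) a(1) \<open>a \<noteq> \<one>\<close>] unfolding all .
      then have "s * s * t = s * s * 1" using ord unfolding Coset.order_def by (simp only: mult_1_right)
      then show False using s1 t1 unfolding mult_cancel1 by simp
    qed
    then show ?thesis using a ac by simp
  qed
  obtain i where i: "i \<in> \<Lambda>" using ex_index by blast
  obtain j where j: "j \<in> \<Lambda>" "j \<noteq> i" using third_index[OF i i] by auto
  have "h \<in> K i <#> K j" using K_mult_K[OF i j(1)] j(2) h by simp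
  then obtain x y where xy: "x \<in> K i" "y \<in> K j" "h = x \<otimes> y" by (auto simp: set_mult_def)
  have c: "x \<in> carrier G" "y \<in> carrier G" using xy subgroup_carrier[OF subgroup_K[OF i]] subgroup_carrier[OF subgroup_K[OF j(1)]] by auto
  have x: "x \<in> S" using key[OF i j(1) j(2)[symmetric] xy] .
  then have "h = y \<otimes> x" using S_central[OF x c(2)] xy by simp
  then have "y \<in> S" using key[OF j(1) i j(2) xy(2,1)] by simp
  then show ?thesis using x xy subgroup.m_closed[OF subgroup_S] by simp
qed

end

section \<open>The quadrangle\<close>

definition aut_grp :: "(('p \<Rightarrow> 'p) \<times> ('l \<Rightarrow> 'l)) set \<Rightarrow> (('p \<Rightarrow> 'p) \<times> ('l \<Rightarrow> 'l)) monoid" where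
  "aut_grp H = \<lparr>carrier = H, monoid.mult = aut_comp, one = aut_id\<rparr>"

lemma aut_grp_simps [simp]:
  "carrier (aut_grp H) = H" "monoid.mult (aut_grp H) = aut_comp" "one (aut_grp H) = aut_id"
  by (simp_all add: aut_grp_def)

lemma aut_comp_simps [simp]:
  "fst (aut_comp g h) p = fst g (fst h p)" "snd (aut_comp g h) l = snd g (snd h l)"
  "fst aut_id p = p" "snd aut_id l = l"
  by (simp_all add: aut_comp_def aut_id_def)

lemma group_aut_grp:
  assumes "aut_subgroup P L I H"
  shows "group (aut_grp H)"
proof (rule groupI)
  have assoc: "aut_comp (aut_comp f g) h = aut_comp f (aut_comp g h)" for f g h :: "('a \<Rightarrow> 'a) \<times> ('b \<Rightarrow> 'b)"
    by (simp add: aut_comp_def comp_assoc)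
  have one: "aut_comp aut_id h = h" "aut_comp h aut_id = h" for h :: "('a \<Rightarrow> 'a) \<times> ('b \<Rightarrow> 'b)"
    by (simp_all add: aut_comp_def aut_id_def)
  fix f assume "f \<in> carrier (aut_grp H)"
  then obtain g where g: "g \<in> H" "aut_comp f g = aut_id"
    using assms by (auto simp: aut_subgroup_def)
  then obtain k where k: "k \<in> H" "aut_comp g k = aut_id"
    using assms by (auto simp: aut_subgroup_def)
  \<comment> \<open>Only right inverses are given. The right inverse \<open>g\<close> of
    \<open>f\<close> has a right inverse \<open>k\<close> of its own, and \<open>k = f\<close>, so
    \<open>g\<close> is a left inverse as well.\<close>
  have "f = aut_comp f (aut_comp g k)" by (simp add: k one)
  also have "\<dots> = k" by (simp add: assoc[symmetric] g one)
  finally show "\<exists>y\<in>carrier (aut_grp H). y \<otimes>\<^bsub>aut_grp H\<^esub> f = \<one>\<^bsub>aut_grp H\<^esub>"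
    using g k by auto
qed (use assms in \<open>auto simp: aut_subgroup_def aut_comp_def aut_id_def\<close>)

locale stgq = gq P L I s t
  for P :: "'p set" and L :: "'l set" and I :: "'p \<Rightarrow> 'l \<Rightarrow> bool" and s t :: nat +
  fixes x :: 'p and H S :: "(('p \<Rightarrow> 'p) \<times> ('l \<Rightarrow> 'l)) set"
  assumes stgq: "skew_translation_GQ P L I s t x H S"
    and s1: "s > 1" and t1: "t > 1" and odd_s: "s = t \<Longrightarrow> odd s"
    and star: "property_star P L I x H"
begin

abbreviation coll where "coll \<equiv> collinear P L I"

lemma elation_GQ: "elation_GQ P L I s t x H" and S_subset_H: "S \<subseteq> H" and aut_subgroup_S: "aut_subgroup P L I S"
  and card_S: "card S = t" and symmetry_S: "h \<in> S \<Longrightarrow> symmetry_about P L I x h"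
  using stgq by (auto simp: skew_translation_GQ_def)

lemma x_in_P: "x \<in> P" and aut_subgroup_H: "aut_subgroup P L I H"
  and fix_lines: "h \<in> H \<Longrightarrow> N \<in> L \<Longrightarrow> I x N \<Longrightarrow> snd h N = N"
  and regular: "y \<in> P \<Longrightarrow> z \<in> P \<Longrightarrow> \<not> coll x y \<Longrightarrow> \<not> coll x z \<Longrightarrow> \<exists>!h. h \<in> H \<and> fst h y = z"
  using elation_GQ by (auto simp: elation_GQ_def)

lemma aut: "h \<in> H \<Longrightarrow> automorphism P L I h"
  using aut_subgroup_H by (auto simp: aut_subgroup_def)

sublocale H: group "aut_grp H"
  by (rule group_aut_grp[OF aut_subgroup_H])

abbreviation iv where "iv h \<equiv> inv\<^bsub>aut_grp H\<^esub> h"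

lemma aut_id_in_H: "aut_id \<in> H" and aut_comp_in_H: "g \<in> H \<Longrightarrow> h \<in> H \<Longrightarrow> aut_comp g h \<in> H" and iv_in_H: "h \<in> H \<Longrightarrow> iv h \<in> H"
  using H.one_closed H.m_closed H.inv_closed by simp_all

lemma iv_act:
  assumes "h \<in> H"
  shows "fst (iv h) (fst h p) = p" "fst h (fst (iv h) p) = p"
    "snd (iv h) (snd h l) = l" "snd h (snd (iv h) l) = l"
proof -
  have "aut_comp (iv h) h = aut_id" "aut_comp h (iv h) = aut_id"
    using H.l_inv[of h] H.r_inv[of h] assms by simp_all
  then show "fst (iv h) (fst h p) = p" "fst h (fst (iv h) p) = p"
    "snd (iv h) (snd h l) = l" "snd h (snd (iv h) l) = l"
    by (metis aut_comp_simps)+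
qed

lemma image_in_P: "h \<in> H \<Longrightarrow> p \<in> P \<Longrightarrow> fst h p \<in> P"
  and image_in_L: "h \<in> H \<Longrightarrow> l \<in> L \<Longrightarrow> snd h l \<in> L"
  and incidence_image: "h \<in> H \<Longrightarrow> p \<in> P \<Longrightarrow> l \<in> L \<Longrightarrow> I (fst h p) (snd h l) \<longleftrightarrow> I p l"
  using aut[of h] unfolding automorphism_def by (auto dest: bij_betwE)

lemma point_map_inj: "h \<in> H \<Longrightarrow> fst h p = fst h q \<Longrightarrow> p = q"
  by (metis iv_act(1))

lemma coll_image: "h \<in> H \<Longrightarrow> p \<in> P \<Longrightarrow> q \<in> P \<Longrightarrow> coll p q \<Longrightarrow> coll (fst h p) (fst h q)"
  unfolding collinear_def using image_in_L incidence_image by blast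

lemma coll_sym: "coll p q \<Longrightarrow> coll q p"
  by (auto simp: collinear_def)

lemma finite_lines: "finite {l \<in> L. Q l}" and finite_points: "finite {p \<in> P. Q' p}"
  using finite_L finite_P by auto

lemma other_line:
  assumes "p \<in> P" shows "\<exists>M\<in>L. I p M \<and> M \<noteq> N"
proof (rule ccontr)
  assume "\<not> ?thesis"
  then have "{l \<in> L. I p l} \<subseteq> {N}" by auto
  then have "card {l \<in> L. I p l} \<le> card {N}" by (intro card_mono) auto
  then show False using card_lines[OF assms] t1 by simp
qed

lemma other_point:
  assumes "l \<in> L" shows "\<exists>q\<in>P. I q l \<and> q \<noteq> p"
proof (rule ccontr)
  assume "\<not> ?thesis"
  then have "{q \<in> P. I q l} \<subseteq> {p}" by auto
  then have "card {q \<in> P. I q l} \<le> card {p}" by (intro card_mono) auto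
  then show False using card_points[OF assms] s1 by simp
qed

lemma fix_x:
  assumes h: "h \<in> H" shows "fst h x = x"
proof (rule ccontr)
  assume ne: "fst h x \<noteq> x"
  obtain N where N: "N \<in> L" "I x N" using other_line[OF x_in_P] by blast
  obtain M where M: "M \<in> L" "I x M" "M \<noteq> N" using other_line[OF x_in_P] by blast
  have "I (fst h x) N" "I (fst h x) M"
    using incidence_image[OF h x_in_P N(1)] incidence_image[OF h x_in_P M(1)] fix_lines[OF h] N M by auto
  then show False using line_unique[OF image_in_P[OF h x_in_P] x_in_P ne M(1) N(1)] N M by auto
qed

lemma far_image: "h \<in> H \<Longrightarrow> y \<in> P \<Longrightarrow> \<not> coll x y \<Longrightarrow> \<not> coll x (fst h y)"
  using coll_image[OF iv_in_H, of h x "fst h y"] x_in_P image_in_P fix_x[OF iv_in_H, of h] iv_act(1)[of h y] by auto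

lemma fix_far: "h \<in> H \<Longrightarrow> y \<in> P \<Longrightarrow> \<not> coll x y \<Longrightarrow> fst h y = y \<Longrightarrow> h = aut_id"
  using regular[of y y] aut_id_in_H by (metis aut_comp_simps(3))

text \<open>\<open>l\<close> is a line off \<open>x\<close>, \<open>w\<close> is the projection of
  \<open>x\<close> to \<open>l\<close>, and \<open>N\<close> is the line joining \<open>x\<close>
  and \<open>w\<close>. As \<open>H\<close> fixes every line on \<open>x\<close>, it moves
  \<open>w\<close> and \<open>l\<close> but keeps \<open>N\<close>.\<close>

definition flag :: "'l \<Rightarrow> 'p \<Rightarrow> 'l \<Rightarrow> bool" where
  "flag N w l \<longleftrightarrow> N \<in> L \<and> I x N \<and> w \<in> P \<and> I w N \<and> l \<in> L \<and> I w l \<and> \<not> I x l"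

lemma flag_ne: "flag N w l \<Longrightarrow> w \<noteq> x" and flag_coll: "flag N w l \<Longrightarrow> coll x w"
  by (auto simp: flag_def collinear_def)

lemma flag_far:
  assumes "flag N w l" "y \<in> P" "I y l" "y \<noteq> w"
  shows "\<not> coll x y"
  using proj_unique[OF x_in_P, of l y w] assms flag_coll[OF assms(1)] by (auto simp: flag_def)

lemma flag_unique:
  assumes f: "flag N w l" and f': "flag N' w' l"
  shows "w' = w" "N' = N"
proof -
  show w: "w' = w"
    using flag_far[OF f, of w'] f' flag_coll[OF f'] by (auto simp: flag_def)
  show "N' = N"
    using line_unique[OF x_in_P, of w N' N] f f' flag_ne[OF f] unfolding w by (auto simp: flag_def)
qed

lemma flag_of_line:
  assumes "l \<in> L" "\<not> I x l"
  shows "\<exists>N w. flag N w l"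
  using proj_ex1[OF x_in_P assms] assms unfolding flag_def collinear_def by blast

lemma proj_flag: "flag N w l \<Longrightarrow> proj P L I l x = w"
proof -
  assume f: "flag N w l"
  then have w: "w \<in> P" "I w l" by (auto simp: flag_def)
  show ?thesis
    unfolding proj_def
  proof (rule the_equality)
    show "w \<in> P \<and> I w l \<and> coll x w" using w flag_coll[OF f] by blast
    show "q = w" if "q \<in> P \<and> I q l \<and> coll x q" for q using that flag_far[OF f] by blast
  qed
qed

lemma far_not_on: "\<not> coll x y \<Longrightarrow> N \<in> L \<Longrightarrow> I x N \<Longrightarrow> \<not> I y N"
  by (auto simp: collinear_def)

lemma flag_of_far:
  assumes "y \<in> P" "\<not> coll x y" "N \<in> L" "I x N"
  shows "\<exists>w m. flag N w m \<and> I y m"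
proof -
  have "\<not> I y N" using far_not_on assms by blast
  then obtain w where w: "w \<in> P" "I w N" "coll y w" using proj_ex1 assms by blast
  then obtain m where m: "m \<in> L" "I y m" "I w m" by (auto simp: collinear_def)
  then have "\<not> I x m" using assms by (auto simp: collinear_def)
  then show ?thesis using w m assms by (auto simp: flag_def)
qed

lemma flag_far_unique:
  assumes y: "y \<in> P" "\<not> coll x y" and f: "flag N w m" "I y m" and f': "flag N w' m'" "I y m'"
  shows "w' = w" "m' = m"
proof -
  have n: "\<not> I y N" using far_not_on[OF y(2)] f by (auto simp: flag_def)
  have c: "coll y w" "coll y w'" using f f' by (auto simp: flag_def collinear_def)
  show w: "w' = w"
    using proj_unique[OF y(1) _ n, of w' w] f f' c by (auto simp: flag_def)
  have "y \<noteq> w" using n f by (auto simp: flag_def)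
  then show "m' = m"
    using line_unique[OF y(1), of w m' m] f f' unfolding w by (auto simp: flag_def)
qed

lemma flag_image:
  assumes h: "h \<in> H" and f: "flag N w l"
  shows "flag N (fst h w) (snd h l)"
proof -
  have N: "N \<in> L" "I x N" "w \<in> P" "I w N" "l \<in> L" "I w l" "\<not> I x l" using f by (auto simp: flag_def)
  then show ?thesis
    using image_in_P[OF h N(3)] image_in_L[OF h N(5)] incidence_image[OF h N(3,1)] incidence_image[OF h N(3,5)] incidence_image[OF h x_in_P N(5)]
      fix_lines[OF h N(1,2)] fix_x[OF h]
    by (auto simp: flag_def)
qed

lemma far_line_map:
  assumes h: "h \<in> H" and y: "y \<in> P" "\<not> coll x y" and f: "flag N w m" "I y m" and f': "flag N w' m'" "I (fst h y) m'"
  shows "snd h m = m'" "fst h w = w'"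
proof -
  have "I (fst h y) (snd h m)" using incidence_image[OF h y(1), of m] f by (auto simp: flag_def)
  then show "snd h m = m'" "fst h w = w'"
    using flag_far_unique[OF image_in_P[OF h y(1)] far_image[OF h y] f'] flag_image[OF h f(1)] by auto
qed

section \<open>Stabilizers and their orders\<close>

definition line_stab :: "'l \<Rightarrow> (('p \<Rightarrow> 'p) \<times> ('l \<Rightarrow> 'l)) set" where "line_stab l = {h \<in> H. snd h l = l}"

definition K :: "'l \<Rightarrow> (('p \<Rightarrow> 'p) \<times> ('l \<Rightarrow> 'l)) set" where
  "K N = {h \<in> H. \<forall>z\<in>P. I z N \<longrightarrow> fst h z = z}"

text \<open>The single place where \<open>property_star\<close> enters: fixing one point of
  \<open>N\<close> other than \<open>x\<close> is the same as fixing \<open>N\<close>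
  pointwise.\<close>

lemma K_of_fixed_point:
  assumes "h \<in> H" "N \<in> L" "I x N" "z \<in> P" "I z N" "z \<noteq> x" "fst h z = z"
  shows "h \<in> K N"
  using star assms unfolding property_star_def K_def collinear_def by blast

lemma line_stab_fixes_foot: "h \<in> line_stab l \<Longrightarrow> flag N w l \<Longrightarrow> fst h w = w"
  using flag_image[of h N w l] flag_unique(1)[of N w l N "fst h w"] unfolding line_stab_def mem_Collect_eq by metis

lemma line_stab_subset_K:
  assumes "flag N w l" shows "line_stab l \<subseteq> K N"
proof
  fix h assume h: "h \<in> line_stab l"
  show "h \<in> K N"
    by (rule K_of_fixed_point[of h N w])
      (use h assms line_stab_fixes_foot[OF h assms] flag_ne[OF assms] in \<open>auto simp: line_stab_def flag_def\<close>)
qed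

lemma card_minus_point: "l \<in> L \<Longrightarrow> p \<in> P \<Longrightarrow> I p l \<Longrightarrow> card ({y \<in> P. I y l} - {p}) = s"
  using card_points[of l] finite_points by (simp add: card_Diff_singleton)

text \<open>The stabilizer acts regularly on the \<open>s\<close> points of \<open>l\<close> other
  than \<open>w\<close>. An element carrying one of them to another must fix \<open>l\<close>, since
  \<open>l\<close> is the only line through either point that meets \<open>N\<close>.\<close>

lemma card_line_stab:
  assumes f: "flag N w l" shows "card (line_stab l) = s"
proof -
  have l: "l \<in> L" "w \<in> P" "I w l" using f by (auto simp: flag_def)
  obtain y where y: "y \<in> P" "I y l" "y \<noteq> w" using other_point[OF l(1)] by blast
  have far: "\<not> coll x y" using flag_far[OF f y] .
  have "bij_betw (\<lambda>h. fst h y) (line_stab l) ({y \<in> P. I y l} - {w})"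
    unfolding bij_betw_def
  proof
    show "inj_on (\<lambda>h. fst h y) (line_stab l)"
    proof (rule inj_onI)
      fix g h assume "g \<in> line_stab l" "h \<in> line_stab l" "fst g y = fst h y"
      then show "g = h"
        using regular[OF y(1) image_in_P[of h y] far far_image[of h y]] y far by (auto simp: line_stab_def)
    qed
    show "(\<lambda>h. fst h y) ` line_stab l = {y \<in> P. I y l} - {w}"
    proof
      show "(\<lambda>h. fst h y) ` line_stab l \<subseteq> {y \<in> P. I y l} - {w}"
      proof
        fix z assume "z \<in> (\<lambda>h. fst h y) ` line_stab l"
        then obtain h where h: "h \<in> H" "snd h l = l" "z = fst h y" "h \<in> line_stab l" by (auto simp: line_stab_def)
        have "z \<noteq> w" using line_stab_fixes_foot[OF h(4) f] h point_map_inj[OF h(1), of y w] y by auto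
        then show "z \<in> {y \<in> P. I y l} - {w}"
          using h image_in_P[OF h(1) y(1)] incidence_image[OF h(1) y(1) l(1)] y by auto
      qed
      show "{y \<in> P. I y l} - {w} \<subseteq> (\<lambda>h. fst h y) ` line_stab l"
      proof
        fix z assume z: "z \<in> {y \<in> P. I y l} - {w}"
        then obtain h where h: "h \<in> H" "fst h y = z"
          using regular[OF y(1) _ far flag_far[OF f]] by blast
        then have "snd h l = l" using far_line_map(1)[OF h(1) y(1) far f y(2) f] z by auto
        then show "z \<in> (\<lambda>h. fst h y) ` line_stab l" using h by (auto simp: line_stab_def)
      qed
    qed
  qed
  from bij_betw_same_card[OF this] show ?thesis using card_minus_point[OF l] by simp
qed

lemma line_transitive:
  assumes f: "flag N w l" and f': "flag N w' l'"
  shows "\<exists>h\<in>H. snd h l = l' \<and> fst h w = w'"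
proof -
  obtain y where y: "y \<in> P" "I y l" "y \<noteq> w" using other_point[of l w] f by (auto simp: flag_def)
  obtain z where z: "z \<in> P" "I z l'" "z \<noteq> w'" using other_point[of l' w'] f' by (auto simp: flag_def)
  note far = flag_far[OF f y] flag_far[OF f' z]
  obtain h where h: "h \<in> H" "fst h y = z" using regular[OF y(1) z(1) far] by blast
  then show ?thesis using far_line_map[OF h(1) y(1) far(1) f y(2) f'] z by auto
qed

text \<open>For \<open>w \<noteq> x\<close> on \<open>N\<close> these are the points not collinear
  with \<open>x\<close> whose projection to \<open>N\<close> is \<open>w\<close>. As
  \<open>w\<close> varies they partition the points not collinear with \<open>x\<close>.\<close>

definition far_points :: "'l \<Rightarrow> 'p \<Rightarrow> 'p set" where
  "far_points N w = (\<Union>m\<in>{m \<in> L. I w m} - {N}. {y \<in> P. I y m} - {w})"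

lemma flag_through: "N \<in> L \<Longrightarrow> I x N \<Longrightarrow> w \<in> P \<Longrightarrow> I w N \<Longrightarrow> w \<noteq> x \<Longrightarrow> m \<in> L \<Longrightarrow> I w m \<Longrightarrow> m \<noteq> N \<Longrightarrow> flag N w m"
  using line_unique[OF x_in_P, of w N m] by (auto simp: flag_def)

lemma far_points_iff:
  assumes "N \<in> L" "I x N" "w \<in> P" "I w N" "w \<noteq> x"
  shows "y \<in> far_points N w \<longleftrightarrow> y \<in> P \<and> \<not> coll x y \<and> (\<exists>m. flag N w m \<and> I y m)"
proof
  assume "y \<in> far_points N w"
  then obtain m where m: "m \<in> L" "I w m" "m \<noteq> N" "y \<in> P" "I y m" "y \<noteq> w" by (auto simp: far_points_def)
  then have "flag N w m" using flag_through assms by blast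
  then show "y \<in> P \<and> \<not> coll x y \<and> (\<exists>m. flag N w m \<and> I y m)" using flag_far m by blast
next
  assume "y \<in> P \<and> \<not> coll x y \<and> (\<exists>m. flag N w m \<and> I y m)"
  then show "y \<in> far_points N w" using assms flag_coll by (auto simp: far_points_def flag_def collinear_def)
qed

lemma card_far_points:
  assumes "N \<in> L" "I x N" "w \<in> P" "I w N" "w \<noteq> x"
  shows "card (far_points N w) = s * t"
proof -
  have "card (far_points N w) = (\<Sum>m\<in>{m \<in> L. I w m} - {N}. card ({y \<in> P. I y m} - {w}))"
    unfolding far_points_def
  proof (rule card_UN_disjoint)
    show "\<forall>i\<in>{m \<in> L. I w m} - {N}. \<forall>j\<in>{m \<in> L. I w m} - {N}. i \<noteq> j \<longrightarrow>
        ({y \<in> P. I y i} - {w}) \<inter> ({y \<in> P. I y j} - {w}) = {}"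
      using line_unique[OF assms(3)] by blast
  qed (use finite_L finite_P in auto)
  also have "\<dots> = (\<Sum>m\<in>{m \<in> L. I w m} - {N}. s)"
    using card_minus_point assms by (intro sum.cong) auto
  also have "\<dots> = s * t" using card_lines[OF assms(3)] assms finite_lines by (simp add: card_Diff_singleton)
  finally show ?thesis .
qed

lemma ex_far_point:
  assumes "N \<in> L" "I x N" "w \<in> P" "I w N" "w \<noteq> x"
  shows "\<exists>y. y \<in> far_points N w"
  using card_far_points[OF assms] s1 t1 card_gt_0_iff[of "far_points N w"] by auto

lemma card_far: "card {y \<in> P. \<not> coll x y} = s * s * t"
proof -
  obtain N where N: "N \<in> L" "I x N" using other_line[OF x_in_P] by blast
  have "{y \<in> P. \<not> coll x y} = (\<Union>w\<in>{w \<in> P. I w N} - {x}. far_points N w)"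
  proof
    show "{y \<in> P. \<not> coll x y} \<subseteq> (\<Union>w\<in>{w \<in> P. I w N} - {x}. far_points N w)"
    proof
      fix y assume y: "y \<in> {y \<in> P. \<not> coll x y}"
      then obtain w m where f: "flag N w m" "I y m" using flag_of_far[of y N] N by auto
      then have w: "w \<in> P" "I w N" "w \<noteq> x" using flag_ne by (auto simp: flag_def)
      then show "y \<in> (\<Union>w\<in>{w \<in> P. I w N} - {x}. far_points N w)" using far_points_iff[OF N w] y f by auto
    qed
    show "(\<Union>w\<in>{w \<in> P. I w N} - {x}. far_points N w) \<subseteq> {y \<in> P. \<not> coll x y}" using far_points_iff[OF N] by auto
  qed
  then have "card {y \<in> P. \<not> coll x y} = card (\<Union>w\<in>{w \<in> P. I w N} - {x}. far_points N w)" by simp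
  also have "\<dots> = (\<Sum>w\<in>{w \<in> P. I w N} - {x}. card (far_points N w))"
  proof (rule card_UN_disjoint)
    show "\<forall>w\<in>{w \<in> P. I w N} - {x}. finite (far_points N w)"
      by (auto simp: far_points_def finite_L finite_P)
    show "\<forall>w\<in>{w \<in> P. I w N} - {x}. \<forall>v\<in>{w \<in> P. I w N} - {x}. w \<noteq> v \<longrightarrow> far_points N w \<inter> far_points N v = {}"
    proof (intro ballI impI)
      fix w v assume "w \<in> {w \<in> P. I w N} - {x}" "v \<in> {w \<in> P. I w N} - {x}" "w \<noteq> v"
      then have "w \<in> P" "I w N" "w \<noteq> x" "v \<in> P" "I v N" "v \<noteq> x" by auto
      then show "far_points N w \<inter> far_points N v = {}"
        using far_points_iff[OF N] flag_far_unique(1) \<open>w \<noteq> v\<close> by blast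
    qed
  qed (use finite_P in auto)
  also have "\<dots> = (\<Sum>w\<in>{w \<in> P. I w N} - {x}. s * t)"
    using card_far_points[OF N] by (intro sum.cong) auto
  also have "\<dots> = s * s * t" using card_minus_point[OF N(1) x_in_P N(2)] by simp
  finally show ?thesis .
qed

lemma card_H: "card H = s * s * t"
proof -
  obtain N where N: "N \<in> L" "I x N" using other_line[OF x_in_P] by blast
  obtain w where w: "w \<in> P" "I w N" "w \<noteq> x" using other_point[OF N(1)] by blast
  obtain y where "y \<in> far_points N w" using ex_far_point[OF N w] by blast
  then have y: "y \<in> P" "\<not> coll x y" using far_points_iff[OF N w] by auto
  have "bij_betw (\<lambda>h. fst h y) H {y \<in> P. \<not> coll x y}"
    unfolding bij_betw_def
  proof
    show "inj_on (\<lambda>h. fst h y) H"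
      using regular[OF y(1) image_in_P[OF _ y(1)] y(2) far_image[OF _ y]] by (intro inj_onI) blast
    show "(\<lambda>h. fst h y) ` H = {y \<in> P. \<not> coll x y}"
      using regular[OF y(1) _ y(2)] image_in_P[OF _ y(1)] far_image[OF _ y] by (auto simp: image_iff) blast
  qed
  from bij_betw_same_card[OF this] show ?thesis using card_far by simp
qed

text \<open>\<open>K N\<close> acts regularly on \<open>far_points N w\<close>: an element of
  \<open>H\<close> carrying one such point to another fixes their common projection
  \<open>w\<close>, hence all of \<open>N\<close>.\<close>

lemma card_K:
  assumes N: "N \<in> L" "I x N" shows "card (K N) = s * t"
proof -
  obtain w where w: "w \<in> P" "I w N" "w \<noteq> x" using other_point[OF N(1)] by blast
  obtain y where "y \<in> far_points N w" using ex_far_point[OF N w] by blast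
  then obtain m where y: "y \<in> P" "\<not> coll x y" and m: "flag N w m" "I y m" using far_points_iff[OF N w] by auto
  have KH: "K N \<subseteq> H" by (auto simp: K_def)
  have "bij_betw (\<lambda>h. fst h y) (K N) (far_points N w)"
    unfolding bij_betw_def
  proof
    show "inj_on (\<lambda>h. fst h y) (K N)"
      using regular[OF y(1) image_in_P[OF _ y(1)] y(2) far_image[OF _ y]] KH by (intro inj_onI) blast
    show "(\<lambda>h. fst h y) ` K N = far_points N w"
    proof
      show "(\<lambda>h. fst h y) ` K N \<subseteq> far_points N w"
      proof
        fix z assume "z \<in> (\<lambda>h. fst h y) ` K N"
        then obtain h where h: "h \<in> H" "fst h w = w" "z = fst h y" using w by (auto simp: K_def)
        have "flag N w (snd h m)" using flag_image[OF h(1) m(1)] h by simp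
        moreover have "I z (snd h m)" using incidence_image[OF h(1) y(1)] m h by (auto simp: flag_def)
        ultimately show "z \<in> far_points N w" using far_points_iff[OF N w] image_in_P[OF h(1) y(1)] far_image[OF h(1) y] h by blast
      qed
      show "far_points N w \<subseteq> (\<lambda>h. fst h y) ` K N"
      proof
        fix z assume "z \<in> far_points N w"
        then obtain m' where z: "z \<in> P" "\<not> coll x z" and m': "flag N w m'" "I z m'" using far_points_iff[OF N w] by auto
        obtain h where h: "h \<in> H" "fst h y = z" using regular[OF y(1) z(1) y(2) z(2)] by blast
        have "fst h w = w" using far_line_map(2)[OF h(1) y m m'(1)] m' h by simp
        then have "h \<in> K N" using K_of_fixed_point[OF h(1) N w] by simp
        then show "z \<in> (\<lambda>h. fst h y) ` K N" using h by auto
      qed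
    qed
  qed
  from bij_betw_same_card[OF this] show ?thesis using card_far_points[OF N w] by simp
qed

section \<open>Normality and intersections of the stabilizers\<close>

lemma subgroup_line_stab: "subgroup (line_stab l) (aut_grp H)"
proof (rule H.subgroupI)
  have "aut_id \<in> line_stab l" by (simp add: line_stab_def aut_id_in_H)
  then show "line_stab l \<noteq> {}" by blast
  show "iv h \<in> line_stab l" if "h \<in> line_stab l" for h
    using that iv_in_H iv_act(3)[of h l] by (auto simp: line_stab_def)
qed (auto simp: line_stab_def aut_comp_in_H)

lemma subgroup_K: "N \<in> L \<Longrightarrow> I x N \<Longrightarrow> subgroup (K N) (aut_grp H)"
proof (rule H.subgroupI)
  have "aut_id \<in> K N" by (simp add: K_def aut_id_in_H)
  then show "K N \<noteq> {}" by blast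
  show "iv h \<in> K N" if "h \<in> K N" for h
  proof -
    have h: "h \<in> H" and f: "\<And>z. z \<in> P \<Longrightarrow> I z N \<Longrightarrow> fst h z = z" using that by (auto simp: K_def)
    have "fst (iv h) z = z" if "z \<in> P" "I z N" for z
      using iv_act(1)[OF h, of z] f[OF that] by simp
    then show ?thesis using iv_in_H[OF h] by (auto simp: K_def)
  qed
qed (auto simp: K_def aut_comp_in_H)

lemma subgroup_S: "subgroup S (aut_grp H)"
proof (rule H.subgroupI)
  show "S \<noteq> {}" using card_S t1 by auto
  show "iv h \<in> S" if "h \<in> S" for h
  proof -
    obtain g where g: "g \<in> S" "aut_comp h g = aut_id"
      using aut_subgroup_S \<open>h \<in> S\<close> unfolding aut_subgroup_def by blast
    have c: "g \<in> H" "h \<in> H" using g \<open>h \<in> S\<close> S_subset_H by auto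
    then have "aut_comp g h = aut_id" using H.inv_comm[of h g] g by simp
    then have "iv h = g" using H.inv_equality[of g h] c by simp
    then show ?thesis using g by simp
  qed
qed (use S_subset_H aut_subgroup_S in \<open>auto simp: aut_subgroup_def\<close>)

lemma normal_K:
  assumes N: "N \<in> L" "I x N"
  shows "K N \<lhd> aut_grp H"
  unfolding H.normal_inv_iff
proof (intro conjI ballI subgroup_K[OF N])
  fix g h assume g: "g \<in> carrier (aut_grp H)" and h: "h \<in> K N"
  have gH: "g \<in> H" using g by simp
  have "fst g (fst h (fst (iv g) z)) = z" if z: "z \<in> P" "I z N" for z
  proof -
    have "fst (iv g) z \<in> P" "I (fst (iv g) z) N"
      using image_in_P[OF iv_in_H[OF gH]] incidence_image[OF iv_in_H[OF gH] z(1) N(1)] fix_lines[OF iv_in_H[OF gH] N] z by auto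
    then have "fst h (fst (iv g) z) = fst (iv g) z" using h by (auto simp: K_def)
    then show ?thesis using iv_act(2)[OF gH] by simp
  qed
  then show "g \<otimes>\<^bsub>aut_grp H\<^esub> h \<otimes>\<^bsub>aut_grp H\<^esub> iv g \<in> K N"
    using gH h aut_comp_in_H iv_in_H by (auto simp: K_def)
qed

lemma S_subset_K: "N \<in> L \<Longrightarrow> I x N \<Longrightarrow> S \<subseteq> K N"
  using symmetry_S S_subset_H by (auto simp: K_def symmetry_about_def collinear_def)

text \<open>Such an \<open>h\<close> fixes \<open>l\<close> and a point \<open>z \<noteq> x\<close>
  of \<open>N'\<close>, hence the projection \<open>u\<close> of \<open>z\<close> to
  \<open>l\<close>. If \<open>u\<close> were \<open>w\<close>, then \<open>x\<close>,
  \<open>w\<close>, \<open>z\<close> would form a triangle. So \<open>u\<close> is not collinear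
  with \<open>x\<close>, and by regularity only the identity fixes it.\<close>

lemma line_stab_inter_K:
  assumes f: "flag N w l" and N': "N' \<in> L" "I x N'" "N' \<noteq> N" and h: "h \<in> line_stab l" "h \<in> K N'"
  shows "h = aut_id"
proof -
  have hH: "h \<in> H" "snd h l = l" using h by (auto simp: line_stab_def)
  have l: "l \<in> L" "N \<in> L" "I x N" "w \<in> P" "I w N" using f by (auto simp: flag_def)
  obtain z where z: "z \<in> P" "I z N'" "z \<noteq> x" using other_point[OF N'(1)] by blast
  have zh: "fst h z = z" using h z by (auto simp: K_def)
  have zN: "\<not> I z N" using line_unique[OF x_in_P z(1)] z l N' by blast
  have xz: "coll z x" using z N' by (auto simp: collinear_def)
  have zl: "\<not> I z l"
    using flag_far[OF f z(1)] xz coll_sym zN l z by blast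
  obtain u where u: "u \<in> P" "I u l" "coll z u" using proj_ex1[OF z(1) l(1) zl] by blast
  have "fst h u = u"
    by (rule proj_unique[OF z(1) l(1) zl])
      (use u image_in_P[OF hH(1)] incidence_image[OF hH(1) u(1) l(1)] hH coll_image[OF hH(1) z(1) u(1)] zh in auto)
  moreover have "u \<noteq> w"
  proof
    assume "u = w"
    then have "x = w"
      using proj_unique[OF z(1) l(2) zN, of x w] x_in_P xz l u by auto
    then show False using flag_ne[OF f] by simp
  qed
  ultimately show ?thesis using fix_far[OF hH(1) u(1)] flag_far[OF f u(1,2)] by blast
qed

lemma another_line: "\<exists>N'\<in>L. I x N' \<and> N' \<noteq> N"
  using other_line[OF x_in_P] by blast

lemma line_stab_inter_S: "flag N w l \<Longrightarrow> line_stab l \<inter> S = {aut_id}"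
proof -
  assume f: "flag N w l"
  obtain N' where N': "N' \<in> L" "I x N'" "N' \<noteq> N" using another_line by blast
  have "aut_id \<in> S" using aut_subgroup_S by (simp add: aut_subgroup_def)
  then show ?thesis
    using line_stab_inter_K[OF f N'] S_subset_K[OF N'(1,2)] aut_id_in_H by (auto simp: line_stab_def)
qed

lemma finite_H: "finite H"
  using card_H s1 t1 by (intro card_ge_0_finite) simp

lemma ex_flag: "N \<in> L \<Longrightarrow> I x N \<Longrightarrow> \<exists>w l. flag N w l"
  using other_point[of N x] other_line[of _ N] flag_through[of N] by blast

text \<open>The stabilizer of a line meeting \<open>N\<close> has order \<open>s\<close>, lies in
  \<open>K N\<close> of order \<open>s t\<close>, and meets the intersection trivially. So the
  intersection has at most \<open>t\<close> elements, and it contains \<open>S\<close>.\<close>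

lemma K_inter_K:
  assumes N: "N \<in> L" "I x N" and N': "N' \<in> L" "I x N'" and ne: "N \<noteq> N'"
  shows "K N \<inter> K N' = S"
proof -
  obtain w l where f: "flag N w l" using ex_flag[OF N] by blast
  have sub: "S \<subseteq> K N \<inter> K N'" using S_subset_K[OF N] S_subset_K[OF N'] by blast
  have sKK: "subgroup (K N \<inter> K N') (aut_grp H)" using H.subgroups_Inter_pair[OF subgroup_K[OF N] subgroup_K[OF N']] .
  have "line_stab l \<inter> (K N \<inter> K N') \<subseteq> {aut_id}"
    using line_stab_inter_K[OF f N'] ne by blast
  then have "card (line_stab l \<inter> (K N \<inter> K N')) \<le> card {aut_id :: ('p \<Rightarrow> 'p) \<times> ('l \<Rightarrow> 'l)}"
    by (intro card_mono) auto
  moreover have "card (line_stab l) * card (K N \<inter> K N') \<le> card (K N) * card (line_stab l \<inter> (K N \<inter> K N'))"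
    by (rule H.card_subgroups_le[OF _ subgroup_line_stab sKK subgroup_K[OF N]]) (use finite_H line_stab_subset_K[OF f] in auto)
  ultimately have "s * card (K N \<inter> K N') \<le> s * t * card {aut_id :: ('p \<Rightarrow> 'p) \<times> ('l \<Rightarrow> 'l)}"
    unfolding card_line_stab[OF f] card_K[OF N] by (meson mult_le_mono2 order_trans)
  then have "card (K N \<inter> K N') \<le> card S" using s1 card_S by simp
  moreover have "finite (K N \<inter> K N')" using finite_H by (auto simp: K_def)
  ultimately show ?thesis using card_seteq[OF _ sub] by blast
qed

text \<open>If \<open>g\<close> fixes no line off \<open>x\<close> meeting \<open>N\<close>, its fixed points are the points of \<open>N\<close>, and only
  points collinear with \<open>x\<close> are mapped to collinear points; so Benson's congruence reads \<open>s + t\<close> divides \<open>s * t\<close>.\<close>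

lemma conj_into_line_stab:
  assumes f: "flag N w l" and g: "g \<in> K N" "g \<notin> S"
  shows "(\<exists>h\<in>H. aut_comp (aut_comp h g) (iv h) \<in> line_stab l) \<or> s + t dvd s * t"
proof (rule disjCI)
  assume "\<not> s + t dvd s * t"
  show "\<exists>h\<in>H. aut_comp (aut_comp h g) (iv h) \<in> line_stab l"
  proof (rule ccontr)
    assume no: "\<not> ?thesis"
    have gH: "g \<in> H" using g by (simp add: K_def)
    have N: "N \<in> L" "I x N" using f by (auto simp: flag_def)
    \<comment> \<open>\<open>H\<close> is transitive on the lines off \<open>x\<close> meeting
      \<open>N\<close>, so a fixed line of this kind could be moved to \<open>l\<close>, conjugating
      \<open>g\<close> into the stabilizer of \<open>l\<close>.\<close>
    have nofix: "snd g k \<noteq> k" if fk: "flag N v k" for v k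
    proof
      assume k: "snd g k = k"
      obtain h where h: "h \<in> H" "snd h k = l" using line_transitive[OF fk f] by blast
      have "snd (iv h) l = k" using iv_act(3)[OF h(1), of k] h by simp
      then have "aut_comp (aut_comp h g) (iv h) \<in> line_stab l"
        using h k gH aut_comp_in_H iv_in_H by (auto simp: line_stab_def)
      then show False using no h by blast
    qed
    \<comment> \<open>The points of \<open>N\<close> are fixed. Those on the other lines through
      \<open>x\<close> are moved within their line, as a fixed one would put \<open>g\<close> into a
      second \<open>K M\<close>, hence into \<open>S\<close>. The remaining ones go to non-collinear
      points.\<close>
    let ?N = "{p \<in> P. I p N}" and ?F = "{p \<in> P. \<not> coll x p}" and ?Z = "{p \<in> P. coll x p \<and> \<not> I p N}"
    have N1: "common_lines (fst g p) p = t + 1" if "p \<in> ?N" for p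
      using that g common_lines_self by (auto simp: K_def)
    have Z1: "common_lines (fst g p) p = 1" if p: "p \<in> ?Z" for p
    proof -
      have pP: "p \<in> P" "\<not> I p N" "coll x p" using p by auto
      then obtain M where M: "M \<in> L" "I x M" "I p M" by (auto simp: collinear_def)
      have "fst g p \<noteq> p"
      proof
        assume "fst g p = p"
        moreover have "p \<noteq> x" using pP N by auto
        ultimately have "g \<in> K M" using K_of_fixed_point[OF gH M(1,2) pP(1) M(3)] by simp
        moreover have "N \<noteq> M" using M pP by auto
        ultimately show False using K_inter_K[OF N M(1,2)] g by blast
      qed
      moreover have "coll (fst g p) p"
        using incidence_image[OF gH pP(1) M(1)] fix_lines[OF gH M(1,2)] M by (auto simp: collinear_def)
      ultimately show ?thesis using common_lines_distinct[OF image_in_P[OF gH pP(1)] pP(1)] by simp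
    qed
    have F1: "common_lines (fst g p) p = 0" if p: "p \<in> ?F" for p
    proof -
      have pP: "p \<in> P" "\<not> coll x p" using p by auto
      have gp: "fst g p \<in> P" "\<not> coll x (fst g p)" using image_in_P[OF gH pP(1)] far_image[OF gH pP] by auto
      have ne: "fst g p \<noteq> p"
        using fix_far[OF gH pP] g subgroup.one_closed[OF subgroup_S] by auto
      obtain v k where k: "flag N v k" "I p k" using flag_of_far[OF pP N] by blast
      have v: "v \<in> P" "I v N" "I v k" "k \<in> L" using k by (auto simp: flag_def)
      have gv: "fst g v = v" using g v by (auto simp: K_def)
      have gk: "flag N v (snd g k)" using flag_image[OF gH k(1)] gv by simp
      have gpk: "I (fst g p) (snd g k)" using incidence_image[OF gH pP(1) v(4)] k by simp
      \<comment> \<open>\<open>p\<close> and its image are both joined to the fixed point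
        \<open>v\<close> on \<open>N\<close>. A line joining the two would have to pass through
        \<open>v\<close>, as there are no triangles, and would then be both \<open>k\<close> and its
        image.\<close>
      have "\<not> coll (fst g p) p"
      proof
        assume "coll (fst g p) p"
        then obtain m where m: "m \<in> L" "I (fst g p) m" "I p m" by (auto simp: collinear_def)
        have "I v m"
        proof (rule ccontr)
          assume "\<not> I v m"
          moreover have "coll v p" "coll v (fst g p)"
            using v k gk gpk by (auto simp: collinear_def flag_def)
          ultimately show False using proj_unique[OF v(1) m(1), of p "fst g p"] pP gp m ne by auto
        qed
        moreover have "p \<noteq> v" "fst g p \<noteq> v" using far_not_on pP gp N v by auto
        ultimately have "m = k" "m = snd g k"
          using line_unique[OF pP(1) v(1) _ m(1) v(4)] line_unique[OF gp(1) v(1) _ m(1), of "snd g k"]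
            m k v gk gpk by (auto simp: flag_def)
        then show False using nofix[OF k(1)] by simp
      qed
      then show ?thesis using common_lines_distinct[OF gp(1) pP(1) ne] by simp
    qed
    have NN: "?N \<inter> ?Z = {}" "(?N \<union> ?Z) \<inter> ?F = {}" "P = (?N \<union> ?Z) \<union> ?F"
      using N by (auto simp: collinear_def)
    have "card P = card ?N + card ?Z + card ?F"
      by (subst NN(3), subst card_Un_disjoint[OF _ _ NN(2)])
        (use finite_P card_Un_disjoint[OF _ _ NN(1)] in auto)
    \<comment> \<open>\<open>(s + 1) (s t + 1) - (s + 1) - s^2 t = s t\<close>. Each of these points
      counts 1, and the points of \<open>N\<close> contribute exactly the constant
      \<open>(s + 1) (t + 1)\<close> of Benson's congruence.\<close>
    then have cZ: "card ?Z = s * t"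
      unfolding card_P[OF x_in_P] card_far using card_points[OF N(1)] by (simp add: algebra_simps)
    have "(\<Sum>p\<in>P. common_lines (fst g p) p)
        = (\<Sum>p\<in>?N \<union> ?Z. common_lines (fst g p) p) + (\<Sum>p\<in>?F. common_lines (fst g p) p)"
      by (subst NN(3), rule sum.union_disjoint) (use finite_P NN in auto)
    also have "(\<Sum>p\<in>?N \<union> ?Z. common_lines (fst g p) p)
        = (\<Sum>p\<in>?N. common_lines (fst g p) p) + (\<Sum>p\<in>?Z. common_lines (fst g p) p)"
      by (rule sum.union_disjoint) (use finite_P NN in auto)
    also have "(\<Sum>p\<in>?N. common_lines (fst g p) p) = (\<Sum>p\<in>?N. t + 1)" by (rule sum.cong[OF refl N1])
    also have "(\<Sum>p\<in>?Z. common_lines (fst g p) p) = (\<Sum>p\<in>?Z. 1)" by (rule sum.cong[OF refl Z1])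
    also have "(\<Sum>p\<in>?F. common_lines (fst g p) p) = (\<Sum>p\<in>?F. 0)" by (rule sum.cong[OF refl F1])
    finally have "(\<Sum>p\<in>P. common_lines (fst g p) p) = (s + 1) * (t + 1) + s * t"
      using card_points[OF N(1)] cZ by simp
    then have "int (s + t) dvd int (s * t)"
      using benson[OF aut[OF gH] x_in_P] by simp
    then show False using \<open>\<not> s + t dvd s * t\<close> by (simp only: of_nat_dvd_iff)
  qed
qed

section \<open>Passage to the abstract group\<close>

lemma stgq_group_aut_grp:
  assumes m: "\<And>N. N \<in> L \<Longrightarrow> I x N \<Longrightarrow> \<exists>w. flag N w (m N)"
  shows "stgq_group (aut_grp H) S {N \<in> L. I x N} K (\<lambda>N. line_stab (m N)) s t"
proof (intro stgq_group.intro stgq_group_axioms.intro H.is_group)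
  show "Coset.order (aut_grp H) = s * s * t" using card_H by (simp add: Coset.order_def)
  show "subgroup S (aut_grp H)" by (rule subgroup_S)
  show "card {N \<in> L. I x N} = t + 1" using card_lines[OF x_in_P] .
  fix i assume i: "i \<in> {N \<in> L. I x N}"
  then obtain w where f: "flag i w (m i)" using m by blast
  show "K i \<lhd> aut_grp H" "card (K i) = s * t" "S \<subseteq> K i"
    using normal_K card_K S_subset_K i by auto
  show "subgroup (line_stab (m i)) (aut_grp H)" "line_stab (m i) \<subseteq> K i" "card (line_stab (m i)) = s"
    using subgroup_line_stab line_stab_subset_K[OF f] card_line_stab[OF f] by auto
  show "line_stab (m i) \<inter> S = {\<one>\<^bsub>aut_grp H\<^esub>}" using line_stab_inter_S[OF f] by simp
  show "(\<exists>h\<in>carrier (aut_grp H). h \<otimes>\<^bsub>aut_grp H\<^esub> g \<otimes>\<^bsub>aut_grp H\<^esub> iv h \<in> line_stab (m i)) \<or> s + t dvd s * t"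
    if "g \<in> K i" "g \<notin> S" for g
    using conj_into_line_stab[OF f that] by simp
  show "K i \<inter> K j = S" if "j \<in> {N \<in> L. I x N}" "i \<noteq> j" for j
    using K_inter_K[of i j] i that by auto
qed (use card_S s1 t1 odd_s in auto)

text \<open>The abstract setting knows only one chosen line for each \<open>N\<close>. Making the
  choice at \<open>N\<close> the given \<open>l\<close> opens its results to the stabilizer of an
  arbitrary line off \<open>x\<close>.\<close>

lemma stgq_group_at_flag:
  assumes f: "flag N w l"
  obtains m where "stgq_group (aut_grp H) S {N \<in> L. I x N} K (\<lambda>N. line_stab (m N)) s t" "m N = l"
proof -
  define m where "m = (\<lambda>M. if M = N then l else SOME k. \<exists>w. flag M w k)"
  have "\<exists>w. flag M w (m M)" if "M \<in> L" "I x M" for M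
  proof (cases "M = N")
    case False
    have "\<exists>k w. flag M w k" using ex_flag[OF that] by blast
    then have "\<exists>w. flag M w (SOME k. \<exists>w. flag M w k)" by (rule someI_ex)
    then show ?thesis using False by (simp add: m_def)
  qed (use f in \<open>auto simp: m_def\<close>)
  then have "stgq_group (aut_grp H) S {N \<in> L. I x N} K (\<lambda>N. line_stab (m N)) s t"
    by (rule stgq_group_aut_grp)
  then show ?thesis by (rule that) (simp add: m_def)
qed

section \<open>Fixed lines and the centre\<close>

lemma S_commutes:
  assumes "\<sigma> \<in> S" "h \<in> H" shows "aut_comp h \<sigma> = aut_comp \<sigma> h"
proof -
  obtain N where N: "N \<in> L" "I x N" using other_line[OF x_in_P] by blast
  obtain w l where f: "flag N w l" using ex_flag[OF N] by blast
  obtain m where "stgq_group (aut_grp H) S {N \<in> L. I x N} K (\<lambda>N. line_stab (m N)) s t"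
    using stgq_group_at_flag[OF f] by blast
  from stgq_group.S_central[OF this assms(1)] assms(2) show ?thesis by simp
qed

text \<open>\<open>S\<close> fixes \<open>w\<close>, and only the identity of \<open>S\<close> fixes
  a line off \<open>x\<close>. So its \<open>t\<close> elements give \<open>t\<close> different
  images of \<open>l\<close>, which are all the lines through \<open>w\<close> other than
  \<open>N\<close>.\<close>

lemma S_transitive_on_pencil:
  assumes f: "flag N w l" and g: "flag N w k"
  shows "\<exists>\<sigma>\<in>S. snd \<sigma> l = k"
proof -
  have N: "N \<in> L" "I x N" "w \<in> P" "I w N" "l \<in> L" using f by (auto simp: flag_def)
  have "inj_on (\<lambda>\<sigma>. snd \<sigma> l) S"
  proof (rule inj_onI)
    fix \<sigma> \<tau> assume st: "\<sigma> \<in> S" "\<tau> \<in> S" "snd \<sigma> l = snd \<tau> l"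
    then have c: "\<sigma> \<in> H" "\<tau> \<in> H" using S_subset_H by auto
    have "aut_comp (iv \<sigma>) \<tau> \<in> S"
      using subgroup.m_closed[OF subgroup_S] subgroup.m_inv_closed[OF subgroup_S] st by fastforce
    moreover have "aut_comp (iv \<sigma>) \<tau> \<in> line_stab l"
      using c aut_comp_in_H iv_in_H st(3)[symmetric] iv_act(3)[OF c(1), of l] by (simp add: line_stab_def)
    ultimately have "aut_comp (iv \<sigma>) \<tau> = aut_id" using line_stab_inter_S[OF f] by blast
    then show "\<sigma> = \<tau>"
      using H.inv_mult_cancel(2)[of \<sigma> \<tau>] H.r_one[of \<sigma>] c by simp
  qed
  moreover have "{k. flag N w k} = {k \<in> L. I w k} - {N}"
    using flag_through[OF N(1-4)] flag_ne[OF f] N by (auto simp: flag_def)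
  then have "card {k. flag N w k} = t" "finite {k. flag N w k}"
    using card_lines[OF N(3)] N finite_L by (auto simp: card_Diff_singleton)
  moreover have "(\<lambda>\<sigma>. snd \<sigma> l) ` S \<subseteq> {k. flag N w k}"
  proof
    fix y assume "y \<in> (\<lambda>\<sigma>. snd \<sigma> l) ` S"
    then obtain \<sigma> where \<sigma>: "\<sigma> \<in> S" "y = snd \<sigma> l" by auto
    have "fst \<sigma> w = w" using S_subset_K[OF N(1,2)] \<sigma> N by (auto simp: K_def)
    then show "y \<in> {k. flag N w k}" using flag_image[OF subsetD[OF S_subset_H \<sigma>(1)] f] \<sigma> by simp
  qed
  ultimately have "(\<lambda>\<sigma>. snd \<sigma> l) ` S = {k. flag N w k}"
    using card_S by (intro card_subset_eq) (auto simp: card_image)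
  then have "k \<in> (\<lambda>\<sigma>. snd \<sigma> l) ` S" using g by simp
  then show ?thesis unfolding image_iff by metis
qed

text \<open>Every line through \<open>w\<close> other than \<open>N\<close> is the image of
  \<open>l\<close> under an element of \<open>S\<close>, with which \<open>h\<close>
  commutes.\<close>

lemma stabilizer_fixes_pencil:
  assumes f: "flag N w l" and h: "h \<in> H" "snd h l = l" and M: "M \<in> L" "I w M"
  shows "snd h M = M"
proof (cases "M = N")
  case True
  then show ?thesis using fix_lines[OF h(1)] f by (simp add: flag_def)
next
  case False
  then have "flag N w M" using flag_through[of N w M] f M flag_ne[OF f] by (auto simp: flag_def)
  then obtain \<sigma> where \<sigma>: "\<sigma> \<in> S" "snd \<sigma> l = M" using S_transitive_on_pencil[OF f] by blast
  have "snd h (snd \<sigma> l) = snd \<sigma> (snd h l)"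
    using S_commutes[OF \<sigma>(1) h(1)] aut_comp_simps(2) by metis
  then show ?thesis using \<sigma> h by simp
qed

text \<open>The set is the orbit of \<open>w\<close> under the centralizer \<open>C\<close> of
  \<open>\<alpha>\<close>. As \<open>K N\<close> is contained in \<open>C\<close> and is the
  stabilizer of \<open>w\<close>, the orbit has \<open>s^2 / (s t)\<close> points. The product form
  of the claim avoids the division.\<close>

lemma card_bracket:
  assumes f: "flag N w l" and \<alpha>: "\<alpha> \<in> H" "snd \<alpha> l = l" "\<alpha> \<noteq> aut_id"
  shows "card (bracket P L I x w \<alpha>) * t = s"
proof -
  obtain m where "stgq_group (aut_grp H) S {N \<in> L. I x N} K (\<lambda>N. line_stab (m N)) s t" and mN: "m N = l"
    using stgq_group_at_flag[OF f] by blast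
  then interpret E: stgq_group "aut_grp H" S "{N \<in> L. I x N}" K "\<lambda>N. line_stab (m N)" s t by simp
  have N: "N \<in> L" "I x N" "w \<in> P" "I w N" "l \<in> L" using f by (auto simp: flag_def)
  have wx: "w \<noteq> x" using flag_ne[OF f] .
  have \<alpha>l: "\<alpha> \<in> line_stab (m N)" using \<alpha> mN by (simp add: line_stab_def)
  define C where "C = {h \<in> H. aut_comp h \<alpha> = aut_comp \<alpha> h}"
  have cC: "card C = s * s"
    using E.card_centralizer[of N \<alpha>] N \<alpha>l \<alpha> by (simp add: C_def)
  have sC: "subgroup C (aut_grp H)"
    using H.subgroup_centralizer[OF H.subgroup_self, of "{\<alpha>}"] \<alpha> by (simp add: C_def)
  have KC: "K N \<subseteq> C"
  proof
    fix g assume g: "g \<in> K N"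
    then have "aut_comp g \<alpha> = aut_comp \<alpha> g"
      using E.K_commutes_with_A[of N \<alpha> g] N \<alpha>l by simp
    then show "g \<in> C" using g by (simp add: C_def K_def)
  qed
  have br: "bracket P L I x w \<alpha> = (\<lambda>h. fst h w) ` C"
  proof
    show "bracket P L I x w \<alpha> \<subseteq> (\<lambda>h. fst h w) ` C"
    proof
      fix z assume "z \<in> bracket P L I x w \<alpha>"
      then obtain N' M where z: "z \<in> P" "N' \<in> L" "I x N'" "I w N'" "I z N'" "M \<in> L" "\<not> I x M" "snd \<alpha> M = M" "I z M"
        by (auto simp: bracket_def)
      have "N' = N" using line_unique[OF x_in_P N(3)] wx z N by blast
      then have fM: "flag N z M" using z by (simp add: flag_def)
      obtain h where h: "h \<in> H" "snd h l = M" "fst h w = z" using line_transitive[OF f fM] by blast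
      \<comment> \<open>Bring the fixed line \<open>M\<close> back to \<open>l\<close>. The
        conjugate \<open>\<beta>\<close> fixes \<open>l\<close> and agrees with
        \<open>\<alpha>\<close> modulo \<open>S\<close>, so \<open>\<beta> = \<alpha>\<close>
        because the stabilizer of \<open>l\<close> meets \<open>S\<close> trivially. Thus
        \<open>h\<close> centralizes \<open>\<alpha>\<close>.\<close>
      define \<beta> where "\<beta> = aut_comp (iv h) (aut_comp \<alpha> h)"
      have \<beta>H: "\<beta> \<in> H" using h \<alpha> iv_in_H aut_comp_in_H by (simp add: \<beta>_def)
      have "snd \<beta> l = l" using h z iv_act(3)[OF h(1), of l] by (simp add: \<beta>_def)
      then have \<beta>l: "\<beta> \<in> line_stab l" using \<beta>H by (simp add: line_stab_def)
      have "aut_comp (iv \<alpha>) \<beta> = iv \<alpha> \<otimes>\<^bsub>aut_grp H\<^esub> iv h \<otimes>\<^bsub>aut_grp H\<^esub> iv (iv \<alpha>) \<otimes>\<^bsub>aut_grp H\<^esub> iv (iv h)"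
        using h(1) \<alpha>(1) H.m_assoc iv_in_H aut_comp_in_H by (simp add: \<beta>_def)
      also have "\<dots> \<in> S"
        using E.commutator_in_S[of "iv \<alpha>" "iv h"] iv_in_H h(1) \<alpha>(1) by simp
      finally have "aut_comp (iv \<alpha>) \<beta> \<in> S" .
      moreover have "aut_comp (iv \<alpha>) \<beta> \<in> line_stab l"
        using subgroup.m_closed[OF subgroup_line_stab] subgroup.m_inv_closed[OF subgroup_line_stab] \<alpha>l \<beta>l mN by fastforce
      ultimately have "aut_comp (iv \<alpha>) \<beta> = aut_id" using line_stab_inter_S[OF f] by blast
      then have "\<alpha> = \<beta>"
        using H.inv_mult_cancel(2)[of \<alpha> \<beta>] H.r_one[of \<alpha>] \<alpha>(1) \<beta>H by simp
      then have "aut_comp h \<alpha> = aut_comp h (aut_comp (iv h) (aut_comp \<alpha> h))" by (simp add: \<beta>_def)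
      also have "\<dots> = aut_comp \<alpha> h"
        using H.inv_mult_cancel(2)[of h "aut_comp \<alpha> h"] h(1) \<alpha>(1) aut_comp_in_H by simp
      finally show "z \<in> (\<lambda>h. fst h w) ` C" using h by (auto simp: C_def intro!: image_eqI[of _ _ h])
    qed
    show "(\<lambda>h. fst h w) ` C \<subseteq> bracket P L I x w \<alpha>"
    proof
      fix z assume "z \<in> (\<lambda>h. fst h w) ` C"
      then obtain h where h: "h \<in> H" "aut_comp h \<alpha> = aut_comp \<alpha> h" "z = fst h w" by (auto simp: C_def)
      have "flag N z (snd h l)" using flag_image[OF h(1) f] h by simp
      moreover have "snd \<alpha> (snd h l) = snd h l"
        using \<alpha>(2) arg_cong[OF h(2), of "\<lambda>f. snd f l"] by simp
      ultimately show "z \<in> bracket P L I x w \<alpha>"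
        using N by (auto simp: bracket_def flag_def)
    qed
  qed
  have "card C = card ((\<lambda>h. fst h w) ` C) * card (K N)"
  proof (rule H.card_fibers[OF sC _ KC])
    show "finite C" using finite_H by (simp add: C_def)
    fix g h assume "g \<in> C" "h \<in> C"
    then have gh: "g \<in> H" "h \<in> H" by (auto simp: C_def)
    have "fst g w = fst h w \<longleftrightarrow> fst (iv g) (fst h w) = w"
      using iv_act(1)[OF gh(1), of w] iv_act(2)[OF gh(1), of "fst h w"] by metis
    also have "\<dots> \<longleftrightarrow> aut_comp (iv g) h \<in> K N"
      using K_of_fixed_point[OF aut_comp_in_H[OF iv_in_H[OF gh(1)] gh(2)] N(1-4) wx] N by (auto simp: K_def)
    finally show "fst g w = fst h w \<longleftrightarrow> iv g \<otimes>\<^bsub>aut_grp H\<^esub> h \<in> K N" by simp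
  qed
  then have "s * s = card (bracket P L I x w \<alpha>) * (s * t)"
    unfolding cC br card_K[OF N(1,2)] .
  then have "s * s = s * (card (bracket P L I x w \<alpha>) * t)" by (simp only: mult_ac)
  then show ?thesis using s1 by simp
qed

text \<open>For \<open>s = t\<close> the bracket reduces to \<open>w\<close>. It only sees fixed
  lines that meet \<open>N\<close>; a fixed line meeting another line \<open>N'\<close> on
  \<open>x\<close> would put \<open>\<alpha>\<close> into \<open>K N'\<close>, which meets the
  stabilizer of \<open>l\<close> trivially.\<close>

lemma fixed_lines_of_square_order:
  assumes f: "flag N w l" and \<alpha>: "\<alpha> \<in> H" "snd \<alpha> l = l" "\<alpha> \<noteq> aut_id" and st: "s = t"
  shows "{M \<in> L. \<not> I x M \<and> snd \<alpha> M = M} = {M \<in> L. I w M \<and> \<not> I x M}"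
proof
  have N: "N \<in> L" "I x N" "w \<in> P" "I w N" "l \<in> L" "I w l" "\<not> I x l" using f by (auto simp: flag_def)
  have "card (bracket P L I x w \<alpha>) = 1" using card_bracket[OF f \<alpha>] st s1 by simp
  moreover have "w \<in> bracket P L I x w \<alpha>" using N \<alpha> by (auto simp: bracket_def)
  ultimately have br: "bracket P L I x w \<alpha> = {w}" by (metis card_1_singletonE singletonD)
  show "{M \<in> L. \<not> I x M \<and> snd \<alpha> M = M} \<subseteq> {M \<in> L. I w M \<and> \<not> I x M}"
  proof
    fix M assume "M \<in> {M \<in> L. \<not> I x M \<and> snd \<alpha> M = M}"
    then have M: "M \<in> L" "\<not> I x M" "snd \<alpha> M = M" by auto
    obtain N' v where g: "flag N' v M" using flag_of_line[OF M(1,2)] by blast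
    then have v: "N' \<in> L" "I x N'" "v \<in> P" "I v N'" "I v M" by (auto simp: flag_def)
    have "\<alpha> \<in> K N'" using line_stab_subset_K[OF g] M \<alpha> by (auto simp: line_stab_def)
    moreover have "\<alpha> \<in> line_stab l" using \<alpha> by (simp add: line_stab_def)
    ultimately have "N' = N" using line_stab_inter_K[OF f v(1,2)] \<alpha>(3) by blast
    then have "v \<in> bracket P L I x w \<alpha>" using v M N by (auto simp: bracket_def)
    then show "M \<in> {M \<in> L. I w M \<and> \<not> I x M}" using br v M by auto
  qed
  show "{M \<in> L. I w M \<and> \<not> I x M} \<subseteq> {M \<in> L. \<not> I x M \<and> snd \<alpha> M = M}"
    using stabilizer_fixes_pencil[OF f \<alpha>(1,2)] by auto
qed

lemma center_eq: "center H = S"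
proof
  obtain N where N: "N \<in> L" "I x N" using other_line[OF x_in_P] by blast
  obtain w l where f: "flag N w l" using ex_flag[OF N] by blast
  obtain m where E: "stgq_group (aut_grp H) S {N \<in> L. I x N} K (\<lambda>N. line_stab (m N)) s t"
    using stgq_group_at_flag[OF f] by blast
  show "center H \<subseteq> S"
    using stgq_group.central_in_S[OF E] by (auto simp: center_def)
  show "S \<subseteq> center H" using S_commutes S_subset_H by (auto simp: center_def)
qed

end

theorem mainTheorem6:
  fixes P :: "'p set" and L :: "'l set" and I :: "'p \<Rightarrow> 'l \<Rightarrow> bool"
    and s t :: nat and x :: 'p
    and H S :: "(('p \<Rightarrow> 'p) \<times> ('l \<Rightarrow> 'l)) set"
  assumes stgq: "skew_translation_GQ P L I s t x H S"
    and thick: "s > 1" "t > 1"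
    and odd_s: "s = t \<Longrightarrow> odd s"
    and star: "property_star P L I x H"
  shows "(\<forall>l\<in>L. \<not> I x l \<longrightarrow> (\<forall>h\<in>H. snd h l = l \<longrightarrow>
            (\<forall>M\<in>L. I (proj P L I l x) M \<longrightarrow> snd h M = M)))
       \<and> (\<forall>l\<in>L. \<not> I x l \<longrightarrow> (\<forall>\<alpha>\<in>H. snd \<alpha> l = l \<longrightarrow> \<alpha> \<noteq> aut_id \<longrightarrow>
            real (card (bracket P L I x (proj P L I l x) \<alpha>)) = real s / real t
            \<and> (s = t \<longrightarrow> {M\<in>L. \<not> I x M \<and> snd \<alpha> M = M}
                        = {M\<in>L. I (proj P L I l x) M \<and> \<not> I x M})))
       \<and> center H = S"
proof -
  have gq: "generalized_quadrangle P L I s t"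
    using stgq by (simp add: skew_translation_GQ_def elation_GQ_def)
  interpret stgq P L I s t x H S
    by unfold_locales (use gq stgq thick odd_s star in auto)
  have 1: "\<forall>M\<in>L. I (proj P L I l x) M \<longrightarrow> snd h M = M"
    if l: "l \<in> L" "\<not> I x l" "h \<in> H" "snd h l = l" for l h
  proof -
    obtain N w where f: "flag N w l" using flag_of_line[OF l(1,2)] by blast
    show ?thesis unfolding proj_flag[OF f] using stabilizer_fixes_pencil[OF f l(3,4)] by blast
  qed
  have 2: "real (card (bracket P L I x (proj P L I l x) \<alpha>)) = real s / real t
      \<and> (s = t \<longrightarrow> {M\<in>L. \<not> I x M \<and> snd \<alpha> M = M} = {M\<in>L. I (proj P L I l x) M \<and> \<not> I x M})"
    if l: "l \<in> L" "\<not> I x l" "\<alpha> \<in> H" "snd \<alpha> l = l" "\<alpha> \<noteq> aut_id" for l \<alpha>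
  proof -
    obtain N w where f: "flag N w l" using flag_of_line[OF l(1,2)] by blast
    have "real (card (bracket P L I x w \<alpha>)) * real t = real s"
      unfolding of_nat_mult[symmetric] card_bracket[OF f l(3-5)] ..
    then show ?thesis
      unfolding proj_flag[OF f] using fixed_lines_of_square_order[OF f l(3-5)] thick
      by (simp add: field_simps)
  qed
  show ?thesis
    by (intro conjI ballI impI center_eq) (use 1 2 in blast)+
qed

end
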